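(* Let $G=\mathrm{GSp}_{2n}$ over $\mathbb F_q$. Fix a character $\chi\colon P\to\mathbb C^\times$, written as $\chi=(\alpha\circ m)(\beta\circ\chi_{\det})$ with characters $\alpha,\beta\colon\mathbb F_q^\times\to\mathbb C^\times$. Suppose that $\beta^2=1$ but $\beta\ne1$. (a) If $n=2m$ is even, then the operator $I\circ I$ on $\operatorname{Ind}_P^G\chi$ is diagonalizable and has eigenvalues $$\left\{q^{2m^2+2i^2}:0\le i\le m\right\}.$$ (b) If $n=2m+1$ is odd, then the operator $I\circ I$ on $\operatorname{Ind}_P^G\chi$ is diagonalizable and has eigenvalues $$\left\{\beta(-1)q^{2m(m+1)+2i(i+1)+1}:0\le i\le m\right\}.$$
   Context: $q$ is an odd prime power with $3\nmid q$, and $n\ge1$. $J=\begin{bmatrix}0&-1_n\\1_n&0\end{bmatrix}$. $\mathrm{GSp}_{2n}$ consists of $g\in\mathrm{GL}_{2n}(\mathbb F_q)$ with $g^\intercal Jg=\lambda J$ for some $\lambda\in\mathbb F_q^\times$. $P=\left\{\begin{bmatrix}A&B\\0&D\end{bmatrix}\in G\right\}$ with $n\times n$ blocks, and $U=\left\{\begin{bmatrix}1_n&B\\0&1_n\end{bmatrix}\in G\right\}$. $\chi_{\det}\colon P\to\mathbb F_q^\times$ is $\begin{bmatrix}A&B\\0&D\end{bmatrix}\mapsto(\det D)^{-1}$, and $m\colon P\to\mathbb F_q^\times$ is $\begin{bmatrix}\lambda A&B\\0&A^{-\intercal}\end{bmatrix}\mapsto\lambda$. (Every character of $P$ has the form $(\alpha\circ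 m)(\beta\circ\chi_{\det})$; the map $m$ should not be confused with the integer $m$ in (a), (b).) The character $\chi^J$ is $\chi^J\left(\begin{bmatrix}A&B\\0&D\end{bmatrix}\right)=\chi\left(\begin{bmatrix}D&0\\0&A\end{bmatrix}\right)$, and $(\chi^J)^J=\chi$. $\operatorname{Ind}_P^G\chi$ is the space of functions $f\colon G\to\mathbb C$ with $f(pg)=\chi(p)f(g)$ for $p\in P$, $g\in G$. The formula $(If)(g)=\sum_{u\in U}f(J^{-1}ug)$ defines maps $\operatorname{Ind}_P^G\chi\to\operatorname{Ind}_P^G\chi^J$ and $\operatorname{Ind}_P^G\chi^J\to\operatorname{Ind}_P^G\chi$, both denoted $I$; $I\circ I$ is their composite. *)

theory Defs
  imports
    "Jordan_Normal_Form.Determinant"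
    "HOL-Algebra.Group"
    "HOL-Library.Function_Algebras"
    "HOL-Library.Cardinality"
begin

definition mult_group :: "'a::field monoid" where
  "mult_group = \<lparr>carrier = UNIV - {0}, mult = (*), one = 1\<rparr>"

definition J_mat :: "nat \<Rightarrow> 'a::field mat" where
  "J_mat n = four_block_mat (0\<^sub>m n n) (- 1\<^sub>m n) (1\<^sub>m n) (0\<^sub>m n n)"

definition GSp :: "nat \<Rightarrow> 'a::field mat monoid" where
  "GSp n = \<lparr>carrier = {g \<in> carrier_mat (2 * n) (2 * n). invertible_mat g \<and>
                         (\<exists>l. l \<noteq> 0 \<and> transpose_mat g * J_mat n * g = l \<cdot>\<^sub>m J_mat n)},
            mult = (*), one = 1\<^sub>m (2 * n)\<rparr>"

definition siegel_parabolic :: "nat \<Rightarrow> 'a::field mat set" where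
  "siegel_parabolic n = {g \<in> carrier (GSp n).
     \<exists>A\<in>carrier_mat n n. \<exists>B\<in>carrier_mat n n. \<exists>D\<in>carrier_mat n n.
       g = four_block_mat A B (0\<^sub>m n n) D}"

definition unipotent_radical :: "nat \<Rightarrow> 'a::field mat set" where
  "unipotent_radical n = {g \<in> carrier (GSp n).
     \<exists>B\<in>carrier_mat n n. g = four_block_mat (1\<^sub>m n) B (0\<^sub>m n n) (1\<^sub>m n)}"

definition siegel_group :: "nat \<Rightarrow> 'a::field mat monoid" where
  "siegel_group n = GSp n\<lparr>carrier := siegel_parabolic n\<rparr>"

definition chi_det :: "nat \<Rightarrow> 'a::field mat \<Rightarrow> 'a" where
  "chi_det n p = (case split_block p n n of (A, B, C, D) \<Rightarrow> inverse (det D))"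

lemma J_mat_carrier: "J_mat n \<in> carrier_mat (2 * n) (2 * n)"
  unfolding J_mat_def mult_2 by (intro four_block_carrier_mat) auto

lemma GSp_mult: "x \<otimes>\<^bsub>GSp n\<^esub> y = x * y" and GSp_one: "\<one>\<^bsub>GSp n\<^esub> = 1\<^sub>m (2 * n)"
  by (simp_all add: GSp_def)

lemma GSp_iff:
  "g \<in> carrier (GSp n) \<longleftrightarrow> g \<in> carrier_mat (2 * n) (2 * n) \<and>
     (\<exists>h\<in>carrier_mat (2 * n) (2 * n). g * h = 1\<^sub>m (2 * n) \<and> h * g = 1\<^sub>m (2 * n)) \<and>
     (\<exists>l. l \<noteq> 0 \<and> transpose_mat g * J_mat n * g = l \<cdot>\<^sub>m J_mat n)"
proof -
  have "(\<exists>h. inverts_mat g h \<and> inverts_mat h g) \<longleftrightarrow>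
        (\<exists>h\<in>carrier_mat (2 * n) (2 * n). g * h = 1\<^sub>m (2 * n) \<and> h * g = 1\<^sub>m (2 * n))"
    if g: "g \<in> carrier_mat (2 * n) (2 * n)"
  proof
    assume "\<exists>h. inverts_mat g h \<and> inverts_mat h g"
    then obtain h where h: "g * h = 1\<^sub>m (dim_row g)" "h * g = 1\<^sub>m (dim_row h)"
      unfolding inverts_mat_def by blast
    have "dim_col h = 2 * n"
      using arg_cong[OF h(1), of dim_col] g by simp
    moreover have "dim_row h = 2 * n"
      using arg_cong[OF h(2), of dim_col] g by simp
    ultimately show "\<exists>h\<in>carrier_mat (2 * n) (2 * n). g * h = 1\<^sub>m (2 * n) \<and> h * g = 1\<^sub>m (2 * n)"
      using h g by (intro bexI[of _ h]) auto
  next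
    assume "\<exists>h\<in>carrier_mat (2 * n) (2 * n). g * h = 1\<^sub>m (2 * n) \<and> h * g = 1\<^sub>m (2 * n)"
    then show "\<exists>h. inverts_mat g h \<and> inverts_mat h g"
      using g unfolding inverts_mat_def by auto
  qed
  then show ?thesis
    unfolding GSp_def invertible_mat_def by (auto simp: square_mat.simps)
qed

lemma transpose_smult: "transpose_mat (k \<cdot>\<^sub>m A) = k \<cdot>\<^sub>m transpose_mat (A :: 'a::field mat)"
  by (rule eq_matI) auto

lemma one_smult_m: "1 \<cdot>\<^sub>m A = (A :: 'a::field mat)"
  by (rule eq_matI) auto

lemma smult_smult_m: "(k * l) \<cdot>\<^sub>m A = k \<cdot>\<^sub>m (l \<cdot>\<^sub>m (A :: 'a::field mat))"
  by (rule eq_matI) (auto simp: mult.assoc)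

lemma group_GSp: "group (GSp n :: 'a::field mat monoid)"
proof (rule groupI)
  let ?N = "2 * n"
  let ?J = "J_mat n :: 'a mat"
  note J = J_mat_carrier[of n, where 'a = 'a]
  have aux: "transpose_mat (x * y) * ?J * (x * y) =
      transpose_mat y * (transpose_mat x * ?J * x) * y"
    if x: "x \<in> carrier_mat ?N ?N" and y: "y \<in> carrier_mat ?N ?N" for x y :: "'a mat"
  proof -
    note [simp] = assoc_mult_mat[of _ ?N ?N _ ?N _ ?N] mult_carrier_mat[of _ ?N ?N _ ?N]
    show ?thesis
      using x y J by (simp add: transpose_mult[OF x y])
  qed
  have sc: "transpose_mat y * (l \<cdot>\<^sub>m ?J) * y = l \<cdot>\<^sub>m (transpose_mat y * ?J * y)"
    if y: "y \<in> carrier_mat ?N ?N" for l and y :: "'a mat"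
    using y J by (simp add: mult_smult_distrib[of _ ?N ?N _ ?N] mult_smult_assoc_mat[of _ ?N ?N _ ?N]
        mult_carrier_mat[of _ ?N ?N _ ?N])
  show "x \<otimes>\<^bsub>GSp n\<^esub> y \<in> carrier (GSp n)"
    if xy: "x \<in> carrier (GSp n)" "y \<in> carrier (GSp n)" for x y :: "'a mat"
  proof -
    from xy obtain x' y' l k where x: "x \<in> carrier_mat ?N ?N" "x' \<in> carrier_mat ?N ?N"
        "x * x' = 1\<^sub>m ?N" "x' * x = 1\<^sub>m ?N"
      and y: "y \<in> carrier_mat ?N ?N" "y' \<in> carrier_mat ?N ?N" "y * y' = 1\<^sub>m ?N" "y' * y = 1\<^sub>m ?N"
      and l: "l \<noteq> 0" "transpose_mat x * ?J * x = l \<cdot>\<^sub>m ?J"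
      and k: "k \<noteq> 0" "transpose_mat y * ?J * y = k \<cdot>\<^sub>m ?J"
      unfolding GSp_iff by blast
    have "(x * y) * (y' * x') = x * (y * y') * x'" "(y' * x') * (x * y) = y' * (x' * x) * y"
      using x(1,2) y(1,2)
      by (simp_all add: assoc_mult_mat[of _ ?N ?N _ ?N _ ?N] mult_carrier_mat[of _ ?N ?N _ ?N])
    then have "(x * y) * (y' * x') = 1\<^sub>m ?N" "(y' * x') * (x * y) = 1\<^sub>m ?N"
      using x y by simp_all
    moreover have "transpose_mat (x * y) * ?J * (x * y) = (l * k) \<cdot>\<^sub>m ?J"
      unfolding aux[OF x(1) y(1)] l(2) sc[OF y(1)] k(2) by (simp add: smult_smult_m)
    moreover have "x * y \<in> carrier_mat ?N ?N" "y' * x' \<in> carrier_mat ?N ?N" "l * k \<noteq> 0"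
      using x(1,2) y(1,2) l(1) k(1) by (auto intro: mult_carrier_mat)
    ultimately show ?thesis
      unfolding GSp_iff GSp_mult by blast
  qed
  show "\<one>\<^bsub>GSp n\<^esub> \<in> carrier (GSp n :: 'a mat monoid)"
    unfolding GSp_iff GSp_one using J by (auto intro!: exI[of _ 1] bexI[of _ "1\<^sub>m ?N"])
  show "x \<otimes>\<^bsub>GSp n\<^esub> y \<otimes>\<^bsub>GSp n\<^esub> z = x \<otimes>\<^bsub>GSp n\<^esub> (y \<otimes>\<^bsub>GSp n\<^esub> z)"
    if "x \<in> carrier (GSp n)" "y \<in> carrier (GSp n)" "z \<in> carrier (GSp n)" for x y z :: "'a mat"
    using that unfolding GSp_iff GSp_mult by (auto intro: assoc_mult_mat)
  show "\<one>\<^bsub>GSp n\<^esub> \<otimes>\<^bsub>GSp n\<^esub> x = x" if "x \<in> carrier (GSp n)" for x :: "'a mat"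
    using that unfolding GSp_iff GSp_mult GSp_one by auto
  show "\<exists>y\<in>carrier (GSp n). y \<otimes>\<^bsub>GSp n\<^esub> x = \<one>\<^bsub>GSp n\<^esub>" if "x \<in> carrier (GSp n)" for x :: "'a mat"
  proof -
    from that obtain x' l where x: "x \<in> carrier_mat ?N ?N" "x' \<in> carrier_mat ?N ?N"
        "x * x' = 1\<^sub>m ?N" "x' * x = 1\<^sub>m ?N"
      and l: "l \<noteq> 0" "transpose_mat x * ?J * x = l \<cdot>\<^sub>m ?J"
      unfolding GSp_iff by blast
    have "l \<cdot>\<^sub>m (transpose_mat x' * ?J * x') = ?J"
      using aux[OF x(1,2)] unfolding x(3) l(2) sc[OF x(2)] using J by simp
    then have "inverse l \<cdot>\<^sub>m ?J = (inverse l * l) \<cdot>\<^sub>m (transpose_mat x' * ?J * x')"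
      by (metis smult_smult_m)
    then have "transpose_mat x' * ?J * x' = inverse l \<cdot>\<^sub>m ?J"
      using l(1) by (simp add: one_smult_m)
    moreover have "inverse l \<noteq> 0" using l(1) by simp
    ultimately have "x' \<in> carrier (GSp n)"
      unfolding GSp_iff using x by blast
    then show ?thesis
      using x unfolding GSp_mult GSp_one by blast
  qed
qed

lemma J_mat_sq:
  "transpose_mat (J_mat n :: 'a::field mat) * J_mat n = 1\<^sub>m (2 * n)"
  "J_mat n * transpose_mat (J_mat n :: 'a::field mat) = 1\<^sub>m (2 * n)"
proof -
  have T: "transpose_mat (J_mat n :: 'a mat) =
      four_block_mat (0\<^sub>m n n) (1\<^sub>m n) (- 1\<^sub>m n) (0\<^sub>m n n)"
    unfolding J_mat_def
    by (subst transpose_four_block_mat[where ?nr1.0 = n and ?nr2.0 = n and ?nc1.0 = n and ?nc2.0 = n])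
      (auto simp: transpose_uminus)
  have m: "(- 1\<^sub>m n) * (- 1\<^sub>m n) = (1\<^sub>m n :: 'a mat)"
    by (simp add: uminus_mult_left_mat uminus_mult_right_mat)
  have z: "- 0\<^sub>m n n = (0\<^sub>m n n :: 'a mat)"
    by (rule eq_matI) auto
  show "transpose_mat (J_mat n :: 'a mat) * J_mat n = 1\<^sub>m (2 * n)"
    unfolding T unfolding J_mat_def
    by (subst mult_four_block_mat[where ?n1.0 = n and ?n2.0 = n]) (auto simp: m z mult_2)
  show "J_mat n * transpose_mat (J_mat n :: 'a mat) = 1\<^sub>m (2 * n)"
    unfolding T unfolding J_mat_def
    by (subst mult_four_block_mat[where ?n1.0 = n and ?n2.0 = n]) (auto simp: m z mult_2)
qed

lemma J_mat_in_GSp: "J_mat n \<in> carrier (GSp n :: 'a::field mat monoid)"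
  unfolding GSp_iff
  using J_mat_carrier[of n, where 'a = 'a] J_mat_sq[of n, where 'a = 'a]
  by (auto intro!: bexI[of _ "transpose_mat (J_mat n)"] exI[of _ 1])

text \<open>In \<open>mult_char\<close> the matrix \<open>D\<close> is the inverse transpose of \<open>A\<close>; the scalar is unique
  only for \<open>n \<ge> 1\<close>, see \<open>mult_char_unique\<close> below.\<close>

definition mult_char :: "nat \<Rightarrow> 'a::field mat \<Rightarrow> 'a" where
  "mult_char n p = (THE l. \<exists>A\<in>carrier_mat n n. \<exists>B\<in>carrier_mat n n. \<exists>D\<in>carrier_mat n n.
     inverts_mat (transpose_mat A) D \<and> inverts_mat D (transpose_mat A) \<and>
     p = four_block_mat (l \<cdot>\<^sub>m A) B (0\<^sub>m n n) D)"

lemma siegel_subset: "siegel_parabolic n \<subseteq> carrier (GSp n)"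
  and unipotent_subset: "unipotent_radical n \<subseteq> siegel_parabolic n"
  unfolding siegel_parabolic_def unipotent_radical_def by (auto 0 4)

lemma split_block_four_block:
  assumes "A \<in> carrier_mat n n" "B \<in> carrier_mat n n" "C \<in> carrier_mat n n" "D \<in> carrier_mat n n"
  shows "split_block (four_block_mat A B C D) n n = (A, B, C, D)"
  using assms unfolding split_block_def Let_def by (auto intro!: eq_matI)

lemma siegel_blocks:
  assumes c: "A \<in> carrier_mat n n" "B \<in> carrier_mat n n" "D \<in> carrier_mat n n"
    and p: "four_block_mat A B (0\<^sub>m n n) D \<in> carrier (GSp n :: 'a::field mat monoid)"
  obtains l where "l \<noteq> 0" "transpose_mat A * D = l \<cdot>\<^sub>m 1\<^sub>m n"
proof -
  let ?p = "four_block_mat A B (0\<^sub>m n n) D"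
  obtain l where l: "l \<noteq> 0" "transpose_mat ?p * J_mat n * ?p = l \<cdot>\<^sub>m J_mat n"
    using p unfolding GSp_iff by blast
  have T: "transpose_mat ?p = four_block_mat (transpose_mat A) (0\<^sub>m n n) (transpose_mat B) (transpose_mat D)"
    using c by (subst transpose_four_block_mat) auto
  have TJ: "transpose_mat ?p * J_mat n =
      four_block_mat (0\<^sub>m n n) (- transpose_mat A) (transpose_mat D) (- transpose_mat B)"
    unfolding T J_mat_def using c
    by (subst mult_four_block_mat[where ?n1.0 = n and ?n2.0 = n and ?nr1.0 = n and ?nr2.0 = n
          and ?nc1.0 = n and ?nc2.0 = n])
      (auto simp: uminus_mult_right_mat[symmetric] intro!: cong_four_block_mat eq_matI)
  have TJp: "transpose_mat ?p * J_mat n * ?p =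
      four_block_mat (0\<^sub>m n n) (- transpose_mat A * D) (transpose_mat D * A)
        (transpose_mat D * B + - transpose_mat B * D)"
    unfolding TJ using c
    by (subst mult_four_block_mat[where ?n1.0 = n and ?n2.0 = n and ?nr1.0 = n and ?nr2.0 = n
          and ?nc1.0 = n and ?nc2.0 = n]) auto
  have lJ: "l \<cdot>\<^sub>m J_mat n = four_block_mat (0\<^sub>m n n) (l \<cdot>\<^sub>m (- 1\<^sub>m n)) (l \<cdot>\<^sub>m 1\<^sub>m n) (0\<^sub>m n n)"
    unfolding J_mat_def by (subst smult_four_block_mat) auto
  have "split_block (four_block_mat (0\<^sub>m n n) (- transpose_mat A * D) (transpose_mat D * A)
        (transpose_mat D * B + - transpose_mat B * D)) n n =
      split_block (four_block_mat (0\<^sub>m n n) (l \<cdot>\<^sub>m (- 1\<^sub>m n)) (l \<cdot>\<^sub>m 1\<^sub>m n) (0\<^sub>m n n)) n n"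
    using TJp l(2) lJ by simp
  then have "- transpose_mat A * D = l \<cdot>\<^sub>m (- 1\<^sub>m n)"
    using c by (subst (asm) (1 2) split_block_four_block) auto
  then have e: "- (transpose_mat A * D) = l \<cdot>\<^sub>m (- 1\<^sub>m n)"
    using c by simp
  have "transpose_mat A * D = l \<cdot>\<^sub>m 1\<^sub>m n"
    using arg_cong[OF e, of uminus] c by (auto intro!: eq_matI simp: mat_eq_iff)
  then show thesis using that l(1) by blast
qed

lemma mult_char_unique:
  assumes n: "n \<ge> 1" and p: "(p :: 'a::field mat) \<in> siegel_parabolic n"
  shows "\<exists>!l. \<exists>A\<in>carrier_mat n n. \<exists>B\<in>carrier_mat n n. \<exists>D\<in>carrier_mat n n.
     inverts_mat (transpose_mat A) D \<and> inverts_mat D (transpose_mat A) \<and>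
     p = four_block_mat (l \<cdot>\<^sub>m A) B (0\<^sub>m n n) D" (is "\<exists>!l. ?Q l")
proof -
  obtain A B D where c: "A \<in> carrier_mat n n" "B \<in> carrier_mat n n" "D \<in> carrier_mat n n"
    and pe: "p = four_block_mat A B (0\<^sub>m n n) D"
    using p unfolding siegel_parabolic_def by blast
  obtain l where l: "l \<noteq> 0" "transpose_mat A * D = l \<cdot>\<^sub>m 1\<^sub>m n"
    using siegel_blocks[OF c] p siegel_subset unfolding pe by blast
  let ?A = "inverse l \<cdot>\<^sub>m A"
  have A: "?A \<in> carrier_mat n n" using c by simp
  have tA: "transpose_mat ?A = inverse l \<cdot>\<^sub>m transpose_mat A" by (rule eq_matI) auto
  have "transpose_mat ?A * D = (inverse l * l) \<cdot>\<^sub>m 1\<^sub>m n"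
    unfolding tA smult_smult_m l(2)[symmetric] using c
    by (simp add: mult_smult_assoc_mat[of _ n n])
  then have inv1: "transpose_mat ?A * D = 1\<^sub>m n" using l(1) by (simp add: one_smult_m)
  then have inv2: "D * transpose_mat ?A = 1\<^sub>m n"
    using mat_mult_left_right_inverse[OF _ c(3)] A by simp
  have "A = l \<cdot>\<^sub>m ?A" unfolding smult_smult_m[symmetric] using l(1) by (simp add: one_smult_m)
  then have "?Q l"
    using A c inv1 inv2 unfolding inverts_mat_def pe by (intro bexI[of _ ?A] bexI[of _ B] bexI[of _ D]) auto
  moreover have "k = l" if k: "?Q k" for k
  proof -
    obtain A' B' D' where c': "A' \<in> carrier_mat n n" "B' \<in> carrier_mat n n" "D' \<in> carrier_mat n n"
      and i0: "inverts_mat (transpose_mat A') D'"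
      and pe': "p = four_block_mat (k \<cdot>\<^sub>m A') B' (0\<^sub>m n n) D'"
      using k by blast
    have i': "transpose_mat A' * D' = 1\<^sub>m n"
      using i0 c'(1) unfolding inverts_mat_def by simp
    have "split_block (four_block_mat (k \<cdot>\<^sub>m A') B' (0\<^sub>m n n) D') n n =
          split_block (four_block_mat A B (0\<^sub>m n n) D) n n"
      using pe pe' by simp
    then have e: "k \<cdot>\<^sub>m A' = A" "D' = D"
      using c c' by (simp_all add: split_block_four_block)
    have "transpose_mat A * D = k \<cdot>\<^sub>m (transpose_mat A' * D')"
      unfolding e(1)[symmetric] e(2) using c c'
      by (simp add: mult_smult_assoc_mat[of _ n n] transpose_smult)
    then have "k \<cdot>\<^sub>m 1\<^sub>m n = l \<cdot>\<^sub>m (1\<^sub>m n :: 'a mat)"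
      using i' l(2) by simp
    then have "(k \<cdot>\<^sub>m 1\<^sub>m n) $$ (0, 0) = (l \<cdot>\<^sub>m (1\<^sub>m n :: 'a mat)) $$ (0, 0)"
      by simp
    then show ?thesis using n by simp
  qed
  ultimately show ?thesis by blast
qed

definition J_twist :: "nat \<Rightarrow> ('a::field mat \<Rightarrow> complex) \<Rightarrow> 'a mat \<Rightarrow> complex" where
  "J_twist n \<chi> p =
     (case split_block p n n of (A, B, C, D) \<Rightarrow> \<chi> (four_block_mat D (0\<^sub>m n n) (0\<^sub>m n n) A))"

text \<open>Functions on the group are represented by functions on all matrices that vanish outside
  the group.\<close>

definition induced :: "nat \<Rightarrow> ('a::field mat \<Rightarrow> complex) \<Rightarrow> ('a mat \<Rightarrow> complex) set" where
  "induced n \<chi> = {f. (\<forall>g. g \<notin> carrier (GSp n) \<longrightarrow> f g = 0) \<and>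
     (\<forall>p\<in>siegel_parabolic n. \<forall>g\<in>carrier (GSp n). f (p * g) = \<chi> p * f g)}"

definition intertwiner :: "nat \<Rightarrow> ('a::field mat \<Rightarrow> complex) \<Rightarrow> 'a mat \<Rightarrow> complex" where
  "intertwiner n f g = (if g \<in> carrier (GSp n)
     then \<Sum>u\<in>unipotent_radical n. f (inv\<^bsub>GSp n\<^esub> (J_mat n) * u * g) else 0)"

text \<open>The formula defining the operator does not involve \<open>\<chi>\<close>; its source and target are as follows.\<close>

lemma intertwiner_induced:
  fixes \<chi> :: "'a::{field,finite} mat \<Rightarrow> complex"
  assumes f: "f \<in> induced n \<chi>"
  shows "intertwiner n f \<in> induced n (J_twist n \<chi>)"
proof -
  let ?G = "GSp n :: 'a mat monoid"
  let ?J = "J_mat n :: 'a mat"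
  interpret group ?G by (rule group_GSp)
  note Jc = J_mat_in_GSp[of n, where 'a = 'a]
  have main: "intertwiner n f (p * g) = J_twist n \<chi> p * intertwiner n f g"
    if p: "p \<in> siegel_parabolic n" and g: "g \<in> carrier ?G" for p g
  proof -
    obtain A B D where c: "A \<in> carrier_mat n n" "B \<in> carrier_mat n n" "D \<in> carrier_mat n n"
      and pe: "p = four_block_mat A B (0\<^sub>m n n) D"
      using p unfolding siegel_parabolic_def by blast
    have pG: "p \<in> carrier ?G" using p siegel_subset by blast
    obtain l where l: "l \<noteq> 0" "transpose_mat A * D = l \<cdot>\<^sub>m 1\<^sub>m n"
      using siegel_blocks[OF c] pG unfolding pe by blast
    define A' where "A' = inverse l \<cdot>\<^sub>m transpose_mat D"
    define D' where "D' = inverse l \<cdot>\<^sub>m transpose_mat A"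
    have c': "A' \<in> carrier_mat n n" "D' \<in> carrier_mat n n"
      using c unfolding A'_def D'_def by auto
    have D'D: "D' * D = 1\<^sub>m n"
      unfolding D'_def using c l by (simp add: mult_smult_assoc_mat[of _ n n] smult_smult_m[symmetric] one_smult_m)
    have "transpose_mat (transpose_mat A * D) = transpose_mat (l \<cdot>\<^sub>m (1\<^sub>m n :: 'a mat))"
      using l by simp
    then have tDA: "transpose_mat D * A = l \<cdot>\<^sub>m 1\<^sub>m n"
      using c by (simp add: transpose_mult[of _ n n] transpose_smult)
    have A'A: "A' * A = 1\<^sub>m n"
      unfolding A'_def using c l tDA
      by (simp add: mult_smult_assoc_mat[of _ n n] smult_smult_m[symmetric] one_smult_m)
    have DD': "D * D' = 1\<^sub>m n" and AA': "A * A' = 1\<^sub>m n"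
      using mat_mult_left_right_inverse D'D A'A c c' by blast+
    define d where "d = four_block_mat A (0\<^sub>m n n) (0\<^sub>m n n) D"
    define d' where "d' = four_block_mat A' (0\<^sub>m n n) (0\<^sub>m n n) D'"
    define w where "w = four_block_mat D (0\<^sub>m n n) (0\<^sub>m n n) A"
    define w' where "w' = four_block_mat D' (0\<^sub>m n n) (0\<^sub>m n n) A'"
    have cc: "d \<in> carrier_mat (2 * n) (2 * n)" "d' \<in> carrier_mat (2 * n) (2 * n)"
      "w \<in> carrier_mat (2 * n) (2 * n)" "w' \<in> carrier_mat (2 * n) (2 * n)"
      unfolding d_def d'_def w_def w'_def mult_2 using c c' by (auto intro!: four_block_carrier_mat)
    note mfb = mult_four_block_mat[where ?n1.0 = n and ?n2.0 = n and ?nr1.0 = n and ?nr2.0 = n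
          and ?nc1.0 = n and ?nc2.0 = n]
    have dd': "d * d' = 1\<^sub>m (2 * n)" "d' * d = 1\<^sub>m (2 * n)"
      "w * w' = 1\<^sub>m (2 * n)" "w' * w = 1\<^sub>m (2 * n)"
      unfolding d_def d'_def w_def w'_def using c c'
      by (subst mfb; auto simp: D'D A'A DD' AA' mult_2)+
    have form: "transpose_mat (four_block_mat X (0\<^sub>m n n) (0\<^sub>m n n) Y) * ?J *
        four_block_mat X (0\<^sub>m n n) (0\<^sub>m n n) Y = l \<cdot>\<^sub>m ?J"
      if X: "X \<in> carrier_mat n n" "Y \<in> carrier_mat n n"
        and XY: "transpose_mat X * Y = l \<cdot>\<^sub>m 1\<^sub>m n" "transpose_mat Y * X = l \<cdot>\<^sub>m 1\<^sub>m n" for X Y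
    proof -
      have "transpose_mat (four_block_mat X (0\<^sub>m n n) (0\<^sub>m n n) Y) =
          four_block_mat (transpose_mat X) (0\<^sub>m n n) (0\<^sub>m n n) (transpose_mat Y)"
        using X by (subst transpose_four_block_mat) auto
      moreover have "four_block_mat (transpose_mat X) (0\<^sub>m n n) (0\<^sub>m n n) (transpose_mat Y) * ?J =
          four_block_mat (0\<^sub>m n n) (- transpose_mat X) (transpose_mat Y) (0\<^sub>m n n)"
        unfolding J_mat_def using X by (subst mfb) (auto intro!: cong_four_block_mat eq_matI)
      moreover have "four_block_mat (0\<^sub>m n n) (- transpose_mat X) (transpose_mat Y) (0\<^sub>m n n) *
          four_block_mat X (0\<^sub>m n n) (0\<^sub>m n n) Y =
          four_block_mat (0\<^sub>m n n) (- (l \<cdot>\<^sub>m 1\<^sub>m n)) (l \<cdot>\<^sub>m 1\<^sub>m n) (0\<^sub>m n n)"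
        using X by (subst mfb) (auto simp: XY intro!: cong_four_block_mat)
      moreover have "l \<cdot>\<^sub>m ?J = four_block_mat (0\<^sub>m n n) (- (l \<cdot>\<^sub>m 1\<^sub>m n)) (l \<cdot>\<^sub>m 1\<^sub>m n) (0\<^sub>m n n)"
        unfolding J_mat_def
        by (subst smult_four_block_mat) (auto intro!: cong_four_block_mat eq_matI)
      ultimately show ?thesis by simp
    qed
    have dG: "d \<in> carrier ?G" and wG: "w \<in> carrier ?G"
      unfolding GSp_iff using cc dd' l(1) form[OF c(1,3) l(2) tDA] form[OF c(3,1) tDA l(2)]
      unfolding d_def[symmetric] w_def[symmetric] by blast+
    have wP: "w \<in> siegel_parabolic n"
      unfolding siegel_parabolic_def
    proof (intro CollectI conjI)
      show "\<exists>A\<in>carrier_mat n n. \<exists>B\<in>carrier_mat n n. \<exists>D\<in>carrier_mat n n.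
          w = four_block_mat A B (0\<^sub>m n n) D"
        by (rule bexI[OF bexI[OF bexI[OF _ c(1)] zero_carrier_mat] c(3)]) (rule w_def)
    qed (rule wG)
    have invd: "inv\<^bsub>?G\<^esub> d = d'"
    proof -
      have "d \<otimes>\<^bsub>?G\<^esub> inv\<^bsub>?G\<^esub> d = \<one>\<^bsub>?G\<^esub>" using dG by simp
      then have e: "d * inv\<^bsub>?G\<^esub> d = 1\<^sub>m (2 * n)" by (simp add: GSp_mult GSp_one)
      have ic: "inv\<^bsub>?G\<^esub> d \<in> carrier_mat (2 * n) (2 * n)"
        using inv_closed[OF dG] unfolding GSp_iff by blast
      have "d' * (d * inv\<^bsub>?G\<^esub> d) = inv\<^bsub>?G\<^esub> d"
        using cc ic dd'(2) by (simp flip: assoc_mult_mat[of _ "2 * n" "2 * n" _ "2 * n" _ "2 * n"])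
      then show ?thesis using e cc by simp
    qed
    have dJ: "d * ?J = ?J * w"
    proof -
      have "d * ?J = four_block_mat (0\<^sub>m n n) (- A) D (0\<^sub>m n n)"
        unfolding d_def J_mat_def using c
        by (subst mfb) (auto intro!: cong_four_block_mat eq_matI)
      moreover have "?J * w = four_block_mat (0\<^sub>m n n) (- A) D (0\<^sub>m n n)"
        unfolding w_def J_mat_def using c
        by (subst mfb) (auto intro!: cong_four_block_mat eq_matI)
      ultimately show ?thesis by simp
    qed
    have Jd: "inv\<^bsub>?G\<^esub> ?J \<otimes>\<^bsub>?G\<^esub> d = w \<otimes>\<^bsub>?G\<^esub> inv\<^bsub>?G\<^esub> ?J"
    proof -
      have "d \<otimes>\<^bsub>?G\<^esub> ?J = ?J \<otimes>\<^bsub>?G\<^esub> w" using dJ by (simp add: GSp_mult)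
      then have "d = ?J \<otimes>\<^bsub>?G\<^esub> w \<otimes>\<^bsub>?G\<^esub> inv\<^bsub>?G\<^esub> ?J"
        using dG wG Jc by (metis inv_solve_right m_closed)
      then show ?thesis using dG wG Jc by (simp add: m_assoc[symmetric])
    qed
    define \<phi> where "\<phi> u = inv\<^bsub>?G\<^esub> d \<otimes>\<^bsub>?G\<^esub> u \<otimes>\<^bsub>?G\<^esub> p" for u
    have UG: "u \<in> carrier ?G" if "u \<in> unipotent_radical n" for u
      using that siegel_subset unipotent_subset by blast
    have phiU: "\<phi> u \<in> unipotent_radical n" if u: "u \<in> unipotent_radical n" for u
    proof -
      obtain X where X: "X \<in> carrier_mat n n" "u = four_block_mat (1\<^sub>m n) X (0\<^sub>m n n) (1\<^sub>m n)"
        using u unfolding unipotent_radical_def by blast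
      have "d' * u = four_block_mat A' (A' * X) (0\<^sub>m n n) D'"
        unfolding d'_def X(2) using c' X by (subst mfb) (auto intro!: cong_four_block_mat)
      then have "d' * u * p = four_block_mat (1\<^sub>m n) (A' * B + A' * X * D) (0\<^sub>m n n) (1\<^sub>m n)"
        unfolding pe using c c' X by (subst \<open>d' * u = _\<close>, subst mfb) (auto simp: A'A D'D)
      moreover have "A' * B + A' * X * D \<in> carrier_mat n n" using c c' X by auto
      moreover have "\<phi> u \<in> carrier ?G" using UG[OF u] dG pG unfolding \<phi>_def by simp
      ultimately show ?thesis
        unfolding unipotent_radical_def \<phi>_def invd GSp_mult by auto
    qed
    have fin: "finite (unipotent_radical n :: 'a mat set)"
    proof (rule finite_subset)
      show "unipotent_radical n \<subseteq> (\<lambda>X. four_block_mat (1\<^sub>m n) X (0\<^sub>m n n) (1\<^sub>m n)) `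
          (carrier_mat n n :: 'a mat set)"
        unfolding unipotent_radical_def by auto
      have "(carrier_mat n n :: 'a mat set) \<subseteq>
          (\<lambda>h. mat n n h) ` (PiE ({..<n} \<times> {..<n}) (\<lambda>_. UNIV))"
      proof
        fix X :: "'a mat" assume X: "X \<in> carrier_mat n n"
        define h where "h = restrict (\<lambda>ij. X $$ ij) ({..<n} \<times> {..<n})"
        have "mat n n h = X" unfolding h_def using X by (intro eq_matI) auto
        moreover have "h \<in> PiE ({..<n} \<times> {..<n}) (\<lambda>_. UNIV)"
          unfolding h_def restrict_PiE_iff by simp
        ultimately show "X \<in> (\<lambda>h. mat n n h) ` (PiE ({..<n} \<times> {..<n}) (\<lambda>_. UNIV))"
          by (metis imageI)
      qed
      then have "finite (carrier_mat n n :: 'a mat set)"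
        by (rule finite_subset) (intro finite_imageI finite_PiE; simp)
      then show "finite ((\<lambda>X. four_block_mat (1\<^sub>m n) X (0\<^sub>m n n) (1\<^sub>m n)) `
          (carrier_mat n n :: 'a mat set))"
        by simp
    qed
    have inj: "inj_on \<phi> (unipotent_radical n)"
      using UG dG pG unfolding \<phi>_def by (intro inj_onI) simp
    have bij: "bij_betw \<phi> (unipotent_radical n) (unipotent_radical n)"
      unfolding bij_betw_def using endo_inj_surj[OF fin _ inj] phiU inj by blast
    have tw: "J_twist n \<chi> p = \<chi> w"
      unfolding J_twist_def pe w_def using c by (simp add: split_block_four_block)
    have step: "f (inv\<^bsub>?G\<^esub> ?J * u * (p * g)) = \<chi> w * f (inv\<^bsub>?G\<^esub> ?J * \<phi> u * g)"
      if u: "u \<in> unipotent_radical n" for u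
    proof -
      let ?i = "inv\<^bsub>?G\<^esub> ?J"
      have iG: "?i \<in> carrier ?G" using Jc by simp
      have phG: "\<phi> u \<in> carrier ?G" using UG[OF phiU[OF u]] .
      have "d \<otimes>\<^bsub>?G\<^esub> \<phi> u = u \<otimes>\<^bsub>?G\<^esub> p"
        unfolding \<phi>_def using UG[OF u] dG pG by (simp add: m_assoc[symmetric])
      then have "?i \<otimes>\<^bsub>?G\<^esub> u \<otimes>\<^bsub>?G\<^esub> (p \<otimes>\<^bsub>?G\<^esub> g) = (?i \<otimes>\<^bsub>?G\<^esub> d) \<otimes>\<^bsub>?G\<^esub> (\<phi> u \<otimes>\<^bsub>?G\<^esub> g)"
        using UG[OF u] dG pG g iG phG by (metis m_assoc m_closed)
      also have "\<dots> = w \<otimes>\<^bsub>?G\<^esub> (?i \<otimes>\<^bsub>?G\<^esub> \<phi> u \<otimes>\<^bsub>?G\<^esub> g)"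
        unfolding Jd using wG iG phG g by (simp add: m_assoc)
      finally have "?i * u * (p * g) = w * (?i * \<phi> u * g)" by (simp add: GSp_mult)
      moreover have "?i * \<phi> u * g \<in> carrier ?G"
        using m_closed[OF m_closed[OF iG phG] g] by (simp add: GSp_mult)
      ultimately show ?thesis using f wP unfolding induced_def by auto
    qed
    have "p * g \<in> carrier ?G" using m_closed[OF pG g] by (simp add: GSp_mult)
    then have "intertwiner n f (p * g) = (\<Sum>u\<in>unipotent_radical n. \<chi> w * f (inv\<^bsub>?G\<^esub> ?J * \<phi> u * g))"
      unfolding intertwiner_def using step by simp
    also have "\<dots> = (\<Sum>u\<in>unipotent_radical n. \<chi> w * f (inv\<^bsub>?G\<^esub> ?J * u * g))"
      using sum.reindex_bij_betw[OF bij, of "\<lambda>u. \<chi> w * f (inv\<^bsub>?G\<^esub> ?J * u * g)"] by simp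
    also have "\<dots> = J_twist n \<chi> p * intertwiner n f g"
      unfolding intertwiner_def tw using g by (simp add: sum_distrib_left)
    finally show ?thesis .
  qed
  show ?thesis
    using main unfolding induced_def by (auto simp: intertwiner_def)
qed

definition fscale :: "complex \<Rightarrow> ('b \<Rightarrow> complex) \<Rightarrow> 'b \<Rightarrow> complex" where
  "fscale c f = (\<lambda>x. c * f x)"

global_interpretation fun_space: vector_space "fscale :: complex \<Rightarrow> ('b \<Rightarrow> complex) \<Rightarrow> 'b \<Rightarrow> complex"
  by standard (auto simp: fscale_def fun_eq_iff algebra_simps)

definition eigenvalues_on ::
  "('b \<Rightarrow> complex) set \<Rightarrow> (('b \<Rightarrow> complex) \<Rightarrow> 'b \<Rightarrow> complex) \<Rightarrow> complex set" where
  "eigenvalues_on V T = {c. \<exists>f\<in>V. f \<noteq> 0 \<and> T f = fscale c f}"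

definition diagonalizable_on ::
  "('b \<Rightarrow> complex) set \<Rightarrow> (('b \<Rightarrow> complex) \<Rightarrow> 'b \<Rightarrow> complex) \<Rightarrow> bool" where
  "diagonalizable_on V T \<longleftrightarrow> (\<exists>E. fun_space.independent E \<and> fun_space.span E = V \<and>
     (\<forall>f\<in>E. \<exists>c. T f = fscale c f))"

end

theory Submission imports Defs begin

text \<open>
  Why the theorem holds. Write a matrix as the pair $\tau$ of its upper and its lower $n$ rows, and let
  a function $f$ in the induced space become a function of $\tau$. On elements of multiplier $1$ the
  character is $\beta$ of the determinant of the lower right block, so $f$ is invariant under the
  unipotent radical and transforms under the Levi factor by $\beta \circ \det$. The operator $I$ sums $f$
  over the left translates by $J^{-1} u$, and these can be reached in steps that change only one or two rows:
  $t_0$ is the analogous sum for the first row pair alone, divided by a square root $\epsilon$ of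
  $\beta(-1) q$, and $t_i$ sums over a shear followed by the exchange of two neighbouring row pairs, with
  the sign $\beta(-1)$. On all functions of $\tau$ these operators satisfy the braid relations of type
  $C_n$. On functions with the right equivariance $t_i^2 = (q - 1) t_i + q$ for $i \ge 1$, as in an ordinary
  Hecke algebra, but $t_0^2 = 1$: the coefficient of $t_0$ is a multiple of $\sum_y \beta(y)$, which
  vanishes because $\beta$ is nontrivial. So the relevant Hecke algebra has the unequal parameters $q$ and
  $1$, and this is the origin of the unusual spectrum.

  The Jucys--Murphy elements $L_0 = t_0$, $L_i = t_i L_{i-1} t_i$ commute, and their product
  $Z = L_0 \cdots L_{n-1}$ is central. By \<open>app_LL\<close> it acts on the induced space as a
  scalar multiple $\kappa I$ of the intertwiner, so the spectrum of $Z^2$ is wanted. Since the functions in question absorb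
  $t_1, \dots, t_{n-1}$ with eigenvalue $q$, and averaging over the general linear group absorbs the same
  generators from the other side, the function $\Lambda(r)$ = average of $r f$ at a point $\tau$ only sees
  the elements $u_k = \prod_{j < k} (q^j + L_j)$ with $k \le n$. Modulo such $\Lambda$ the element $Z$ acts
  on $u_0, \dots, u_n$ by a triangular matrix (\<open>center_expand\<close>) with the diagonal entries
  $z_k = \pm q^{k(k-1) + k(n-k) + (n-k)(n-k-1)}$.

  Hence $\prod_k (Z^2 - z_k^2)$ annihilates the induced space (\<open>center_prod_annihilates\<close>). As
  $I \circ I$ is selfadjoint for the Hermitian form on functions on the group (\<open>ip_I2\<close>), it is
  diagonalizable, and its eigenvalues are among $z_k^2 / \kappa^2 = \beta(-1)^n q^{k^2 + (n-k)^2}$. Every $k$ does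
  occur. Otherwise the product of the factors with a value other than $z_k^2$ would annihilate the function
  $\delta$ that is $\chi$ on the parabolic subgroup and $0$ elsewhere. But triangularity turns this product, applied to
  $u_k$, into a combination of $u_k, \dots, u_n$ whose coefficient at $u_k$ is not zero, and the highest
  $u_l$ in it is detected at a point whose lower left block has rank $l$: there $u_m \delta$ averages to $0$
  for $m < l$, and to a sum of terms $0$ and $1$, not all $0$, for $m = l$
  (\<open>gl_average_delta_partial_sym\<close>). Finally $k$ and $n - k$ give the same eigenvalue, and
  writing $k = m \pm i$ for $n = 2m$, and $k = m - i$ or $k = m + 1 + i$ for $n = 2m + 1$, gives the stated lists.
\<close>

section \<open>Jucys--Murphy elements in type C\<close>

lemma commute_mult:
  fixes a b c :: "'r::semigroup_mult"
  assumes "a * c = c * a" "b * c = c * b"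
  shows "(a * b) * c = c * (a * b)"
  using assms by (metis mult.assoc)

locale braid_C =
  fixes t :: "nat \<Rightarrow> 'r::ring_1"
  assumes far: "Suc i < j \<Longrightarrow> t i * t j = t j * t i"
    and braid: "0 < i \<Longrightarrow> t i * t (Suc i) * t i = t (Suc i) * t i * t (Suc i)"
    and braid4: "t 0 * t 1 * t 0 * t 1 = t 1 * t 0 * t 1 * t 0"
begin

text \<open>
  The Jucys--Murphy elements of type $C$. They generate a commutative subring, and the products
  of consecutive ones are what the central element and its expansion are made of.
\<close>

primrec L :: "nat \<Rightarrow> 'r" where
  "L 0 = t 0"
| "L (Suc i) = t (Suc i) * L i * t (Suc i)"

definition LL :: "nat \<Rightarrow> nat \<Rightarrow> 'r" where
  "LL k l = prod_list (map L [k..<l])"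

text \<open>
  The element $u_k = (q^{k-1} + L_{k-1}) \cdots (q^0 + L_0)$ behaves under spherical functionals like the
  symmetriser of the parabolic subgroup generated by $t_0, \dots, t_{k-1}$, with $t_0$ acting as $1$ and
  the other generators as $q$. In this form its expansion in products of the $L_i$ is available at once.
\<close>

primrec partial_sym :: "nat \<Rightarrow> nat \<Rightarrow> 'r" where
  "partial_sym q 0 = 1"
| "partial_sym q (Suc k) = (of_nat (q ^ k) + L k) * partial_sym q k"

text \<open>
  The word $t_l \cdots t_1 t_0$ is the first half of $L_l$. The product of these halves is a reduced word
  for the longest of the minimal representatives of the cosets of the symmetric group in the Weyl group,
  that is, for $-1$ followed by a reversal of the rows, and it can be computed as a single sum.
\<close>

primrec chain :: "nat \<Rightarrow> 'r" where
  "chain 0 = t 0"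
| "chain (Suc l) = t (Suc l) * chain l"

primrec longest :: "nat \<Rightarrow> 'r" where
  "longest 0 = 1"
| "longest (Suc l) = longest l * chain l"

lemma t_L_above: "Suc j < i \<Longrightarrow> t i * L j = L j * t i"
proof (induction j)
  case 0
  then show ?case using far[of 0 i] by simp
next
  case (Suc j)
  have c: "t (Suc j) * t i = t i * t (Suc j)" using Suc.prems by (intro far) simp
  have l: "L j * t i = t i * L j" using Suc by simp
  show ?case unfolding L.simps by (rule commute_mult[OF commute_mult[OF c l] c, symmetric])
qed

text \<open>
  For $i < j - 1$ the outer factors $t_j$ of $L_j$ commute with $t_i$ and induction applies. For
  $i = j - 1$ one braid relation carries $t_i$ to the middle of $L_j$, where it is $t_{i + 1}$ and commutes
  with the core, and another carries it out; the bottom case is the relation of length four.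
\<close>

lemma t_L_below: "i < j \<Longrightarrow> t i * L j = L j * t i"
proof (induction j)
  case (Suc j)
  show ?case
  proof (cases "i = j")
    case False
    then have c: "t (Suc j) * t i = t i * t (Suc j)" and l: "L j * t i = t i * L j"
      using Suc far[of i "Suc j"] by simp_all
    show ?thesis unfolding L.simps by (rule commute_mult[OF commute_mult[OF c l] c, symmetric])
  next
    case [simp]: True
    show ?thesis
    proof (cases j)
      case 0
      then show ?thesis using braid4 by (simp add: mult.assoc)
    next
      case [simp]: (Suc k)
      have b: "t j * t (Suc j) * t j = t (Suc j) * t j * t (Suc j)" by (rule braid) simp
      have a: "t (Suc j) * L k = L k * t (Suc j)" by (rule t_L_above) simp
      have "t j * L (Suc j) = (t j * t (Suc j) * t j) * L k * t j * t (Suc j)"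
        by (simp add: mult.assoc)
      also have "\<dots> = (t (Suc j) * t j * t (Suc j)) * L k * t j * t (Suc j)"
        by (simp only: b)
      also have "\<dots> = t (Suc j) * t j * (t (Suc j) * L k) * t j * t (Suc j)"
        by (simp only: mult.assoc)
      also have "\<dots> = t (Suc j) * t j * L k * (t (Suc j) * t j * t (Suc j))"
        by (simp only: a mult.assoc)
      also have "\<dots> = t (Suc j) * t j * L k * (t j * t (Suc j) * t j)" by (simp only: b)
      also have "\<dots> = L (Suc j) * t j" by (simp add: mult.assoc)
      finally show ?thesis by simp
    qed
  qed
qed simp

lemma L_commute_less: "i < j \<Longrightarrow> L i * L j = L j * L i"
proof (induction i)
  case 0
  then show ?case using t_L_below[of 0 j] by simp
next
  case (Suc i)
  then have c: "t (Suc i) * L j = L j * t (Suc i)" and l: "L i * L j = L j * L i"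
    using t_L_below[of "Suc i" j] by simp_all
  show ?case unfolding L.simps by (rule commute_mult[OF commute_mult[OF c l] c])
qed

lemma L_commute: "L i * L j = L j * L i"
  using L_commute_less[of i j] L_commute_less[of j i] by (cases i j rule: linorder_cases) simp_all

lemma t_L_pair: "t (Suc i) * (L i * L (Suc i)) = L i * L (Suc i) * t (Suc i)"
proof -
  have "t (Suc i) * (L i * L (Suc i)) = (L (Suc i) * L i) * t (Suc i)"
    by (simp only: L.simps mult.assoc)
  also have "L (Suc i) * L i = L i * L (Suc i)" by (rule L_commute)
  finally show ?thesis .
qed

lemma LL_empty: "l \<le> k \<Longrightarrow> LL k l = 1"
  and LL_head: "k < l \<Longrightarrow> LL k l = L k * LL (Suc k) l"
  and LL_last: "k \<le> l \<Longrightarrow> LL k (Suc l) = LL k l * L l"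
  and LL_split: "k \<le> m \<Longrightarrow> m \<le> l \<Longrightarrow> LL k l = LL k m * LL m l"
proof -
  show "k \<le> m \<Longrightarrow> m \<le> l \<Longrightarrow> LL k l = LL k m * LL m l"
    unfolding LL_def by (metis le_Suc_ex map_append prod_list.append upt_add_eq_append)
qed (simp_all add: LL_def upt_conv_Cons)

lemma LL_commute:
  assumes "\<And>i. k \<le> i \<Longrightarrow> i < l \<Longrightarrow> r * L i = L i * r"
  shows "r * LL k l = LL k l * r"
  using assms
proof (induction "l - k" arbitrary: k)
  case 0
  then show ?case by (simp add: LL_empty)
next
  case (Suc m)
  then have h: "LL k l = L k * LL (Suc k) l" and k: "r * L k = L k * r" by (simp_all add: LL_head)
  have l: "r * LL (Suc k) l = LL (Suc k) l * r" using Suc by (intro Suc.hyps) auto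
  show ?case unfolding h by (rule commute_mult[OF k[symmetric] l[symmetric], symmetric])
qed

lemma partial_sym_commute:
  assumes "\<And>i. i < k \<Longrightarrow> r * L i = L i * r"
  shows "r * partial_sym q k = partial_sym q k * r"
  using assms
proof (induction k)
  case (Suc k)
  then have c: "r * L k = L k * r" and u: "r * partial_sym q k = partial_sym q k * r" by simp_all
  have "(of_nat (q ^ k) + L k) * r = r * (of_nat (q ^ k) + L k)"
    by (simp only: distrib_left distrib_right mult_of_nat_commute c)
  then show ?case unfolding partial_sym.simps by (rule commute_mult[OF _ u[symmetric], symmetric])
qed simp

text \<open>
  Among $L_0, \dots, L_{n-1}$ the generator $t_i$ fails to commute only with $L_{i-1}$ and $L_i$, and it
  commutes with their product by \<open>t_L_pair\<close>. So the product of all of them is central.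
\<close>

lemma t_LL_full: "0 < i \<Longrightarrow> i < n \<Longrightarrow> t i * LL 0 n = LL 0 n * t i"
proof -
  assume i: "0 < i" "i < n"
  then obtain j where [simp]: "i = Suc j" by (cases i) auto
  have s: "LL 0 n = LL 0 j * (L j * L i) * LL (Suc i) n"
    using i LL_split[of 0 j n] LL_head[of j n] LL_head[of i n] by (simp add: mult.assoc)
  have a: "t i * LL 0 j = LL 0 j * t i" using i by (intro LL_commute t_L_above) auto
  have b: "t i * LL (Suc i) n = LL (Suc i) n * t i" using i by (intro LL_commute t_L_below) auto
  have c: "t i * (L j * L i) = (L j * L i) * t i" using t_L_pair[of j] by simp
  show ?thesis
    unfolding s by (rule commute_mult[OF commute_mult[OF a[symmetric] c[symmetric]] b[symmetric], symmetric])
qed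

text \<open>
  Conjugation by the chain shifts the index of a generator; this lets a functional that absorbs
  $t_1, \dots, t_l$ on the right of the chain absorb $t_1, \dots, t_{l-1}$ on its left.
\<close>

lemma t_chain: "0 < i \<Longrightarrow> i < l \<Longrightarrow> t i * chain l = chain l * t (Suc i)"
proof (induction l)
  case (Suc l)
  show ?case
  proof (cases "i = l")
    case False
    then have c: "t i * t (Suc l) = t (Suc l) * t i" using far[of i "Suc l"] Suc.prems by simp
    have d: "t i * chain l = chain l * t (Suc i)" using Suc False by simp
    have "t i * chain (Suc l) = (t i * t (Suc l)) * chain l" by (simp only: chain.simps mult.assoc)
    also have "\<dots> = t (Suc l) * (t i * chain l)" by (simp only: c mult.assoc)
    finally show ?thesis by (simp only: d chain.simps mult.assoc)
  next
    case True
    then obtain k where [simp]: "l = Suc k" using Suc.prems by (cases l) auto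
    have f: "t (Suc l) * chain m = chain m * t (Suc l)" if "m < l" for m
      using that
    proof (induction m)
      case 0
      then show ?case using far[of 0 "Suc l"] by simp
    next
      case (Suc m)
      then have "t (Suc l) * chain m = chain m * t (Suc l)" "t (Suc m) * t (Suc l) = t (Suc l) * t (Suc m)"
        using far[of "Suc m" "Suc l"] by simp_all
      then show ?case unfolding chain.simps by (intro commute_mult[symmetric]) (simp_all only:)
    qed
    have b: "t l * t (Suc l) * t l = t (Suc l) * t l * t (Suc l)" by (rule braid) simp
    have "t i * chain (Suc l) = (t l * t (Suc l) * t l) * chain k" using True by (simp add: mult.assoc)
    also have "\<dots> = (t (Suc l) * t l * t (Suc l)) * chain k" by (simp only: b)
    also have "\<dots> = t (Suc l) * t l * (t (Suc l) * chain k)" by (simp only: mult.assoc)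
    also have "t (Suc l) * chain k = chain k * t (Suc l)" by (rule f) simp
    also have "t (Suc l) * t l * (chain k * t (Suc l)) = chain (Suc l) * t (Suc l)" by (simp add: mult.assoc)
    finally show ?thesis using True by simp
  qed
qed simp

end

text \<open>
  The second half $t_1 \cdots t_l$ of $L_l$ is absorbed on the right, and each letter contributes $q$.
\<close>

lemma (in braid_C) absorb_chain:
  fixes \<Lambda> :: "'r \<Rightarrow> complex"
  assumes "\<And>r i. 0 < i \<Longrightarrow> i \<le> l \<Longrightarrow> \<Lambda> (r * t i) = of_nat q * \<Lambda> r"
  shows "\<Lambda> (r * L l) = of_nat q ^ l * \<Lambda> (r * chain l)"
  using assms
proof (induction l arbitrary: r)
  case (Suc l)
  have "\<Lambda> (r * L (Suc l)) = \<Lambda> (r * t (Suc l) * L l * t (Suc l))" by (simp add: mult.assoc)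
  also have "\<dots> = of_nat q * \<Lambda> (r * t (Suc l) * L l)" by (rule Suc.prems) simp_all
  also have "\<Lambda> (r * t (Suc l) * L l) = of_nat q ^ l * \<Lambda> (r * t (Suc l) * chain l)"
    by (rule Suc.IH, rule Suc.prems) simp_all
  finally show ?case by (simp add: mult.assoc)
qed simp

lemma (in braid_C) absorb_longest:
  fixes \<Lambda> :: "'r \<Rightarrow> complex"
  assumes "\<And>r i. 0 < i \<Longrightarrow> i < l \<Longrightarrow> \<Lambda> (r * t i) = of_nat q * \<Lambda> r"
  shows "\<Lambda> (r * LL 0 l) = of_nat q ^ (l * (l - 1) div 2) * \<Lambda> (r * longest l)"
  using assms
proof (induction l arbitrary: r \<Lambda>)
  case 0
  then show ?case by (simp add: LL_empty)
next
  case (Suc l)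
  have "\<Lambda> (r * LL 0 (Suc l)) = \<Lambda> (r * LL 0 l * L l)" by (simp add: LL_last mult.assoc)
  also have "\<dots> = of_nat q ^ l * \<Lambda> (r * LL 0 l * chain l)"
    by (rule absorb_chain, rule Suc.prems) simp_all
  also have "\<Lambda> (r * LL 0 l * chain l) =
      of_nat q ^ (l * (l - 1) div 2) * \<Lambda> (r * longest l * chain l)"
  proof (rule Suc.IH)
    fix s i assume i: "0 < i" "i < l"
    have "\<Lambda> (s * t i * chain l) = \<Lambda> (s * chain l * t (Suc i))"
      using t_chain[OF i] by (simp add: mult.assoc)
    also have "\<dots> = of_nat q * \<Lambda> (s * chain l)" using i by (intro Suc.prems) simp_all
    finally show "\<Lambda> (s * t i * chain l) = of_nat q * \<Lambda> (s * chain l)" .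
  qed
  finally have "\<Lambda> (r * LL 0 (Suc l)) =
      of_nat q ^ (l + l * (l - 1) div 2) * \<Lambda> (r * longest (Suc l))"
    by (simp add: power_add mult.assoc)
  also have "l + l * (l - 1) div 2 = Suc l * (Suc l - 1) div 2"
    by (cases l) (simp_all add: algebra_simps)
  finally show ?case .
qed

section \<open>Spherical functionals and the action of the centre\<close>

text \<open>
  The abstract form of the functional $r \mapsto$ average of $r f$ at a point, where $f$ is in an induced
  space: both the averaging and the equivariance of $f$ absorb $t_1, \dots, t_{n-1}$. The quadratic relation
  of $t_{i+1}$ holds on functions that are equivariant under a Borel subgroup acting on the rows from $i$ on;
  $f$ and $L_i f$ are of this kind, a general $r f$ is not, and so the relation
  is demanded only in front of $L_i$.
\<close>

locale spherical = braid_C t for t :: "nat \<Rightarrow> 'r::ring_1" +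
  fixes n q :: nat and \<Lambda> :: "'r \<Rightarrow> complex"
  assumes additive: "\<Lambda> (r + s) = \<Lambda> r + \<Lambda> s"
    and left: "0 < i \<Longrightarrow> i < n \<Longrightarrow> \<Lambda> (t i * r) = of_nat q * \<Lambda> r"
    and right: "0 < i \<Longrightarrow> i < n \<Longrightarrow> \<Lambda> (r * t i) = of_nat q * \<Lambda> r"
    and quad0: "0 < n \<Longrightarrow> \<Lambda> (r * t 0 * t 0) = \<Lambda> r"
    and quad: "Suc i < n \<Longrightarrow> \<Lambda> (r * t (Suc i) * t (Suc i) * L i) =
       (of_nat q - 1) * \<Lambda> (r * t (Suc i) * L i) + of_nat q * \<Lambda> (r * L i)"
begin

lemma zero: "\<Lambda> 0 = 0"
  using additive[of 0 0] by simp

lemma minus: "\<Lambda> (r - s) = \<Lambda> r - \<Lambda> s"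
  using additive[of "r - s" s] by simp

lemma nat_scale: "\<Lambda> (of_nat m * r) = of_nat m * \<Lambda> r"
  by (induction m) (simp_all add: zero additive algebra_simps)

lemma int_scale: "\<Lambda> (of_int m * r) = of_int m * \<Lambda> r"
proof (cases m)
  case (nonneg k)
  then show ?thesis by (simp add: nat_scale)
next
  case (neg k)
  have "of_int m = (- of_nat (Suc k) :: 'r)" unfolding neg by (simp only: of_int_minus of_int_of_nat_eq)
  then have "of_int m * r = 0 - of_nat (Suc k) * r" by (simp only: minus_mult_left[symmetric] diff_0)
  then have "\<Lambda> (of_int m * r) = \<Lambda> (0 - of_nat (Suc k) * r)" by simp
  also have "\<dots> = - (of_nat (Suc k) * \<Lambda> r)" by (simp only: minus nat_scale zero) simp
  finally show ?thesis unfolding neg by (simp add: algebra_simps)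
qed

lemma nat_scale_mid: "\<Lambda> (r * (of_nat m * s)) = of_nat m * \<Lambda> (r * s)"
proof -
  have "r * (of_nat m * s) = of_nat m * (r * s)"
    by (metis mult.assoc mult_of_nat_commute)
  then show ?thesis by (simp add: nat_scale)
qed

text \<open>
  The factors of $u_{i+2}$ with $j < i$ commute with $t_{i+1}$, so everything happens in
  $(q^{i+1} + L_{i+1}) (q^i + L_i)$. Here $L_{i+1}$ may be replaced by $q\, t_{i+1} L_i$ because its last
  letter is absorbed, and the quadratic relation then gives the eigenvalue $q$; the constants $q^j$ in the
  definition of $u_k$ are those for which this works.
\<close>

lemma t_partial_sym_pair:
  assumes i: "Suc i < n"
  shows "\<Lambda> (r * t (Suc i) * partial_sym q (Suc (Suc i))) = of_nat q * \<Lambda> (r * partial_sym q (Suc (Suc i)))"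
proof -
  let ?t = "t (Suc i)" and ?u = "partial_sym q i"
  let ?a = "of_nat (q ^ Suc i) :: 'r" and ?b = "of_nat (q ^ i) :: 'r"
  define p where "p = (?a + L (Suc i)) * (?b + L i)"
  have u: "r * ?u = ?u * r" if "\<And>j. j < i \<Longrightarrow> r * L j = L j * r" for r
    using that by (rule partial_sym_commute)
  have c: "(of_nat m + L i') * L j = L j * (of_nat m + L i')" for m i' j
    by (simp only: distrib_left distrib_right mult_of_nat_commute L_commute[of i' j])
  have "p * L j = L j * p" for j
    unfolding p_def by (rule commute_mult; rule c)
  then have "p * ?u = ?u * p" by (intro u)
  then have top: "partial_sym q (Suc (Suc i)) = ?u * p" by (simp add: p_def mult.assoc)
  have tu: "?t * ?u = ?u * ?t" by (rule u) (rule t_L_above, simp)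
  have pe: "p = of_nat (q ^ Suc i * q ^ i) + of_nat (q ^ i) * L (Suc i) + of_nat (q ^ Suc i) * L i + L i * L (Suc i)"
  proof -
    have "p = ?a * ?b + ?a * L i + L (Suc i) * ?b + L (Suc i) * L i"
      unfolding p_def by (simp only: distrib_left distrib_right add_ac)
    also have "L (Suc i) * ?b = ?b * L (Suc i)" by (rule mult_of_nat_commute[symmetric])
    also have "L (Suc i) * L i = L i * L (Suc i)" by (rule L_commute)
    finally show ?thesis by (simp only: of_nat_mult add_ac)
  qed
  have e: "\<Lambda> (s * p) = of_nat (q ^ Suc i * q ^ i) * \<Lambda> s + of_nat (q ^ i) * \<Lambda> (s * L (Suc i))
      + of_nat (q ^ Suc i) * \<Lambda> (s * L i) + \<Lambda> (s * (L i * L (Suc i)))" for s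
  proof -
    have "\<Lambda> (s * of_nat m) = of_nat m * \<Lambda> s" for m
      using nat_scale_mid[of s m 1] by simp
    then show ?thesis
      unfolding pe by (simp only: distrib_left additive nat_scale_mid)
  qed
  have Ls: "\<Lambda> (s * L (Suc i)) = of_nat q * \<Lambda> (s * ?t * L i)" for s
    using right[of "Suc i" "s * ?t * L i"] i by (simp add: mult.assoc)
  define s where "s = r * ?u"
  \<comment> \<open>Both sides become the same linear combination of $\Lambda(s)$ and the following three values.\<close>
  define X Y where "X = \<Lambda> (s * L i)" and "Y = \<Lambda> (s * ?t * L i)"
  define V where "V = \<Lambda> (s * (L i * L (Suc i)))"
  have r1: "\<Lambda> (s * ?t * p) = of_nat (q ^ Suc i * q ^ i) * (of_nat q * \<Lambda> s)
      + of_nat (q ^ i) * (of_nat q * ((of_nat q - 1) * Y + of_nat q * X)) + of_nat (q ^ Suc i) * Y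
      + of_nat q * V"
  proof -
    have "\<Lambda> (s * ?t * (L i * L (Suc i))) = \<Lambda> (s * (L i * L (Suc i)) * ?t)"
      by (simp only: t_L_pair mult.assoc)
    then show ?thesis
      using i quad[OF i, of s] right[of "Suc i" s] right[of "Suc i" "s * (L i * L (Suc i))"]
      by (simp only: e Ls X_def Y_def V_def)
  qed
  have r2: "\<Lambda> (s * p) = of_nat (q ^ Suc i * q ^ i) * \<Lambda> s
      + of_nat (q ^ i) * (of_nat q * Y) + of_nat (q ^ Suc i) * X + V"
    by (simp only: e Ls X_def Y_def V_def)
  have "\<Lambda> (s * ?t * p) = of_nat q * \<Lambda> (s * p)"
    unfolding r1 r2 by (simp add: algebra_simps)
  then show ?thesis
    unfolding top s_def using tu by (metis mult.assoc)
qed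

lemma t_partial_sym: "Suc i < k \<Longrightarrow> k \<le> n \<Longrightarrow>
    \<Lambda> (r * t (Suc i) * partial_sym q k) = of_nat q * \<Lambda> (r * partial_sym q k)"
proof (induction k arbitrary: r)
  case (Suc k)
  show ?case
  proof (cases "Suc i = k")
    case True
    then show ?thesis using t_partial_sym_pair[of i r] Suc.prems by auto
  next
    case False
    then have c: "t (Suc i) * L k = L k * t (Suc i)" using Suc.prems by (intro t_L_below) simp
    have c': "t (Suc i) * (of_nat (q ^ k) + L k) = (of_nat (q ^ k) + L k) * t (Suc i)"
      by (simp only: distrib_left distrib_right mult_of_nat_commute c)
    have "r * t (Suc i) * partial_sym q (Suc k) = r * (t (Suc i) * (of_nat (q ^ k) + L k)) * partial_sym q k"
      by (simp only: partial_sym.simps mult.assoc)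
    also have "\<dots> = r * (of_nat (q ^ k) + L k) * t (Suc i) * partial_sym q k"
      by (simp only: c') (simp only: mult.assoc)
    finally show ?thesis using Suc.IH[of "r * (of_nat (q ^ k) + L k)"] Suc.prems False
      by (simp add: mult.assoc)
  qed
qed simp

lemma t0_partial_sym: "0 < k \<Longrightarrow> k \<le> n \<Longrightarrow> \<Lambda> (r * t 0 * partial_sym q k) = \<Lambda> (r * partial_sym q k)"
proof (induction k arbitrary: r)
  case (Suc k)
  show ?case
  proof (cases "k = 0")
    case True
    then show ?thesis using quad0[of r] Suc.prems by (simp add: distrib_left additive)
  next
    case False
    then have c: "t 0 * L k = L k * t 0" by (intro t_L_below) simp
    have c': "t 0 * (of_nat (q ^ k) + L k) = (of_nat (q ^ k) + L k) * t 0"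
      by (simp only: distrib_left distrib_right mult_of_nat_commute c)
    have "r * t 0 * partial_sym q (Suc k) = r * (t 0 * (of_nat (q ^ k) + L k)) * partial_sym q k"
      by (simp only: partial_sym.simps mult.assoc)
    also have "\<dots> = r * (of_nat (q ^ k) + L k) * t 0 * partial_sym q k"
      by (simp only: c') (simp only: mult.assoc)
    finally show ?thesis using Suc.IH[of "r * (of_nat (q ^ k) + L k)"] Suc.prems False
      by (simp add: mult.assoc)
  qed
qed simp

text \<open>
  Every letter of $L_i = t_i \cdots t_1 t_0 t_1 \cdots t_i$ is absorbed by $u_k$, with the factor $q$ for each
  of the $2 i$ letters other than $t_0$.
\<close>

lemma L_partial_sym: "i < k \<Longrightarrow> k \<le> n \<Longrightarrow> \<Lambda> (r * L i * partial_sym q k) = of_nat q ^ (2 * i) * \<Lambda> (r * partial_sym q k)"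
proof (induction i arbitrary: r)
  case 0
  then show ?case using t0_partial_sym[of k r] by simp
next
  case (Suc i)
  have "\<Lambda> (r * L (Suc i) * partial_sym q k) = \<Lambda> (r * t (Suc i) * L i * t (Suc i) * partial_sym q k)"
    by (simp add: mult.assoc)
  also have "\<dots> = of_nat q * \<Lambda> (r * t (Suc i) * L i * partial_sym q k)"
    using Suc.prems by (intro t_partial_sym)
  also have "\<Lambda> (r * t (Suc i) * L i * partial_sym q k) = of_nat q ^ (2 * i) * \<Lambda> (r * t (Suc i) * partial_sym q k)"
    using Suc by simp
  also have "\<Lambda> (r * t (Suc i) * partial_sym q k) = of_nat q * \<Lambda> (r * partial_sym q k)"
    using Suc.prems by (intro t_partial_sym)
  finally show ?case by simp
qed

lemma LL_partial_sym:
  assumes "k \<le> m" "m \<le> n"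
  shows "\<Lambda> (r * LL 0 k * partial_sym q m) = of_nat q ^ (k * (k - 1)) * \<Lambda> (r * partial_sym q m)"
  using assms(1)
proof (induction k)
  case 0
  then show ?case by (simp add: LL_empty)
next
  case (Suc k)
  have "\<Lambda> (r * LL 0 (Suc k) * partial_sym q m) = \<Lambda> (r * LL 0 k * L k * partial_sym q m)"
    by (simp add: LL_last mult.assoc)
  also have "\<dots> = of_nat q ^ (2 * k) * (of_nat q ^ (k * (k - 1)) * \<Lambda> (r * partial_sym q m))"
    using Suc assms by (subst L_partial_sym) simp_all
  also have "\<dots> = of_nat q ^ (2 * k + k * (k - 1)) * \<Lambda> (r * partial_sym q m)"
    by (simp add: power_add)
  also have "2 * k + k * (k - 1) = Suc k * (Suc k - 1)" by (cases k) simp_all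
  finally show ?case .
qed

text \<open>
  The factors of $L_{j+1} = t_{j+1} L_j t_{j+1}$ to the left and to the right of $L_j$ commute with everything else in the
  product, as no other factor involves the neighbouring index, and are absorbed at the two ends.
\<close>

lemma shift_one:
  assumes j: "k \<le> j" "Suc j < l" "l \<le> n"
  shows "\<Lambda> (LL k j * LL (Suc j) l * partial_sym q k) =
    of_nat q ^ 2 * \<Lambda> (LL k (Suc j) * LL (Suc (Suc j)) l * partial_sym q k)"
proof -
  let ?t = "t (Suc j)"
  have a: "?t * LL k j = LL k j * ?t" using j by (intro LL_commute t_L_above) simp
  have b: "?t * LL (Suc (Suc j)) l = LL (Suc (Suc j)) l * ?t" using j by (intro LL_commute t_L_below) simp
  have c: "?t * partial_sym q k = partial_sym q k * ?t" using j by (intro partial_sym_commute t_L_above) simp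
  have "LL k j * LL (Suc j) l * partial_sym q k = LL k j * (?t * L j * ?t) * LL (Suc (Suc j)) l * partial_sym q k"
    using j by (simp add: LL_head[of "Suc j"] mult.assoc)
  also have "\<dots> = (LL k j * ?t) * L j * (?t * LL (Suc (Suc j)) l) * partial_sym q k"
    by (simp only: mult.assoc)
  also have "\<dots> = ?t * LL k j * L j * LL (Suc (Suc j)) l * (?t * partial_sym q k)"
    unfolding a[symmetric] b by (simp only: mult.assoc)
  also have "\<dots> = ?t * LL k j * L j * LL (Suc (Suc j)) l * partial_sym q k * ?t"
    unfolding c by (simp only: mult.assoc)
  finally have "\<Lambda> (LL k j * LL (Suc j) l * partial_sym q k) =
      \<Lambda> (?t * (LL k j * L j * LL (Suc (Suc j)) l * partial_sym q k * ?t))" by (simp add: mult.assoc)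
  also have "\<dots> = of_nat q * (of_nat q * \<Lambda> (LL k j * L j * LL (Suc (Suc j)) l * partial_sym q k))"
    using j by (simp add: left right)
  finally show ?thesis using j by (simp add: LL_last power2_eq_square)
qed

lemma shift:
  assumes "k < l" "l \<le> n"
  shows "\<Lambda> (LL (Suc k) l * partial_sym q k) = of_nat q ^ (2 * (l - k - 1)) * \<Lambda> (LL k (l - 1) * partial_sym q k)"
proof -
  have "\<Lambda> (LL k k * LL (Suc k) l * partial_sym q k) =
      of_nat q ^ (2 * d) * \<Lambda> (LL k (k + d) * LL (Suc (k + d)) l * partial_sym q k)" if "k + d < l" for d
    using that
  proof (induction d)
    case (Suc d)
    then show ?case using shift_one[of k "k + d" l] assms by (simp add: power2_eq_square)
  qed simp
  from this[of "l - k - 1"] show ?thesis using assms by (simp add: LL_empty)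
qed

end

text \<open>
  The coefficient of $u_m$ in $L_k \cdots L_{l-1} u_k$ modulo spherical functionals. Its recursion comes from
  $L_k u_k = u_{k+1} - q^k u_k$: the first summand leaves $L_{k+1} \cdots L_{l-1} u_{k+1}$, and in the second
  \<open>shift\<close> lowers all indices by one at the cost of $q^{2(l-k-1)}$.
\<close>

function zcoef :: "nat \<Rightarrow> nat \<Rightarrow> nat \<Rightarrow> nat \<Rightarrow> int" where
  "zcoef q k l m = (if l \<le> k then (if m = k then 1 else 0)
     else zcoef q (Suc k) l m - int q ^ (k + 2 * (l - k - 1)) * zcoef q k (l - 1) m)"
  by pat_completeness auto
termination by (relation "measure (\<lambda>(q, k, l, m). l - k)") auto

declare zcoef.simps [simp del]

lemma zcoef_base: "zcoef q k k m = (if m = k then 1 else 0)"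
  by (simp add: zcoef.simps)

lemma zcoef_step: "k < l \<Longrightarrow>
    zcoef q k l m = zcoef q (Suc k) l m - int q ^ (k + 2 * (l - k - 1)) * zcoef q k (l - 1) m"
  by (subst zcoef.simps) simp

lemma zcoef_below: "k \<le> l \<Longrightarrow> m < k \<Longrightarrow> zcoef q k l m = 0"
proof (induction "l - k" arbitrary: k l)
  case 0
  then show ?case by (simp add: zcoef_base)
next
  case (Suc d)
  from Suc.hyps(2) Suc.prems show ?case
    using Suc.hyps(1)[of l "Suc k"] Suc.hyps(1)[of "l - 1" k] by (simp add: zcoef_step)
qed

lemma zcoef_diag: "zcoef q k (k + d) k = (- 1) ^ d * int q ^ (k * d + d * (d - 1))"
proof (induction d)
  case 0
  then show ?case by (simp add: zcoef_base)
next
  case (Suc d)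
  have "zcoef q k (k + Suc d) k = - (int q ^ (k + 2 * d) * zcoef q k (k + d) k)"
    by (simp add: zcoef_below zcoef_step)
  also have "\<dots> = (- 1) ^ Suc d * int q ^ (k + 2 * d + (k * d + d * (d - 1)))"
    by (simp add: Suc power_add)
  also have "k + 2 * d + (k * d + d * (d - 1)) = k * Suc d + Suc d * (Suc d - 1)"
    by (cases d) (simp_all add: algebra_simps)
  finally show ?case .
qed

text \<open>
  The matrix of the central element on $u_0, \dots, u_n$. The power of $q$ is the contribution of
  $L_0 \cdots L_{k-1}$, which $u_k$ absorbs.
\<close>

definition zmat :: "nat \<Rightarrow> nat \<Rightarrow> nat \<Rightarrow> nat \<Rightarrow> int" where
  "zmat q n k m = int q ^ (k * (k - 1)) * zcoef q k n m"

lemma zmat_below: "k \<le> n \<Longrightarrow> m < k \<Longrightarrow> zmat q n k m = 0"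
  by (simp add: zmat_def zcoef_below)

lemma (in spherical) LL_expand:
  "k \<le> l \<Longrightarrow> l \<le> n \<Longrightarrow> \<Lambda> (LL k l * partial_sym q k) = (\<Sum>m\<le>n. of_int (zcoef q k l m) * \<Lambda> (partial_sym q m))"
proof (induction "l - k" arbitrary: k l)
  case 0
  then have "k = l" by simp
  have "(\<Sum>m\<le>n. of_int (zcoef q l l m) * \<Lambda> (partial_sym q m)) = (\<Sum>m\<le>n. if m = l then \<Lambda> (partial_sym q m) else 0)"
    by (intro sum.cong) (simp_all add: zcoef_base)
  then show ?case using \<open>k = l\<close> 0 by (simp add: LL_empty)
next
  case (Suc d)
  then have kl: "k < l" by simp
  have "LL k l = LL (Suc k) l * L k"
    using kl LL_commute[of "Suc k" l "L k"] L_commute by (simp add: LL_head)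
  then have "LL k l * partial_sym q k = LL (Suc k) l * (partial_sym q (Suc k) - of_nat (q ^ k) * partial_sym q k)"
    by (simp add: mult.assoc algebra_simps)
  then have "\<Lambda> (LL k l * partial_sym q k) =
      \<Lambda> (LL (Suc k) l * partial_sym q (Suc k)) - of_nat (q ^ k) * \<Lambda> (LL (Suc k) l * partial_sym q k)"
    by (simp only: right_diff_distrib minus nat_scale_mid)
  also have "\<Lambda> (LL (Suc k) l * partial_sym q k) = of_nat q ^ (2 * (l - k - 1)) * \<Lambda> (LL k (l - 1) * partial_sym q k)"
    using kl Suc by (intro shift) auto
  also have "\<Lambda> (LL (Suc k) l * partial_sym q (Suc k)) = (\<Sum>m\<le>n. of_int (zcoef q (Suc k) l m) * \<Lambda> (partial_sym q m))"
    using Suc kl by (intro Suc.hyps(1)) auto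
  also have "\<Lambda> (LL k (l - 1) * partial_sym q k) = (\<Sum>m\<le>n. of_int (zcoef q k (l - 1) m) * \<Lambda> (partial_sym q m))"
    using Suc kl by (intro Suc.hyps(1)) auto
  finally show ?case
    by (simp add: zcoef_step[OF kl] sum_subtractf sum_distrib_left power_add algebra_simps)
qed

lemma (in spherical) center_expand:
  assumes "k \<le> n"
  shows "\<Lambda> (LL 0 n * partial_sym q k) = (\<Sum>m\<le>n. of_int (zmat q n k m) * \<Lambda> (partial_sym q m))"
proof -
  have "LL 0 k * L i = L i * LL 0 k" for i
    by (rule LL_commute[symmetric]) (rule L_commute)
  then have "LL 0 k * LL k n = LL k n * LL 0 k" by (intro LL_commute)
  then have "LL 0 n = LL k n * LL 0 k" using assms LL_split[of 0 k n] by simp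
  then have "\<Lambda> (LL 0 n * partial_sym q k) = of_nat q ^ (k * (k - 1)) * \<Lambda> (LL k n * partial_sym q k)"
    using LL_partial_sym[of k k "LL k n"] assms by (simp add: mult.assoc)
  then show ?thesis using assms
    by (simp add: LL_expand zmat_def sum_distrib_left mult.assoc)
qed

section \<open>Polynomials in the square of the central element\<close>

context braid_C
begin

definition center_factor :: "nat \<Rightarrow> int \<Rightarrow> 'r" where
  "center_factor n \<mu> = LL 0 n * LL 0 n - of_int \<mu>"

definition center_prod :: "nat \<Rightarrow> int list \<Rightarrow> 'r" where
  "center_prod n \<mu>s = prod_list (map (center_factor n) \<mu>s)"

lemma center_prod_simps [simp]:
  "center_prod n [] = 1" "center_prod n (\<mu> # \<mu>s) = center_factor n \<mu> * center_prod n \<mu>s"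
  by (simp_all add: center_prod_def)

lemma center_factor_commute:
  assumes "r * LL 0 n = LL 0 n * r"
  shows "r * center_factor n \<mu> = center_factor n \<mu> * r"
proof -
  have "r * (LL 0 n * LL 0 n) = (LL 0 n * LL 0 n) * r"
    by (rule commute_mult[symmetric]; rule assms[symmetric])
  then show ?thesis
    unfolding center_factor_def by (simp only: right_diff_distrib left_diff_distrib mult_of_int_commute)
qed

lemma center_prod_commute:
  assumes "r * LL 0 n = LL 0 n * r"
  shows "r * center_prod n \<mu>s = center_prod n \<mu>s * r"
proof (induction \<mu>s)
  case (Cons \<mu> \<mu>s)
  show ?case unfolding center_prod_simps
    by (rule commute_mult[symmetric]) (rule center_factor_commute[OF assms, symmetric], rule Cons[symmetric])
qed simp

lemma center_factor_prod: "center_factor n \<mu> * center_prod n \<mu>s = center_prod n \<mu>s * center_factor n \<mu>"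
  by (rule center_prod_commute, rule center_factor_commute[symmetric]) simp

text \<open>
  Composing a spherical functional with an element that commutes with $t_1, \dots, t_{n-1}$ keeps it
  spherical, so an expansion that is valid for all spherical functionals can be applied repeatedly.
\<close>

lemma spherical_comp:
  assumes sph: "spherical t n q \<Lambda>"
    and comm: "\<And>i. 0 < i \<Longrightarrow> i < n \<Longrightarrow> t i * r = r * t i"
  shows "spherical t n q (\<lambda>s. \<Lambda> (r * s))"
proof -
  interpret spherical t n q \<Lambda> by (rule sph)
  show ?thesis
  proof
    fix i s assume i: "0 < i" "i < n"
    have "r * (t i * s) = t i * (r * s)" using comm[OF i] by (simp flip: mult.assoc)
    then show "\<Lambda> (r * (t i * s)) = of_nat q * \<Lambda> (r * s)" using left[OF i] by simp
    show "\<Lambda> (r * (s * t i)) = of_nat q * \<Lambda> (r * s)" using right[OF i, of "r * s"] by (simp add: mult.assoc)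
  next
    fix s
    show "\<Lambda> (r * (s * t 0 * t 0)) = \<Lambda> (r * s)" if "0 < n"
      using quad0[OF that, of "r * s"] by (simp add: mult.assoc)
    show "\<Lambda> (r * (s * t (Suc i) * t (Suc i) * L i)) =
       (of_nat q - 1) * \<Lambda> (r * (s * t (Suc i) * L i)) + of_nat q * \<Lambda> (r * (s * L i))" if "Suc i < n" for i
      using quad[OF that, of "r * s"] by (simp add: mult.assoc)
    show "\<Lambda> (r * (s + s')) = \<Lambda> (r * s) + \<Lambda> (r * s')" for s'
      by (simp only: distrib_left additive)
  qed
qed

lemma spherical_center_factor:
  assumes "spherical t n q \<Lambda>"
  shows "spherical t n q (\<lambda>s. \<Lambda> (center_factor n \<mu> * s))"
proof (rule spherical_comp[OF assms])
  fix i assume "0 < i" "i < n"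
  then show "t i * center_factor n \<mu> = center_factor n \<mu> * t i" by (rule center_factor_commute[OF t_LL_full])
qed

lemma spherical_center_prod:
  assumes "spherical t n q \<Lambda>"
  shows "spherical t n q (\<lambda>s. \<Lambda> (center_prod n \<mu>s * s))"
proof (rule spherical_comp[OF assms])
  fix i assume "0 < i" "i < n"
  then show "t i * center_prod n \<mu>s = center_prod n \<mu>s * t i" by (rule center_prod_commute[OF t_LL_full])
qed

lemma spherical_center:
  assumes "spherical t n q \<Lambda>"
  shows "spherical t n q (\<lambda>s. \<Lambda> (LL 0 n * s))"
proof (rule spherical_comp[OF assms])
  fix i assume "0 < i" "i < n"
  then show "t i * LL 0 n = LL 0 n * t i" by (rule t_LL_full)
qed

definition factor_mat :: "nat \<Rightarrow> nat \<Rightarrow> int \<Rightarrow> nat \<Rightarrow> nat \<Rightarrow> int" where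
  "factor_mat q n \<mu> k m = (\<Sum>l\<le>n. zmat q n k l * zmat q n l m) - (if m = k then \<mu> else 0)"

lemma factor_mat_below: "k \<le> n \<Longrightarrow> m < k \<Longrightarrow> factor_mat q n \<mu> k m = 0"
proof -
  assume km: "k \<le> n" "m < k"
  have "zmat q n k l * zmat q n l m = 0" if "l \<le> n" for l
    using zmat_below[of k n l q] zmat_below[of l n m q] km that by (cases "l < k") auto
  then have "(\<Sum>l\<le>n. zmat q n k l * zmat q n l m) = 0" by (intro sum.neutral) auto
  then show ?thesis using km by (simp add: factor_mat_def)
qed

lemma factor_mat_diag: "k \<le> n \<Longrightarrow> factor_mat q n \<mu> k k = (zmat q n k k)\<^sup>2 - \<mu>"
proof -
  assume k: "k \<le> n"
  have "(\<Sum>l\<le>n. zmat q n k l * zmat q n l k) = (\<Sum>l\<le>n. if l = k then (zmat q n k k)\<^sup>2 else 0)"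
  proof (rule sum.cong)
    fix l assume "l \<in> {..n}"
    then show "zmat q n k l * zmat q n l k = (if l = k then (zmat q n k k)\<^sup>2 else 0)"
      using zmat_below[of k n l q] zmat_below[of l n k q] k
      by (cases l k rule: linorder_cases) (auto simp: power2_eq_square)
  qed simp
  then show ?thesis using k by (simp add: factor_mat_def)
qed

lemma center_factor_expand:
  assumes sph: "spherical t n q \<Lambda>" and k: "k \<le> n"
  shows "\<Lambda> (center_factor n \<mu> * partial_sym q k) = (\<Sum>m\<le>n. of_int (factor_mat q n \<mu> k m) * \<Lambda> (partial_sym q m))"
proof -
  interpret spherical t n q \<Lambda> by (rule sph)
  interpret Z: spherical t n q "\<lambda>s. \<Lambda> (LL 0 n * s)" by (rule spherical_center[OF sph])
  have "\<Lambda> (LL 0 n * LL 0 n * partial_sym q k) = (\<Sum>l\<le>n. of_int (zmat q n k l) * \<Lambda> (LL 0 n * partial_sym q l))"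
    using Z.center_expand[OF k] by (simp add: mult.assoc)
  also have "\<dots> = (\<Sum>l\<le>n. \<Sum>m\<le>n. of_int (zmat q n k l * zmat q n l m) * \<Lambda> (partial_sym q m))"
    by (intro sum.cong) (simp_all add: center_expand sum_distrib_left mult.assoc)
  also have "\<dots> = (\<Sum>m\<le>n. of_int (\<Sum>l\<le>n. zmat q n k l * zmat q n l m) * \<Lambda> (partial_sym q m))"
    by (subst sum.swap) (simp add: sum_distrib_right)
  finally have 1: "\<Lambda> (LL 0 n * LL 0 n * partial_sym q k) = \<dots>" .
  have "of_int \<mu> * \<Lambda> (partial_sym q k) = (\<Sum>m\<le>n. if m = k then of_int \<mu> * \<Lambda> (partial_sym q m) else 0)"
    using k by simp
  also have "\<dots> = (\<Sum>m\<le>n. of_int (if m = k then \<mu> else 0) * \<Lambda> (partial_sym q m))"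
    by (intro sum.cong) auto
  finally have 2: "of_int \<mu> * \<Lambda> (partial_sym q k) = \<dots>" .
  have "\<Lambda> (center_factor n \<mu> * partial_sym q k) = \<Lambda> (LL 0 n * LL 0 n * partial_sym q k) - of_int \<mu> * \<Lambda> (partial_sym q k)"
    by (simp only: center_factor_def left_diff_distrib minus int_scale)
  then show ?thesis unfolding 1 2 factor_mat_def by (simp add: sum_subtractf algebra_simps)
qed

text \<open>
  The coefficients are fixed before the functional because the point at which the expansion will be evaluated
  is chosen in terms of them.
\<close>

theorem center_prod_triangular:
  assumes k: "k \<le> n"
  obtains c :: "nat \<Rightarrow> int" where "c k = (\<Prod>\<mu>\<leftarrow>\<mu>s. (zmat q n k k)\<^sup>2 - \<mu>)"
    and "\<And>\<Lambda>. spherical t n q \<Lambda> \<Longrightarrow>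
      \<Lambda> (center_prod n \<mu>s * partial_sym q k) = (\<Sum>m\<in>{k..n}. of_int (c m) * \<Lambda> (partial_sym q m))"
proof -
  have "\<exists>c. c k = (\<Prod>\<mu>\<leftarrow>\<mu>s. (zmat q n k k)\<^sup>2 - \<mu>) \<and> (\<forall>m<k. c m = 0) \<and> (\<forall>\<Lambda>. spherical t n q \<Lambda> \<longrightarrow>
      \<Lambda> (center_prod n \<mu>s * partial_sym q k) = (\<Sum>m\<le>n. of_int (c m) * \<Lambda> (partial_sym q m)))"
  proof (induction \<mu>s)
    case Nil
    have "(\<Sum>m\<le>n. of_int (if m = k then 1 else 0) * \<Lambda> (partial_sym q m)) = \<Lambda> (partial_sym q k)"
      for \<Lambda> :: "'r \<Rightarrow> complex"
    proof -
      have "(\<Sum>m\<le>n. of_int (if m = k then 1 else 0) * \<Lambda> (partial_sym q m)) =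
          (\<Sum>m\<le>n. if m = k then \<Lambda> (partial_sym q m) else 0)"
        by (intro sum.cong) auto
      then show ?thesis using k by simp
    qed
    then show ?case by (intro exI[of _ "\<lambda>m. if m = k then 1 else 0"]) simp
  next
    case (Cons \<mu> \<mu>s)
    then obtain c where c: "c k = (\<Prod>\<mu>\<leftarrow>\<mu>s. (zmat q n k k)\<^sup>2 - \<mu>)" "\<And>m. m < k \<Longrightarrow> c m = 0"
      "\<And>\<Lambda>. spherical t n q \<Lambda> \<Longrightarrow>
        \<Lambda> (center_prod n \<mu>s * partial_sym q k) = (\<Sum>m\<le>n. of_int (c m) * \<Lambda> (partial_sym q m))"
      by blast
    define d where "d m = (\<Sum>l\<le>n. c l * factor_mat q n \<mu> l m)" for m
    have "d k = (\<Sum>l\<le>n. if l = k then c k * factor_mat q n \<mu> k k else 0)"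
      unfolding d_def
    proof (rule sum.cong)
      fix l assume "l \<in> {..n}"
      then show "c l * factor_mat q n \<mu> l k = (if l = k then c k * factor_mat q n \<mu> k k else 0)"
        using c(2) factor_mat_below[of l n k] by (cases l k rule: linorder_cases) auto
    qed simp
    then have "d k = c k * ((zmat q n k k)\<^sup>2 - \<mu>)" using k by (simp add: factor_mat_diag)
    then have "d k = (\<Prod>\<mu>\<leftarrow>\<mu> # \<mu>s. (zmat q n k k)\<^sup>2 - \<mu>)" using c(1) by simp
    moreover have "d m = 0" if "m < k" for m
      unfolding d_def
    proof (rule sum.neutral, rule ballI)
      fix l assume "l \<in> {..n}"
      then show "c l * factor_mat q n \<mu> l m = 0"
        using c(2)[of l] factor_mat_below[of l n m q \<mu>] that by (cases "l < k") auto
    qed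
    moreover have "\<Lambda> (center_prod n (\<mu> # \<mu>s) * partial_sym q k) = (\<Sum>m\<le>n. of_int (d m) * \<Lambda> (partial_sym q m))"
      if sph: "spherical t n q \<Lambda>" for \<Lambda>
    proof -
      have "\<Lambda> (center_prod n (\<mu> # \<mu>s) * partial_sym q k) = \<Lambda> (center_factor n \<mu> * (center_prod n \<mu>s * partial_sym q k))"
        by (simp add: mult.assoc)
      also have "\<dots> = (\<Sum>l\<le>n. of_int (c l) * \<Lambda> (center_factor n \<mu> * partial_sym q l))"
        by (rule c(3)[OF spherical_center_factor[OF sph]])
      also have "\<dots> = (\<Sum>l\<le>n. \<Sum>m\<le>n. of_int (c l * factor_mat q n \<mu> l m) * \<Lambda> (partial_sym q m))"
        using sph by (intro sum.cong) (simp_all add: center_factor_expand sum_distrib_left mult.assoc)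
      also have "\<dots> = (\<Sum>m\<le>n. of_int (d m) * \<Lambda> (partial_sym q m))"
        unfolding d_def by (subst sum.swap) (simp add: sum_distrib_right)
      finally show ?thesis .
    qed
    ultimately show ?case by blast
  qed
  then obtain c where c: "c k = (\<Prod>\<mu>\<leftarrow>\<mu>s. (zmat q n k k)\<^sup>2 - \<mu>)" "\<forall>m<k. c m = 0" "\<And>\<Lambda>. spherical t n q \<Lambda> \<Longrightarrow>
      \<Lambda> (center_prod n \<mu>s * partial_sym q k) = (\<Sum>m\<le>n. of_int (c m) * \<Lambda> (partial_sym q m))"
    by blast
  have "(\<Sum>m\<le>n. of_int (c m) * \<Lambda> (partial_sym q m)) = (\<Sum>m\<in>{k..n}. of_int (c m) * \<Lambda> (partial_sym q m))"
    for \<Lambda> :: "'r \<Rightarrow> complex"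
    using c(2) by (intro sum.mono_neutral_right) auto
  then show thesis using c by (intro that[of c]) simp_all
qed

text \<open>
  This is the Cayley--Hamilton argument for a triangular matrix: the factor with index $k$ sends $u_k$ to a combination of
  $u_{k+1}, \dots, u_n$, which the factors with higher index kill. The case $u_0 = 1$ is the claim.
\<close>

theorem center_prod_annihilates:
  assumes "spherical t n q \<Lambda>"
  shows "\<Lambda> (center_prod n (map (\<lambda>k. (zmat q n k k)\<^sup>2) [0..<Suc n])) = 0"
proof -
  \<comment> \<open>The factors with index at least $k$ annihilate $u_k, \dots, u_n$, by downward induction on $k$.\<close>
  let ?P = "\<lambda>k. center_prod n (map (\<lambda>k. (zmat q n k k)\<^sup>2) [k..<Suc n])"
  have "\<forall>m. k \<le> m \<longrightarrow> m \<le> n \<longrightarrow> (\<forall>\<Lambda>. spherical t n q \<Lambda> \<longrightarrow> \<Lambda> (?P k * partial_sym q m) = 0)" if "k \<le> Suc n" for k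
    using that
  proof (induction k rule: inc_induct)
    case (step k)
    then have k: "k \<le> n" by simp
    have P: "?P k = center_factor n ((zmat q n k k)\<^sup>2) * ?P (Suc k)"
      using k by (simp add: upt_conv_Cons del: upt_Suc)
    show ?case
    proof (intro allI impI)
      fix m \<Lambda> assume m: "k \<le> m" "m \<le> n" and sph: "spherical t n q \<Lambda>"
      show "\<Lambda> (?P k * partial_sym q m) = 0"
      proof (cases "m = k")
        case False
        then have "Suc k \<le> m" using m by simp
        then have "\<Lambda> (center_factor n ((zmat q n k k)\<^sup>2) * (?P (Suc k) * partial_sym q m)) = 0"
          using step.IH[rule_format, OF _ m(2) spherical_center_factor[OF sph]] by blast
        then show ?thesis unfolding P by (simp only: mult.assoc)
      next
        case True
        have "\<Lambda> (?P k * partial_sym q k) = \<Lambda> (?P (Suc k) * (center_factor n ((zmat q n k k)\<^sup>2) * partial_sym q k))"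
          by (simp only: P center_factor_prod mult.assoc)
        also have "\<dots> = (\<Sum>l\<le>n. of_int (factor_mat q n ((zmat q n k k)\<^sup>2) k l) * \<Lambda> (?P (Suc k) * partial_sym q l))"
          by (rule center_factor_expand[OF spherical_center_prod[OF sph] k])
        also have "\<dots> = 0"
        proof (rule sum.neutral, rule ballI)
          fix l assume "l \<in> {..n}"
          then show "of_int (factor_mat q n ((zmat q n k k)\<^sup>2) k l) * \<Lambda> (?P (Suc k) * partial_sym q l) = 0"
            using factor_mat_below[OF k, of l] factor_mat_diag[OF k] step.IH[rule_format, of l, OF _ _ sph]
            by (cases l k rule: linorder_cases) (simp_all del: upt_Suc)
        qed
        finally show ?thesis using True by simp
      qed
    qed
  qed simp
  from this[of 0] have "\<Lambda> (?P 0 * partial_sym q 0) = 0" using assms by blast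
  then show ?thesis by simp
qed

end

section \<open>Averaging operators on functions\<close>

text \<open>
  Additive maps of a space of functions are closed under pointwise sum and under composition, so they form a
  ring in which the braid relations can be stated and the identities of the previous sections apply.
\<close>

typedef 'b endo = "{T :: ('b \<Rightarrow> complex) \<Rightarrow> 'b \<Rightarrow> complex.
    \<forall>f g. T (\<lambda>x. f x + g x) = (\<lambda>x. T f x + T g x)}"
  morphisms app Endo
  by (rule exI[of _ "\<lambda>f. f"]) simp

setup_lifting type_definition_endo

lemma app_add_fun: "app T (\<lambda>x. f x + g x) = (\<lambda>x. app T f x + app T g x)"
  using app[of T] by simp

lemma app_zero_fun: "app T (\<lambda>x. 0) = (\<lambda>x. 0)"
  using app_add_fun[of T "\<lambda>x. 0" "\<lambda>x. 0"] by (simp add: fun_eq_iff)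

lemma app_nat_fun: "app T (\<lambda>x. of_nat m * f x) = (\<lambda>x. of_nat m * app T f x)"
  by (induction m) (simp_all add: app_zero_fun app_add_fun algebra_simps)

instantiation endo :: (type) ring_1
begin

lift_definition zero_endo :: "'a endo" is "\<lambda>f x. 0" by simp
lift_definition one_endo :: "'a endo" is "\<lambda>f. f" by simp
lift_definition plus_endo :: "'a endo \<Rightarrow> 'a endo \<Rightarrow> 'a endo" is "\<lambda>S T f x. S f x + T f x"
  by (simp add: fun_eq_iff algebra_simps)
lift_definition uminus_endo :: "'a endo \<Rightarrow> 'a endo" is "\<lambda>S f x. - S f x"
  by (simp add: fun_eq_iff algebra_simps)
lift_definition minus_endo :: "'a endo \<Rightarrow> 'a endo \<Rightarrow> 'a endo" is "\<lambda>S T f x. S f x - T f x"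
  by (simp add: fun_eq_iff algebra_simps)
lift_definition times_endo :: "'a endo \<Rightarrow> 'a endo \<Rightarrow> 'a endo" is "\<lambda>S T f. S (T f)"
  by simp

instance
proof
  show "(0 :: 'a endo) \<noteq> 1"
    by transfer (metis zero_neq_one)
qed (transfer; simp add: fun_eq_iff algebra_simps)+

end

lemma endo_eqI: "(\<And>w x. app S w x = app T w x) \<Longrightarrow> S = T"
  by (simp add: app_inject[symmetric] fun_eq_iff)

lemma app_times: "app (S * T) w = app S (app T w)"
  and app_one: "app 1 w = w"
  and app_plus: "app (S + T) w x = app S w x + app T w x"
  and app_minus: "app (S - T) w x = app S w x - app T w x"
  by (transfer; simp)+

lemma app_of_nat: "app (of_nat m) w x = of_nat m * w x"
  by (induction m) (simp_all add: app_plus app_one algebra_simps zero_endo.rep_eq)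

lift_definition pull :: "complex \<Rightarrow> ('c::finite \<Rightarrow> 'b \<Rightarrow> 'b) \<Rightarrow> 'b endo" is
  "\<lambda>\<kappa> \<phi> w x. \<kappa> * (\<Sum>c\<in>UNIV. w (\<phi> c x))"
  by (simp add: fun_eq_iff sum.distrib algebra_simps)

lemmas app_pull = pull.rep_eq

section \<open>The generators as row operations\<close>

text \<open>
  Indexing rows and columns by all natural numbers makes the generators independent of $n$, so that they
  live in one ring and a family of them satisfies the relations for all $n$ at once.
\<close>

type_synonym 'a rows = "nat \<Rightarrow> nat \<Rightarrow> 'a"
type_synonym 'a row_pair = "'a rows \<times> 'a rows"

text \<open>
  In the pair formed by row $0$ of each half this is the left multiplication by $J^{-1} u$ in the case
  $n = 1$, where the upper right entry of $u$ is $x$.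
\<close>

fun dual :: "'a::field \<Rightarrow> 'a row_pair \<Rightarrow> 'a row_pair" where
  "dual x (A, R) = (A(0 := R 0), R(0 := (\<lambda>k. - A 0 k - x * R 0 k)))"

text \<open>
  The lower rows are multiplied by a shear and then by a transposition, the upper rows by the inverse transpose. The
  determinant on the lower rows is $-1$, whence the sign $\beta(-1)$ in the generators below.
\<close>

fun rot :: "nat \<Rightarrow> 'a::field \<Rightarrow> 'a row_pair \<Rightarrow> 'a row_pair" where
  "rot i c (A, R) =
    (A(i := (\<lambda>k. A (Suc i) k - c * A i k), Suc i := A i),
     R(i := R (Suc i), Suc i := (\<lambda>k. R i k + c * R (Suc i) k)))"

fun shear :: "nat \<Rightarrow> nat \<Rightarrow> 'a::field \<Rightarrow> 'a row_pair \<Rightarrow> 'a row_pair" where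
  "shear a b c (A, R) = (A(b := (\<lambda>k. A b k - c * A a k)), R(a := (\<lambda>k. R a k + c * R b k)))"

fun scale :: "nat \<Rightarrow> 'a::field \<Rightarrow> 'a row_pair \<Rightarrow> 'a row_pair" where
  "scale a s (A, R) = (A(a := (\<lambda>k. inverse s * A a k)), R(a := (\<lambda>k. s * R a k)))"

fun unip1 :: "nat \<Rightarrow> 'a::field \<Rightarrow> 'a row_pair \<Rightarrow> 'a row_pair" where
  "unip1 a x (A, R) = (A(a := (\<lambda>k. A a k + x * R a k)), R)"

fun unip2 :: "nat \<Rightarrow> nat \<Rightarrow> 'a::field \<Rightarrow> 'a row_pair \<Rightarrow> 'a row_pair" where
  "unip2 a b x (A, R) = (A(a := (\<lambda>k. A a k + x * R b k), b := (\<lambda>k. A b k + x * R a k)), R)"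

lemma rot_rot_far: "Suc i < j \<Longrightarrow> rot i c (rot j d \<tau>) = rot j d (rot i c \<tau>)"
  by (cases \<tau>) (auto simp: fun_eq_iff)

lemma dual_rot_far: "0 < j \<Longrightarrow> dual x (rot j d \<tau>) = rot j d (dual x \<tau>)"
  by (cases \<tau>) (auto simp: fun_eq_iff)

text \<open>
  Here and in \<open>dual_rot_braid\<close> the two sides are the same product of elementary matrices in two
  orders. As the parameters on the right are a bijective function of those on the left, summing
  over all parameters gives the braid relations.
\<close>

lemma rot_braid: "rot i z (rot (Suc i) y (rot i x \<tau>)) = rot (Suc i) x (rot i (y - x * z) (rot (Suc i) z \<tau>))"
  by (cases \<tau>) (auto simp: fun_eq_iff algebra_simps)

lemma dual_rot_braid:
  "rot 0 d (dual y (rot 0 c (dual x \<tau>))) =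
   dual x (rot 0 (c - x * d) (dual (y - d * (c - x * d) - d * c) (rot 0 (- d) \<tau>)))"
  by (cases \<tau>) (auto simp: fun_eq_iff algebra_simps)

lemma sum_swap3:
  fixes F :: "'a::finite \<Rightarrow> 'a \<Rightarrow> 'a \<Rightarrow> complex"
  shows "(\<Sum>a\<in>UNIV. \<Sum>b\<in>UNIV. \<Sum>c\<in>UNIV. F a b c) = (\<Sum>(a, b, c)\<in>UNIV. F a b c)"
  by (simp add: sum.cartesian_product flip: UNIV_Times_UNIV)

lemma sum_swap4:
  fixes F :: "'a::finite \<Rightarrow> 'a \<Rightarrow> 'a \<Rightarrow> 'a \<Rightarrow> complex"
  shows "(\<Sum>a\<in>UNIV. \<Sum>b\<in>UNIV. \<Sum>c\<in>UNIV. \<Sum>d\<in>UNIV. F a b c d) = (\<Sum>(a, b, c, d)\<in>UNIV. F a b c d)"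
  by (simp add: sum.cartesian_product flip: UNIV_Times_UNIV)

text \<open>
  The square root $\epsilon$ normalises $t_0$ such that its square is $1$ on equivariant functions; the
  Gauss sum of $\beta$ is one choice.
\<close>

locale sign_char =
  fixes \<beta> :: "'a::{field,finite} \<Rightarrow> complex" and \<epsilon> :: complex
  assumes \<beta>_mult: "x \<noteq> 0 \<Longrightarrow> y \<noteq> 0 \<Longrightarrow> \<beta> (x * y) = \<beta> x * \<beta> y"
    and \<beta>_sq: "x \<noteq> 0 \<Longrightarrow> \<beta> x * \<beta> x = 1"
    and \<beta>_nontrivial: "\<exists>x. x \<noteq> 0 \<and> \<beta> x \<noteq> 1"
    and \<epsilon>_sq: "\<epsilon> * \<epsilon> = \<beta> (- 1) * of_nat CARD('a)"
begin

primrec gen :: "nat \<Rightarrow> 'a row_pair endo" where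
  "gen 0 = pull (inverse \<epsilon>) dual"
| "gen (Suc i) = pull (\<beta> (- 1)) (rot i)"

lemma \<beta>_1: "\<beta> 1 = 1"
  using \<beta>_mult[of 1 1] \<beta>_sq[of 1] by simp

lemma \<beta>_m1_sq: "\<beta> (- 1) * \<beta> (- 1) = 1"
  using \<beta>_sq[of "- 1"] by simp

lemma \<beta>_inverse: "x \<noteq> 0 \<Longrightarrow> \<beta> (inverse x) = \<beta> x"
proof -
  assume x: "x \<noteq> 0"
  have "\<beta> (inverse x) = \<beta> (inverse x) * (\<beta> x * \<beta> x)" using \<beta>_sq[OF x] by simp
  also have "\<dots> = \<beta> (inverse x * x) * \<beta> x" using x \<beta>_mult[of "inverse x" x] by (simp add: mult.assoc)
  finally show ?thesis using x \<beta>_1 by simp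
qed

lemma \<beta>_sum: "(\<Sum>y\<in>UNIV - {0}. \<beta> y) = 0"
proof -
  obtain x where x: "x \<noteq> 0" "\<beta> x \<noteq> 1" using \<beta>_nontrivial by blast
  have "(\<Sum>y\<in>UNIV - {0}. \<beta> y) = (\<Sum>y\<in>UNIV - {0}. \<beta> (x * y))"
    by (rule sum.reindex_bij_witness[of _ "\<lambda>y. x * y" "\<lambda>y. inverse x * y"])
       (use x in \<open>auto simp: mult.assoc[symmetric]\<close>)
  also have "\<dots> = \<beta> x * (\<Sum>y\<in>UNIV - {0}. \<beta> y)"
    using x by (simp add: sum_distrib_left \<beta>_mult)
  finally show ?thesis using x by simp
qed

lemma \<epsilon>_nz: "\<epsilon> \<noteq> 0"
proof
  assume "\<epsilon> = 0"
  then have "\<beta> (- 1) * of_nat CARD('a) = 0" using \<epsilon>_sq by simp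
  then show False using \<beta>_m1_sq by auto
qed

sublocale braid_C gen
proof
  fix i j :: nat assume ij: "Suc i < j"
  then obtain j' where j: "j = Suc j'" by (cases j) auto
  show "gen i * gen j = gen j * gen i"
  proof (cases i)
    case 0
    then have "0 < j'" using ij j by simp
    then show ?thesis unfolding 0 j
      by (intro endo_eqI)
        (simp add: app_times app_pull sum_distrib_left dual_rot_far mult_ac, rule sum.swap)
  next
    case (Suc i')
    then have ij': "Suc i' < j'" using ij j by simp
    show ?thesis
    proof (rule endo_eqI)
      fix w :: "'a row_pair \<Rightarrow> complex" and \<tau>
      have "(\<Sum>c\<in>UNIV. \<Sum>d\<in>UNIV. w (rot j' d (rot i' c \<tau>))) =
          (\<Sum>d\<in>UNIV. \<Sum>c\<in>UNIV. w (rot i' c (rot j' d \<tau>)))"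
        by (subst sum.swap) (simp add: rot_rot_far[OF ij'])
      then show "app (gen i * gen j) w \<tau> = app (gen j * gen i) w \<tau>"
        unfolding Suc j by (simp add: app_times app_pull flip: sum_distrib_left)
    qed
  qed
next
  fix i :: nat assume "0 < i"
  then obtain i' where i: "i = Suc i'" by (cases i) auto
  show "gen i * gen (Suc i) * gen i = gen (Suc i) * gen i * gen (Suc i)"
  proof (rule endo_eqI)
    fix w :: "'a row_pair \<Rightarrow> complex" and \<tau>
    have "(\<Sum>x\<in>UNIV. \<Sum>y\<in>UNIV. \<Sum>z\<in>UNIV. w (rot i' z (rot (Suc i') y (rot i' x \<tau>)))) =
          (\<Sum>x\<in>UNIV. \<Sum>y\<in>UNIV. \<Sum>z\<in>UNIV. w (rot (Suc i') z (rot i' y (rot (Suc i') x \<tau>))))"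
      unfolding sum_swap3
      by (rule sum.reindex_bij_witness[of _ "\<lambda>(z, y, x). (x, y + x * z, z)" "\<lambda>(x, y, z). (z, y - x * z, x)"])
        (auto simp: rot_braid)
    then show "app (gen i * gen (Suc i) * gen i) w \<tau> = app (gen (Suc i) * gen i * gen (Suc i)) w \<tau>"
      unfolding i by (simp add: app_times app_pull flip: sum_distrib_left)
  qed
next
  show "gen 0 * gen 1 * gen 0 * gen 1 = gen 1 * gen 0 * gen 1 * gen 0"
  proof (rule endo_eqI)
    fix w :: "'a row_pair \<Rightarrow> complex" and \<tau>
    have "(\<Sum>x\<in>UNIV. \<Sum>c\<in>UNIV. \<Sum>y\<in>UNIV. \<Sum>d\<in>UNIV. w (rot 0 d (dual y (rot 0 c (dual x \<tau>))))) =
          (\<Sum>c\<in>UNIV. \<Sum>x\<in>UNIV. \<Sum>d\<in>UNIV. \<Sum>y\<in>UNIV. w (dual y (rot 0 d (dual x (rot 0 c \<tau>)))))"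
      unfolding sum_swap4
      by (rule sum.reindex_bij_witness[of _
            "\<lambda>(c, x, d, y). (y, d - y * c, x - d * c - c * (d - y * c), - c)"
            "\<lambda>(x, c, y, d). (- d, y - d * (c - x * d) - d * c, c - x * d, x)"])
        (auto simp: dual_rot_braid algebra_simps)
    then show "app (gen 0 * gen 1 * gen 0 * gen 1) w \<tau> = app (gen 1 * gen 0 * gen 1 * gen 0) w \<tau>"
      by (simp add: app_times app_pull flip: sum_distrib_left)
  qed
qed

text \<open>
  Equivariance under the Siegel parabolic, spelled out for the row operations that occur in the relations.
\<close>

definition equivariant :: "nat \<Rightarrow> ('a row_pair \<Rightarrow> complex) \<Rightarrow> bool" where
  "equivariant n d \<longleftrightarrow>
     (\<forall>a x \<tau>. a < n \<longrightarrow> d (unip1 a x \<tau>) = d \<tau>) \<and>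
     (\<forall>a b x \<tau>. a < n \<longrightarrow> b < n \<longrightarrow> a \<noteq> b \<longrightarrow> d (unip2 a b x \<tau>) = d \<tau>) \<and>
     (\<forall>a b x \<tau>. a < n \<longrightarrow> b < n \<longrightarrow> a \<noteq> b \<longrightarrow> d (shear a b x \<tau>) = d \<tau>) \<and>
     (\<forall>a s \<tau>. a < n \<longrightarrow> s \<noteq> 0 \<longrightarrow> d (scale a s \<tau>) = \<beta> s * d \<tau>) \<and>
     (\<forall>i c \<tau>. Suc i < n \<longrightarrow> d (rot i c \<tau>) = \<beta> (- 1) * d \<tau>)"

text \<open>
  The equivariance of $L_i f$: it is inherited from $f$ for upper triangular operations on the
  rows from $i$ on, and just suffices for the quadratic relation of $t_{i+1}$.
\<close>

definition borel_above :: "nat \<Rightarrow> nat \<Rightarrow> ('a row_pair \<Rightarrow> complex) \<Rightarrow> bool" where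
  "borel_above n i w \<longleftrightarrow>
     (\<forall>a b x \<tau>. i \<le> a \<longrightarrow> a < b \<longrightarrow> b < n \<longrightarrow> w (shear a b x \<tau>) = w \<tau>) \<and>
     (\<forall>a s \<tau>. i \<le> a \<longrightarrow> a < n \<longrightarrow> s \<noteq> 0 \<longrightarrow> w (scale a s \<tau>) = \<beta> s * w \<tau>)"

lemma equivariantD:
  assumes "equivariant n d"
  shows "a < n \<Longrightarrow> d (unip1 a x \<tau>) = d \<tau>"
    and "a < n \<Longrightarrow> b < n \<Longrightarrow> a \<noteq> b \<Longrightarrow> d (unip2 a b x \<tau>) = d \<tau>"
    and "a < n \<Longrightarrow> b < n \<Longrightarrow> a \<noteq> b \<Longrightarrow> d (shear a b x \<tau>) = d \<tau>"
    and "a < n \<Longrightarrow> s \<noteq> 0 \<Longrightarrow> d (scale a s \<tau>) = \<beta> s * d \<tau>"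
    and "Suc i < n \<Longrightarrow> d (rot i c \<tau>) = \<beta> (- 1) * d \<tau>"
  using assms unfolding equivariant_def by blast+

lemma borel_aboveD:
  assumes "borel_above n i w"
  shows "i \<le> a \<Longrightarrow> a < b \<Longrightarrow> b < n \<Longrightarrow> w (shear a b x \<tau>) = w \<tau>"
    and "i \<le> a \<Longrightarrow> a < n \<Longrightarrow> s \<noteq> 0 \<Longrightarrow> w (scale a s \<tau>) = \<beta> s * w \<tau>"
  using assms unfolding borel_above_def by blast+

lemma gen_equivariant:
  assumes "equivariant n d" "0 < i" "i < n"
  shows "app (gen i) d = (\<lambda>\<tau>. of_nat CARD('a) * d \<tau>)"
proof -
  obtain j where j: "i = Suc j" using assms by (cases i) auto
  have "d (rot j c \<tau>) = \<beta> (- 1) * d \<tau>" for c \<tau> using assms j unfolding equivariant_def by blast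
  then show ?thesis unfolding j using \<beta>_m1_sq by (simp add: app_pull fun_eq_iff)
qed

lemma dual_dual_zero: "dual 0 (dual x \<tau>) = scale 0 (- 1) (unip1 0 x \<tau>)"
  by (cases \<tau>) (auto simp: fun_eq_iff)

lemma dual_dual_nonzero:
  assumes "y \<noteq> 0"
  shows "unip1 0 (inverse y) (dual y (dual x \<tau>)) =
    scale 0 y (scale 0 (- 1) (dual (x - inverse y) \<tau>))"
  using assms by (cases \<tau>) (auto simp: fun_eq_iff field_simps)

text \<open>
  In the double sum the terms with $y = 0$ return to $\tau$ up to the parabolic and give $\beta(-1) q f(\tau)$.
  For $y \ne 0$ the product of two Weyl elements is, up to the parabolic, a single one, with the factor
  $\beta(y)$; so these terms add up to a multiple of $\sum_y \beta(y) = 0$ and no linear term survives.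
\<close>

lemma gen0_quadratic:
  assumes "equivariant n d" "0 < n"
  shows "app (gen 0) (app (gen 0) d) = d"
proof
  fix \<tau>
  have u: "d (unip1 0 x \<sigma>) = d \<sigma>" and s: "y \<noteq> 0 \<Longrightarrow> d (scale 0 y \<sigma>) = \<beta> y * d \<sigma>" for x y \<sigma>
    using equivariantD(1,4)[OF assms(1)] assms(2) by auto
  define G where "G = (\<Sum>x\<in>UNIV. \<beta> (- 1) * d (dual x \<tau>))"
  have nz: "(\<Sum>x\<in>UNIV. d (dual y (dual x \<tau>))) = \<beta> y * G" if "y \<noteq> 0" for y
  proof -
    have "d (dual y (dual x \<tau>)) = \<beta> y * (\<beta> (- 1) * d (dual (x - inverse y) \<tau>))" for x
    proof -
      have "d (dual y (dual x \<tau>)) = d (unip1 0 (inverse y) (dual y (dual x \<tau>)))" by (simp only: u)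
      then show ?thesis using that by (simp only: dual_dual_nonzero[OF that]) (simp add: s)
    qed
    then have "(\<Sum>x\<in>UNIV. d (dual y (dual x \<tau>))) =
        (\<Sum>x\<in>UNIV. \<beta> y * (\<beta> (- 1) * d (dual (x - inverse y) \<tau>)))" by simp
    also have "\<dots> = (\<Sum>x\<in>UNIV. \<beta> y * (\<beta> (- 1) * d (dual x \<tau>)))"
      by (rule sum.reindex_bij_witness[of _ "\<lambda>x. x + inverse y" "\<lambda>x. x - inverse y"]) auto
    finally show ?thesis unfolding G_def by (simp add: sum_distrib_left)
  qed
  have z: "(\<Sum>x\<in>UNIV. d (dual 0 (dual x \<tau>))) = \<beta> (- 1) * of_nat CARD('a) * d \<tau>"
    by (simp add: dual_dual_zero s u)
  have "(\<Sum>x\<in>UNIV. \<Sum>y\<in>UNIV. d (dual y (dual x \<tau>))) = (\<Sum>y\<in>UNIV. \<Sum>x\<in>UNIV. d (dual y (dual x \<tau>)))"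
    by (rule sum.swap)
  also have "\<dots> = \<beta> (- 1) * of_nat CARD('a) * d \<tau> + (\<Sum>y\<in>UNIV - {0}. \<beta> y * G)"
    by (subst sum.remove[of _ 0]) (simp_all add: z nz)
  also have "(\<Sum>y\<in>UNIV - {0}. \<beta> y * G) = 0"
    using \<beta>_sum by (simp flip: sum_distrib_right)
  finally have "(\<Sum>x\<in>UNIV. \<Sum>y\<in>UNIV. d (dual y (dual x \<tau>))) = \<epsilon> * \<epsilon> * d \<tau>" by (simp add: \<epsilon>_sq)
  moreover have "app (gen 0) (app (gen 0) d) \<tau> =
      inverse \<epsilon> * inverse \<epsilon> * (\<Sum>x\<in>UNIV. \<Sum>y\<in>UNIV. d (dual y (dual x \<tau>)))"
    by (simp add: app_pull mult.assoc flip: sum_distrib_left)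
  moreover have "inverse \<epsilon> * inverse \<epsilon> * (\<epsilon> * \<epsilon>) = 1" using \<epsilon>_nz by (simp add: field_simps)
  ultimately show "app (gen 0) (app (gen 0) d) \<tau> = d \<tau>" by (simp only: mult.assoc[symmetric]) simp
qed

lemma rot_rot_zero: "rot i 0 (rot i c \<tau>) = shear i (Suc i) c \<tau>"
  by (cases \<tau>) (auto simp: fun_eq_iff)

lemma rot_rot_nonzero:
  assumes "e \<noteq> 0"
  shows "rot i e (rot i c \<tau>) =
    shear i (Suc i) (inverse e) (scale i (- inverse e) (scale (Suc i) e (rot i (c + inverse e) \<tau>)))"
  using assms by (cases \<tau>) (auto simp: fun_eq_iff field_simps)

text \<open>
  The same computation as for $t_0$, except that the terms with $e \ne 0$ all come with the factor
  $\beta(-1)$: the two diagonal entries $-1/e$ and $e$ contribute $\beta(-1)$ together. So the usual linear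
  term appears.
\<close>

lemma gen_quadratic:
  assumes w: "borel_above n i w" and i: "Suc i < n"
  shows "app (gen (Suc i)) (app (gen (Suc i)) w) \<tau> =
    (of_nat CARD('a) - 1) * app (gen (Suc i)) w \<tau> + of_nat CARD('a) * w \<tau>"
proof -
  have sh: "w (shear i (Suc i) x \<sigma>) = w \<sigma>" for x \<sigma> using borel_aboveD(1)[OF w] i by simp
  have sc: "y \<noteq> 0 \<Longrightarrow> w (scale i y \<sigma>) = \<beta> y * w \<sigma>" "y \<noteq> 0 \<Longrightarrow> w (scale (Suc i) y \<sigma>) = \<beta> y * w \<sigma>" for y \<sigma>
    using borel_aboveD(2)[OF w] i by simp_all
  define G where "G = (\<Sum>c\<in>UNIV. \<beta> (- 1) * w (rot i c \<tau>))"
  have nz: "(\<Sum>c\<in>UNIV. w (rot i e (rot i c \<tau>))) = G" if e: "e \<noteq> 0" for e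
  proof -
    have "w (rot i e (rot i c \<tau>)) = \<beta> (- 1) * w (rot i (c + inverse e) \<tau>)" for c
    proof -
      have "\<beta> (- inverse e) * \<beta> e = \<beta> (- 1)" using e \<beta>_mult[of "- inverse e" e] by simp
      then show ?thesis using e by (simp add: rot_rot_nonzero sh sc flip: mult.assoc)
    qed
    then have "(\<Sum>c\<in>UNIV. w (rot i e (rot i c \<tau>))) =
        (\<Sum>c\<in>UNIV. \<beta> (- 1) * w (rot i (c + inverse e) \<tau>))" by simp
    also have "\<dots> = G" unfolding G_def
      by (rule sum.reindex_bij_witness[of _ "\<lambda>x. x - inverse e" "\<lambda>x. x + inverse e"]) auto
    finally show ?thesis .
  qed
  have z: "(\<Sum>c\<in>UNIV. w (rot i 0 (rot i c \<tau>))) = of_nat CARD('a) * w \<tau>"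
    by (simp add: rot_rot_zero sh)
  have "(\<Sum>c\<in>UNIV. \<Sum>e\<in>UNIV. w (rot i e (rot i c \<tau>))) = (\<Sum>e\<in>UNIV. \<Sum>c\<in>UNIV. w (rot i e (rot i c \<tau>)))"
    by (rule sum.swap)
  also have "\<dots> = of_nat CARD('a) * w \<tau> + (\<Sum>e\<in>UNIV - {0::'a}. G)"
    by (subst sum.remove[of _ 0]) (simp_all add: z nz)
  also have "(\<Sum>e\<in>UNIV - {0::'a}. G) = (of_nat CARD('a) - 1) * G"
    by (simp add: card_Diff_singleton of_nat_diff Suc_leI)
  finally have "(\<Sum>c\<in>UNIV. \<Sum>e\<in>UNIV. w (rot i e (rot i c \<tau>))) =
      of_nat CARD('a) * w \<tau> + (of_nat CARD('a) - 1) * G" .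
  moreover have "app (gen (Suc i)) (app (gen (Suc i)) w) \<tau> =
      (\<beta> (- 1) * \<beta> (- 1)) * (\<Sum>c\<in>UNIV. \<Sum>e\<in>UNIV. w (rot i e (rot i c \<tau>)))"
    by (simp add: app_pull flip: sum_distrib_left)
  moreover have "G = app (gen (Suc i)) w \<tau>" by (simp add: G_def app_pull sum_distrib_left)
  ultimately show ?thesis using \<beta>_m1_sq by simp
qed

lemma dual_shear: "0 < b \<Longrightarrow> dual x (shear 0 b c \<tau>) =
    unip2 0 b c (shear 0 b (- x * c) (unip1 b (x * c * c) (dual x \<tau>)))"
  by (cases \<tau>) (auto simp: fun_eq_iff algebra_simps)

lemma dual_shear_far: "0 < a \<Longrightarrow> 0 < b \<Longrightarrow> dual x (shear a b c \<tau>) = shear a b c (dual x \<tau>)"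
  by (cases \<tau>) (auto simp: fun_eq_iff)

lemma dual_scale: "s \<noteq> 0 \<Longrightarrow> dual x (scale 0 s \<tau>) = scale 0 (inverse s) (dual (x * s * s) \<tau>)"
  by (cases \<tau>) (auto simp: fun_eq_iff field_simps)

lemma dual_scale_far: "0 < a \<Longrightarrow> dual x (scale a s \<tau>) = scale a s (dual x \<tau>)"
  by (cases \<tau>) (auto simp: fun_eq_iff)

lemma rot_shear: "Suc i < b \<Longrightarrow> rot i c (shear (Suc i) b x \<tau>) = shear i b x (shear (Suc i) b (c * x) (rot i c \<tau>))"
  by (cases \<tau>) (auto simp: fun_eq_iff algebra_simps)

lemma rot_shear_far: "Suc i < a \<Longrightarrow> Suc i < b \<Longrightarrow> rot i c (shear a b x \<tau>) = shear a b x (rot i c \<tau>)"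
  by (cases \<tau>) (auto simp: fun_eq_iff)

lemma rot_scale: "s \<noteq> 0 \<Longrightarrow> rot i c (scale (Suc i) s \<tau>) = scale i s (rot i (c * s) \<tau>)"
  by (cases \<tau>) (auto simp: fun_eq_iff field_simps)

lemma rot_scale_far: "Suc i < a \<Longrightarrow> rot i c (scale a s \<tau>) = scale a s (rot i c \<tau>)"
  by (cases \<tau>) (auto simp: fun_eq_iff)

lemma sum_rescale:
  fixes F :: "'a \<Rightarrow> complex"
  assumes "s \<noteq> 0"
  shows "(\<Sum>c\<in>UNIV. F (c * s)) = (\<Sum>c\<in>UNIV. F c)"
  by (rule sum.reindex_bij_witness[of _ "\<lambda>c. c * inverse s" "\<lambda>c. c * s"]) (use assms in \<open>auto simp: mult.assoc\<close>)

text \<open>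
  Moving an upper triangular operation through the Weyl element in row $0$ produces elements of the parabolic
  and at most rescales the summation variable by the square $s^2$.
\<close>

lemma borel_above_gen0:
  assumes d: "equivariant n d"
  shows "borel_above n 0 (app (gen 0) d)"
  unfolding borel_above_def
proof (intro conjI allI impI)
  fix a b x \<tau> assume ab: "0 \<le> a" "a < b" "b < n"
  have "d (dual y (shear a b x \<tau>)) = d (dual y \<tau>)" for y
    using ab by (cases "a = 0") (simp_all add: dual_shear dual_shear_far equivariantD[OF d])
  then show "app (gen 0) d (shear a b x \<tau>) = app (gen 0) d \<tau>" by (simp add: app_pull)
next
  fix a s \<tau> assume a: "0 \<le> a" "a < n" and s: "s \<noteq> (0::'a)"
  show "app (gen 0) d (scale a s \<tau>) = \<beta> s * app (gen 0) d \<tau>"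
  proof (cases "a = 0")
    case True
    have "d (dual y (scale a s \<tau>)) = \<beta> s * d (dual (y * s * s) \<tau>)" for y
      using a s True by (simp add: dual_scale equivariantD[OF d] \<beta>_inverse)
    then show ?thesis
      using sum_rescale[of "s * s" "\<lambda>y. d (dual y \<tau>)"] s
      by (simp add: app_pull mult.assoc flip: sum_distrib_left)
  next
    case False
    then show ?thesis using a s
      by (simp add: dual_scale_far equivariantD[OF d] app_pull flip: sum_distrib_left)
  qed
qed

lemma borel_above_gen_Suc:
  assumes w: "borel_above n i w"
  shows "borel_above n (Suc i) (app (gen (Suc i)) w)"
  unfolding borel_above_def
proof (intro conjI allI impI)
  fix a b x \<tau> assume ab: "Suc i \<le> a" "a < b" "b < n"
  have "w (rot i c (shear a b x \<tau>)) = w (rot i c \<tau>)" for c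
    using ab by (cases "a = Suc i") (simp_all add: rot_shear rot_shear_far borel_aboveD[OF w])
  then show "app (gen (Suc i)) w (shear a b x \<tau>) = app (gen (Suc i)) w \<tau>" by (simp add: app_pull)
next
  fix a s \<tau> assume a: "Suc i \<le> a" "a < n" and s: "s \<noteq> (0::'a)"
  show "app (gen (Suc i)) w (scale a s \<tau>) = \<beta> s * app (gen (Suc i)) w \<tau>"
  proof (cases "a = Suc i")
    case True
    have "w (rot i c (scale a s \<tau>)) = \<beta> s * w (rot i (c * s) \<tau>)" for c
      using a s True by (simp add: rot_scale borel_aboveD[OF w])
    then show ?thesis
      using sum_rescale[OF s, of "\<lambda>c. w (rot i c \<tau>)"]
      by (simp add: app_pull flip: sum_distrib_left)
  next
    case False
    then show ?thesis using a s
      by (simp add: rot_scale_far borel_aboveD[OF w] app_pull flip: sum_distrib_left)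
  qed
qed

lemma borel_above_chain: "equivariant n d \<Longrightarrow> borel_above n i (app (chain i) d)"
  by (induction i) (simp_all add: borel_above_gen0 borel_above_gen_Suc app_times del: gen.simps)

lemma app_right_absorb:
  assumes "equivariant n d" "0 < i" "i < n"
  shows "app (r * gen i) d \<tau> = of_nat CARD('a) * app r d \<tau>"
  using gen_equivariant[OF assms] by (simp add: app_times app_nat_fun)

lemma app_L_chain:
  assumes "equivariant n d" "l < n"
  shows "app (L l) d \<tau> = of_nat CARD('a) ^ l * app (chain l) d \<tau>"
  using absorb_chain[of l "\<lambda>r. app r d \<tau>" "CARD('a)" 1] app_right_absorb[OF assms(1)] assms(2) by simp

text \<open>
  On equivariant functions $L_l$ is a multiple of the chain $t_l \cdots t_0$, and through the chain the
  equivariance is passed on from one generator to the next.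
\<close>

lemma borel_above_L:
  assumes "equivariant n d" "l < n"
  shows "borel_above n l (app (L l) d)"
  using borel_above_chain[OF assms(1), of l] app_L_chain[OF assms] by (simp add: borel_above_def)

text \<open>
  Right absorption and the quadratic relations come from the equivariance of $d$; only the absorption on the
  left has to be provided by the functional that is applied at the end.
\<close>

lemma spherical_of_absorbing:
  assumes d: "equivariant n d"
    and e_add: "\<And>v w. e (\<lambda>\<tau>. v \<tau> + w \<tau>) = e v + e w"
    and left: "\<And>i w. 0 < i \<Longrightarrow> i < n \<Longrightarrow> e (app (gen i) w) = of_nat CARD('a) * e w"
  shows "spherical gen n CARD('a) (\<lambda>r. e (app r d))"
proof -
  have z: "e (\<lambda>\<tau>. 0) = 0" using e_add[of "\<lambda>\<tau>. 0" "\<lambda>\<tau>. 0"] by simp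
  have nat: "e (\<lambda>\<tau>. of_nat m * w \<tau>) = of_nat m * e w" for m w
    by (induction m) (simp_all add: z e_add algebra_simps)
  show ?thesis
  proof
    show "e (app (r + s) d) = e (app r d) + e (app s d)" for r s
      unfolding e_add[symmetric] by (simp add: app_plus[abs_def])
    fix r i
    show "e (app (gen i * r) d) = of_nat CARD('a) * e (app r d)" if "0 < i" "i < n"
      using left[OF that] by (simp add: app_times)
    show "e (app (r * gen i) d) = of_nat CARD('a) * e (app r d)" if "0 < i" "i < n"
      using gen_equivariant[OF d that] by (simp add: app_times app_nat_fun nat)
    show "e (app (r * gen 0 * gen 0) d) = e (app r d)" if "0 < n"
      using gen0_quadratic[OF d that] by (simp add: app_times)
    show "e (app (r * gen (Suc i) * gen (Suc i) * L i) d) =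
       (of_nat CARD('a) - 1) * e (app (r * gen (Suc i) * L i) d) + of_nat CARD('a) * e (app (r * L i) d)"
      if i: "Suc i < n"
    proof -
      let ?w = "app (L i) d" and ?g = "gen (Suc i)"
      have q: "of_nat CARD('a) - 1 = (of_nat (CARD('a) - 1) :: complex)" by (simp add: of_nat_diff Suc_leI)
      have "app ?g (app ?g ?w) = (\<lambda>\<tau>. of_nat (CARD('a) - 1) * app ?g ?w \<tau> + of_nat CARD('a) * ?w \<tau>)"
        unfolding q[symmetric]
        by (rule ext) (rule gen_quadratic[OF borel_above_L[OF d Suc_lessD[OF i]] i])
      then show ?thesis unfolding q by (simp only: app_times app_add_fun app_nat_fun e_add nat)
    qed
  qed
qed

end

section \<open>The central element as a sum over symmetric matrices\<close>

text \<open>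
  Vectors and matrices of size $l$ are extended by zero, so that the sets for $l$ and $l + 1$ are sets of the same type.
\<close>

definition vec_set :: "nat \<Rightarrow> (nat \<Rightarrow> 'a::zero) set" where
  "vec_set l = {v. \<forall>i\<ge>l. v i = 0}"

definition sym_set :: "nat \<Rightarrow> (nat \<Rightarrow> nat \<Rightarrow> 'a::zero) set" where
  "sym_set l = {X. (\<forall>i j. X i j = X j i) \<and> (\<forall>i\<ge>l. \<forall>j. X i j = 0)}"

text \<open>
  The composite of \<open>rot 0 (v 0)\<close>, ..., \<open>rot (l - 1) (v (l - 1))\<close>, the last of which is
  applied first; see \<open>cyc_rot\<close>.
\<close>

fun cyc :: "nat \<Rightarrow> (nat \<Rightarrow> 'a::field) \<Rightarrow> 'a row_pair \<Rightarrow> 'a row_pair" where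
  "cyc l v (A, R) =
    ((\<lambda>p k. if p = 0 then A l k - (\<Sum>i<l. v i * A i k) else if p \<le> l then A (p - 1) k else A p k),
     (\<lambda>p k. if p = 0 then R l k else if p \<le> l then R (p - 1) k + v (p - 1) * R l k else R p k))"

text \<open>
  On the first $l$ rows of each half this is the left multiplication by $J^{-1} u$, where $u$ has the upper
  right block $X$; the other rows stay.
\<close>

fun opp :: "nat \<Rightarrow> (nat \<Rightarrow> nat \<Rightarrow> 'a::field) \<Rightarrow> 'a row_pair \<Rightarrow> 'a row_pair" where
  "opp l X (A, R) =
    ((\<lambda>p. if p < l then R p else A p),
     (\<lambda>p k. if p < l then - A p k - (\<Sum>j<l. X p j * R j k) else R p k))"

fun rev_rows :: "nat \<Rightarrow> 'a row_pair \<Rightarrow> 'a row_pair" where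
  "rev_rows l (A, R) = (\<lambda>p. A (if p < l then l - 1 - p else p), \<lambda>p. R (if p < l then l - 1 - p else p))"

text \<open>
  The symmetric matrix of size $l + 1$ whose last row and column come from $v$ and whose corner is $x$. The
  signs and the reversed index are those produced by \<open>dual_cyc_opp\<close>, because the rows have been
  reversed before the vector is used.
\<close>

definition border :: "nat \<Rightarrow> (nat \<Rightarrow> nat \<Rightarrow> 'a::field) \<Rightarrow> (nat \<Rightarrow> 'a) \<Rightarrow> 'a \<Rightarrow> nat \<Rightarrow> nat \<Rightarrow> 'a" where
  "border l X v x i j =
    (if i = l \<and> j = l then x else if i = l \<and> j < l then - v (l - 1 - j)
     else if j = l \<and> i < l then - v (l - 1 - i) else X i j)"

lemma sum_vec_Suc:
  fixes F :: "(nat \<Rightarrow> 'a::{zero,finite}) \<Rightarrow> complex"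
  shows "(\<Sum>c\<in>UNIV. \<Sum>v\<in>vec_set l. F (v(l := c))) = (\<Sum>v\<in>vec_set (Suc l). F v)"
  unfolding sum.cartesian_product
  by (rule sum.reindex_bij_witness[of _ "\<lambda>v. (v l, v(l := 0))" "\<lambda>(c, v). v(l := c)"])
    (auto simp: vec_set_def fun_eq_iff)

text \<open>
  Bordering is a bijection onto the symmetric matrices of the next size.
\<close>

lemma sum_sym_Suc:
  fixes F :: "(nat \<Rightarrow> nat \<Rightarrow> 'a::{field,finite}) \<Rightarrow> complex"
  shows "(\<Sum>X\<in>sym_set l. \<Sum>v\<in>vec_set l. \<Sum>x\<in>UNIV. F (border l X v x)) = (\<Sum>X\<in>sym_set (Suc l). F X)"
proof -
  have "(\<Sum>X\<in>sym_set l. \<Sum>v\<in>vec_set l. \<Sum>x\<in>UNIV. F (border l X v x)) =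
      (\<Sum>(X, v, x)\<in>sym_set l \<times> vec_set l \<times> UNIV. F (border l X v x))"
    by (simp add: sum.cartesian_product split_def)
  also have "\<dots> = (\<Sum>X\<in>sym_set (Suc l). F X)"
  proof (rule sum.reindex_bij_witness[of _
        "\<lambda>X. (\<lambda>i j. if i < l \<and> j < l then X i j else 0, \<lambda>i. if i < l then - X l (l - 1 - i) else 0, X l l)"
        "\<lambda>(X, v, x). border l X v x"], goal_cases)
    case (1 a)
    then show ?case
      by (auto simp: border_def sym_set_def vec_set_def fun_eq_iff) (metis not_less)
  next
    case (2 a)
    then show ?case by (auto simp: border_def sym_set_def vec_set_def)
  next
    case (3 X)
    then show ?case
      by (auto simp: border_def sym_set_def fun_eq_iff not_less le_Suc_eq) (metis Suc_leI le_neq_implies_less not_le)+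
  next
    case (4 X)
    then show ?case by (auto simp: border_def sym_set_def vec_set_def)
  qed auto
  finally show ?thesis .
qed

lemma cyc_rot: "cyc l v (rot l c \<tau>) = cyc (Suc l) (v(l := c)) \<tau>"
  by (cases \<tau>) (auto simp: fun_eq_iff)

lemma cyc_0: "v \<in> vec_set 0 \<Longrightarrow> cyc 0 v \<tau> = \<tau>"
  by (cases \<tau>) (auto simp: fun_eq_iff)

lemma dual_cyc_opp:
  "dual x (cyc l v (rev_rows l (opp l X \<tau>))) = rev_rows (Suc l) (opp (Suc l) (border l X v x) \<tau>)"
proof -
  obtain A R where \<tau>: "\<tau> = (A, R)" by (cases \<tau>)
  have r: "(\<Sum>j<l. v (l - Suc j) * R j k) = (\<Sum>i<l. v i * R (l - Suc i) k)" for k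
    by (rule sum.reindex_bij_witness[of _ "\<lambda>i. l - Suc i" "\<lambda>i. l - Suc i"]) auto
  have b: "(\<Sum>j<l. border l X v x i j * R j k) = (if i = l then - (\<Sum>i<l. v i * R (l - Suc i) k) else (\<Sum>j<l. X i j * R j k))" for i k
    by (simp add: border_def r[symmetric] sum_negf[symmetric])
  show ?thesis unfolding \<tau>
    by (auto simp: fun_eq_iff b) (auto simp: border_def not_less le_Suc_eq)
qed

context sign_char
begin

lemma app_chain: "app (chain l) w \<tau> =
    inverse \<epsilon> * \<beta> (- 1) ^ l * (\<Sum>v\<in>vec_set l. \<Sum>x\<in>UNIV. w (dual x (cyc l v \<tau>)))"
proof (induction l arbitrary: \<tau>)
  case 0
  have "vec_set 0 = {\<lambda>_. 0 :: 'a}" by (auto simp: vec_set_def)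
  then show ?case by (simp add: app_pull cyc_0)
next
  case (Suc l)
  have "app (chain (Suc l)) w \<tau> = \<beta> (- 1) * (\<Sum>c\<in>UNIV. app (chain l) w (rot l c \<tau>))"
    by (simp add: app_times app_pull)
  also have "\<dots> = inverse \<epsilon> * \<beta> (- 1) ^ Suc l *
      (\<Sum>c\<in>UNIV. \<Sum>v\<in>vec_set l. \<Sum>x\<in>UNIV. w (dual x (cyc (Suc l) (v(l := c)) \<tau>)))"
    by (simp add: Suc cyc_rot flip: sum_distrib_left)
  also have "(\<Sum>c\<in>UNIV. \<Sum>v\<in>vec_set l. \<Sum>x\<in>UNIV. w (dual x (cyc (Suc l) (v(l := c)) \<tau>))) =
      (\<Sum>v\<in>vec_set (Suc l). \<Sum>x\<in>UNIV. w (dual x (cyc (Suc l) v \<tau>)))"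
    by (rule sum_vec_Suc)
  finally show ?case .
qed

text \<open>
  Each further chain borders the symmetric matrix by a vector and a corner, so the sums over the parameters of all the
  chains together run exactly once over the symmetric matrices of size $l$.
\<close>

lemma app_longest: "app (longest l) w \<tau> =
    inverse \<epsilon> ^ l * \<beta> (- 1) ^ (l * (l - 1) div 2) * (\<Sum>X\<in>sym_set l. w (rev_rows l (opp l X \<tau>)))"
proof (induction l arbitrary: w)
  case 0
  have "sym_set 0 = {\<lambda>_ _. 0 :: 'a}" by (auto simp: sym_set_def fun_eq_iff)
  then show ?case by (cases \<tau>) (simp add: app_one)
next
  case (Suc l)
  have e: "Suc l * (Suc l - 1) div 2 = l + l * (l - 1) div 2" by (cases l) (simp_all add: algebra_simps)
  have "app (longest (Suc l)) w \<tau> = inverse \<epsilon> ^ l * \<beta> (- 1) ^ (l * (l - 1) div 2) *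
      (\<Sum>X\<in>sym_set l. app (chain l) w (rev_rows l (opp l X \<tau>)))"
    by (simp add: app_times Suc)
  also have "\<dots> = inverse \<epsilon> ^ Suc l * \<beta> (- 1) ^ (l + l * (l - 1) div 2) *
      (\<Sum>X\<in>sym_set l. \<Sum>v\<in>vec_set l. \<Sum>x\<in>UNIV. w (rev_rows (Suc l) (opp (Suc l) (border l X v x) \<tau>)))"
    by (simp add: app_chain dual_cyc_opp power_add flip: sum_distrib_left del: rev_rows.simps opp.simps)
  also have "(\<Sum>X\<in>sym_set l. \<Sum>v\<in>vec_set l. \<Sum>x\<in>UNIV. w (rev_rows (Suc l) (opp (Suc l) (border l X v x) \<tau>))) =
      (\<Sum>X\<in>sym_set (Suc l). w (rev_rows (Suc l) (opp (Suc l) X \<tau>)))"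
    by (rule sum_sym_Suc)
  finally show ?case unfolding e .
qed

lemma equivariant_cyc:
  assumes "equivariant n d" "l < n"
  shows "d (cyc l (\<lambda>_. 0) \<tau>) = \<beta> (- 1) ^ l * d \<tau>"
  using assms(2)
proof (induction l arbitrary: \<tau>)
  case 0
  then show ?case by (simp add: cyc_0 vec_set_def)
next
  case (Suc l)
  have "cyc (Suc l) (\<lambda>_. 0) \<tau> = cyc l (\<lambda>_. 0) (rot l 0 \<tau>)"
    using cyc_rot[of l "\<lambda>_. 0" 0 \<tau>] by (simp only: fun_upd_triv[of "\<lambda>_. 0" l])
  then show ?case using Suc equivariantD(5)[OF assms(1), of l 0 \<tau>] by simp
qed

lemma rev_rows_Suc: "rev_rows (Suc l) \<tau> = cyc l (\<lambda>_. 0) (rev_rows l \<tau>)"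
  by (cases \<tau>) (auto simp: fun_eq_iff)

lemma equivariant_rev:
  assumes "equivariant n d" "l \<le> n"
  shows "d (rev_rows l \<tau>) = \<beta> (- 1) ^ (l * (l - 1) div 2) * d \<tau>"
  using assms(2)
proof (induction l arbitrary: \<tau>)
  case 0
  then show ?case by (cases \<tau>) simp
next
  case (Suc l)
  have e: "Suc l * (Suc l - 1) div 2 = l + l * (l - 1) div 2" by (cases l) (simp_all add: algebra_simps)
  show ?case unfolding rev_rows_Suc e
    using Suc equivariant_cyc[OF assms(1), of l "rev_rows l \<tau>"] by (simp add: power_add)
qed

text \<open>
  Absorption replaces the product of the $L_i$ by the longest element, and the equivariance of $d$ undoes the
  reversal of the rows, at the cost of a sign that cancels the one in \<open>app_longest\<close>. For $l = n$ the
  sum is the intertwiner.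
\<close>

theorem app_LL:
  assumes d: "equivariant n d" and l: "l \<le> n"
  shows "app (LL 0 l) d \<tau> =
    of_nat CARD('a) ^ (l * (l - 1) div 2) * inverse \<epsilon> ^ l * (\<Sum>X\<in>sym_set l. d (opp l X \<tau>))"
proof -
  have "app (LL 0 l) d \<tau> = of_nat CARD('a) ^ (l * (l - 1) div 2) * app (longest l) d \<tau>"
    using absorb_longest[of l "\<lambda>r. app r d \<tau>" "CARD('a)" 1] app_right_absorb[OF d] l by simp
  moreover have "\<beta> (- 1) ^ m * \<beta> (- 1) ^ m = 1" for m
    using \<beta>_m1_sq by (simp flip: power_mult_distrib)
  ultimately show ?thesis
    by (simp add: app_longest equivariant_rev[OF d l] flip: sum_distrib_left mult.assoc)
qed

end

section \<open>Block matrices and the Siegel parabolic\<close>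

definition mat_of :: "nat \<Rightarrow> 'a::field row_pair \<Rightarrow> 'a mat" where
  "mat_of n \<tau> = mat (2 * n) (2 * n) (\<lambda>(i, j). if i < n then fst \<tau> i j else snd \<tau> (i - n) j)"

definition rows_of :: "nat \<Rightarrow> 'a::field mat \<Rightarrow> 'a row_pair" where
  "rows_of n g = (\<lambda>i j. g $$ (i, j), \<lambda>i j. g $$ (i + n, j))"

lemma mat_of_carrier [simp]: "mat_of n \<tau> \<in> carrier_mat (2 * n) (2 * n)"
  by (simp add: mat_of_def)

lemma mat_of_rows_of: "g \<in> carrier_mat (2 * n) (2 * n) \<Longrightarrow> mat_of n (rows_of n g) = g"
  by (auto simp: mat_of_def rows_of_def intro!: eq_matI)

lemma four_block_mult_mat_of:
  assumes "a \<in> carrier_mat n n" "b \<in> carrier_mat n n" "c \<in> carrier_mat n n" "d \<in> carrier_mat n n"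
  shows "four_block_mat a b c d * mat_of n (A, R) =
    mat_of n (\<lambda>i k. (\<Sum>j<n. a $$ (i, j) * A j k) + (\<Sum>j<n. b $$ (i, j) * R j k),
              \<lambda>i k. (\<Sum>j<n. c $$ (i, j) * A j k) + (\<Sum>j<n. d $$ (i, j) * R j k))"
proof (rule eq_matI, goal_cases)
  case (1 i k)
  then have ik: "i < 2 * n" "k < 2 * n" by (simp_all add: mat_of_def)
  have *: "(\<Sum>j = 0..<2 * n. F j) = (\<Sum>j<n. F j) + (\<Sum>j<n. F (j + n))" for F :: "nat \<Rightarrow> 'a"
  proof -
    have "(\<Sum>j = 0..<2 * n. F j) = (\<Sum>j = 0..<n. F j) + (\<Sum>j = n..<n + n. F j)"
      by (simp add: mult_2 sum.atLeastLessThan_concat)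
    also have "(\<Sum>j = n..<n + n. F j) = (\<Sum>j = 0..<n. F (j + n))"
      using sum.shift_bounds_nat_ivl[of F 0 n n] by simp
    finally show ?thesis by (simp add: atLeast0LessThan)
  qed
  have "(four_block_mat a b c d * mat_of n (A, R)) $$ (i, k) =
      (\<Sum>j = 0..<2 * n. four_block_mat a b c d $$ (i, j) * mat_of n (A, R) $$ (j, k))"
    using ik assms by (simp add: scalar_prod_def mat_of_def mult_2)
  then show ?case using ik assms
    by (auto simp: * mat_of_def index_mat_four_block intro!: arg_cong2[of _ _ _ _ "(+)"] sum.cong)
qed (use assms in \<open>auto simp: mat_of_def mult_2\<close>)

lemma sum_one_mat: "i < n \<Longrightarrow> (\<Sum>j<n. 1\<^sub>m n $$ (i, j) * F j) = (F i :: 'a::field)"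
proof -
  assume "i < n"
  moreover have "(\<Sum>j<n. 1\<^sub>m n $$ (i, j) * F j) = (\<Sum>j<n. if j = i then F j else 0)"
    using \<open>i < n\<close> by (intro sum.cong) auto
  ultimately show ?thesis by simp
qed

lemma sum_minus_mat:
  assumes "B \<in> carrier_mat n n" "i < n"
  shows "(\<Sum>j<n. (- B) $$ (i, j) * F j) = - (\<Sum>j<n. B $$ (i, j) * F j :: 'a::field)"
  using assms by (simp flip: sum_negf)

text \<open>
  Carrying the inverse transpose $m'$ along with $m$ makes the block diagonal matrices of multiplier $1$
  accessible without computing inverses.
\<close>

definition levi_pairs :: "nat \<Rightarrow> ('a::field mat \<times> 'a mat) set" where
  "levi_pairs n = {(m', m). m' \<in> carrier_mat n n \<and> m \<in> carrier_mat n n \<and> transpose_mat m' * m = 1\<^sub>m n}"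

definition levi_mat :: "nat \<Rightarrow> 'a::field mat \<Rightarrow> 'a mat \<Rightarrow> 'a mat" where
  "levi_mat n m' m = four_block_mat m' (0\<^sub>m n n) (0\<^sub>m n n) m"

definition unip_mat :: "nat \<Rightarrow> 'a::field mat \<Rightarrow> 'a mat" where
  "unip_mat n B = four_block_mat (1\<^sub>m n) B (0\<^sub>m n n) (1\<^sub>m n)"

fun levi_act :: "nat \<Rightarrow> 'a::field mat \<Rightarrow> 'a mat \<Rightarrow> 'a row_pair \<Rightarrow> 'a row_pair" where
  "levi_act n m' m (A, R) =
    (\<lambda>i k. if i < n then \<Sum>j<n. m' $$ (i, j) * A j k else A i k,
     \<lambda>i k. if i < n then \<Sum>j<n. m $$ (i, j) * R j k else R i k)"

fun unip_act :: "nat \<Rightarrow> (nat \<Rightarrow> nat \<Rightarrow> 'a::field) \<Rightarrow> 'a row_pair \<Rightarrow> 'a row_pair" where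
  "unip_act n X (A, R) = (\<lambda>i k. if i < n then A i k + (\<Sum>j<n. X i j * R j k) else A i k, R)"

lemma levi_pairs_swap: "(m', m) \<in> levi_pairs n \<Longrightarrow> (m, m') \<in> levi_pairs n"
proof -
  assume "(m', m) \<in> levi_pairs n"
  then have c: "m' \<in> carrier_mat n n" "m \<in> carrier_mat n n" "transpose_mat m' * m = 1\<^sub>m n"
    by (auto simp: levi_pairs_def)
  have "transpose_mat m * m' = transpose_mat (transpose_mat m' * m)"
    using c(1,2) by (simp add: transpose_mult[of _ n n])
  then show ?thesis using c by (simp add: levi_pairs_def)
qed

lemma levi_pairs_det: "(m', m) \<in> levi_pairs n \<Longrightarrow> det m' * det m = 1"
proof -
  assume m: "(m', m) \<in> levi_pairs n"
  then have "det (transpose_mat m') * det m = det (1\<^sub>m n :: 'a mat)"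
    by (auto simp: levi_pairs_def simp flip: det_mult[of _ n])
  then show ?thesis using m by (simp add: levi_pairs_def det_transpose[of _ n])
qed

lemma levi_pairs_mult:
  assumes "(h', h) \<in> levi_pairs n" "(m', m) \<in> levi_pairs n"
  shows "(h' * m', h * m) \<in> levi_pairs n"
proof -
  have c: "h' \<in> carrier_mat n n" "h \<in> carrier_mat n n" "transpose_mat h' * h = 1\<^sub>m n"
    "m' \<in> carrier_mat n n" "m \<in> carrier_mat n n" "transpose_mat m' * m = 1\<^sub>m n"
    using assms by (auto simp: levi_pairs_def)
  have "transpose_mat (h' * m') * (h * m) = transpose_mat m' * (transpose_mat h' * h) * m"
    using c(1,2,4,5) by (simp add: transpose_mult[of _ n n] assoc_mult_mat[of _ n n _ n _ n]
        mult_carrier_mat[of _ n n _ n])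
  then show ?thesis using c by (simp add: levi_pairs_def)
qed

lemma mult_levi_mat_of:
  assumes "(m', m) \<in> levi_pairs n"
  shows "levi_mat n m' m * mat_of n \<tau> = mat_of n (levi_act n m' m \<tau>)"
proof (cases \<tau>)
  case (Pair A R)
  have c: "m' \<in> carrier_mat n n" "m \<in> carrier_mat n n" using assms by (auto simp: levi_pairs_def)
  show ?thesis
    unfolding Pair levi_mat_def using c
    by (subst four_block_mult_mat_of) (auto simp: mat_of_def intro!: eq_matI)
qed

lemma mult_unip_mat_of:
  assumes "B \<in> carrier_mat n n"
  shows "unip_mat n B * mat_of n \<tau> = mat_of n (unip_act n (\<lambda>i j. B $$ (i, j)) \<tau>)"
proof (cases \<tau>)
  case (Pair A R)
  show ?thesis
    unfolding Pair unip_mat_def using assms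
    by (subst four_block_mult_mat_of) (auto simp: mat_of_def sum_one_mat simp del: index_one_mat intro!: eq_matI)
qed

lemma levi_act_mult:
  assumes "h' \<in> carrier_mat n n" "h \<in> carrier_mat n n" "m' \<in> carrier_mat n n" "m \<in> carrier_mat n n"
  shows "levi_act n h' h (levi_act n m' m \<tau>) = levi_act n (h' * m') (h * m) \<tau>"
proof -
  have "(\<Sum>j<n. a $$ (i, j) * (\<Sum>l<n. b $$ (j, l) * F l)) = (\<Sum>l<n. (a * b) $$ (i, l) * F l)"
    if "i < n" "a \<in> carrier_mat n n" "b \<in> carrier_mat n n" for a b :: "'a mat" and i F
  proof -
    have "(\<Sum>j<n. a $$ (i, j) * (\<Sum>l<n. b $$ (j, l) * F l)) = (\<Sum>j<n. \<Sum>l<n. a $$ (i, j) * b $$ (j, l) * F l)"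
      by (simp add: sum_distrib_left mult.assoc)
    also have "\<dots> = (\<Sum>l<n. (\<Sum>j<n. a $$ (i, j) * b $$ (j, l)) * F l)"
      by (subst sum.swap) (simp add: sum_distrib_right)
    also have "\<dots> = (\<Sum>l<n. (a * b) $$ (i, l) * F l)"
      using that by (intro sum.cong) (simp_all add: scalar_prod_def atLeast0LessThan)
    finally show ?thesis .
  qed
  then show ?thesis using assms by (cases \<tau>) (auto simp: fun_eq_iff)
qed

lemmas mult_square_blocks =
  mult_four_block_mat[where ?n1.0 = n and ?n2.0 = n and ?nr1.0 = n and ?nr2.0 = n
    and ?nc1.0 = n and ?nc2.0 = n] for n

lemma transpose_J_mat:
  "transpose_mat (J_mat n :: 'a::field mat) = four_block_mat (0\<^sub>m n n) (1\<^sub>m n) (- 1\<^sub>m n) (0\<^sub>m n n)"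
  unfolding J_mat_def
  by (subst transpose_four_block_mat[where ?nr1.0 = n and ?nr2.0 = n and ?nc1.0 = n and ?nc2.0 = n])
    (auto simp: transpose_uminus)

text \<open>
  The functions in an induced space vanish outside the group, whereas the row pairs represent all square
  matrices. Through this lemma translation formulas extend from the group to all of them.
\<close>

lemma GSp_left_cancel:
  fixes p g :: "'a::field mat"
  assumes p: "p \<in> carrier (GSp n)" and g: "g \<in> carrier_mat (2 * n) (2 * n)" and pg: "p * g \<in> carrier (GSp n)"
  shows "g \<in> carrier (GSp n)"
proof -
  interpret group "GSp n :: 'a mat monoid" by (rule group_GSp)
  let ?i = "inv\<^bsub>GSp n\<^esub> p"
  have i: "?i \<in> carrier (GSp n)" "?i * p = 1\<^sub>m (2 * n)"
    using p l_inv[OF p] by (simp_all add: GSp_mult GSp_one)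
  have "?i * (p * g) \<in> carrier (GSp n)" using m_closed[OF i(1) pg] by (simp add: GSp_mult)
  moreover have "?i * (p * g) = ?i * p * g"
    using i(1) p g unfolding GSp_iff
    by (intro assoc_mult_mat[symmetric, of _ "2 * n" "2 * n" _ "2 * n" _ "2 * n"]) auto
  ultimately show ?thesis using i(2) g by simp
qed

text \<open>
  An arbitrary multiplier $l$ is admitted because the Levi part of an element of the parabolic can have
  any; the explicit inverse serves to split off that Levi part.
\<close>

lemma block_diag_siegel:
  assumes c: "m' \<in> carrier_mat n n" "m \<in> carrier_mat n n"
    and mm: "transpose_mat m' * m = l \<cdot>\<^sub>m 1\<^sub>m n" and l: "l \<noteq> (0 :: 'a::field)"
  defines "d' \<equiv> levi_mat n (inverse l \<cdot>\<^sub>m transpose_mat m) (inverse l \<cdot>\<^sub>m transpose_mat m')"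
  shows "levi_mat n m' m \<in> siegel_parabolic n"
    and "levi_mat n m' m * d' = 1\<^sub>m (2 * n)" and "d' * levi_mat n m' m = 1\<^sub>m (2 * n)"
proof -
  let ?J = "J_mat n :: 'a mat"
  let ?a = "inverse l \<cdot>\<^sub>m transpose_mat m" and ?b = "inverse l \<cdot>\<^sub>m transpose_mat m'"
  have ab: "?a \<in> carrier_mat n n" "?b \<in> carrier_mat n n" using c by auto
  have "transpose_mat (transpose_mat m' * m) = l \<cdot>\<^sub>m (1\<^sub>m n :: 'a mat)" unfolding mm by (simp add: transpose_smult)
  then have mm2: "transpose_mat m * m' = l \<cdot>\<^sub>m 1\<^sub>m n" using c by (simp add: transpose_mult[of _ n n])
  have bm: "?b * m = 1\<^sub>m n" "?a * m' = 1\<^sub>m n"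
    using c l mm mm2 by (simp_all add: mult_smult_assoc_mat[of _ n n] smult_smult_m[symmetric] one_smult_m)
  then have mb: "m * ?b = 1\<^sub>m n" "m' * ?a = 1\<^sub>m n"
    using mat_mult_left_right_inverse c ab by blast+
  define p where "p = levi_mat n m' m"
  have cc: "p \<in> carrier_mat (2 * n) (2 * n)" "d' \<in> carrier_mat (2 * n) (2 * n)"
    unfolding p_def d'_def levi_mat_def mult_2 using c ab by (auto intro!: four_block_carrier_mat)
  have inv: "p * d' = 1\<^sub>m (2 * n)" "d' * p = 1\<^sub>m (2 * n)"
    unfolding p_def d'_def levi_mat_def using c ab by (subst mult_square_blocks[of _ n]; auto simp: bm mb mult_2)+
  then show "levi_mat n m' m * d' = 1\<^sub>m (2 * n)" "d' * levi_mat n m' m = 1\<^sub>m (2 * n)"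
    by (simp_all add: p_def)
  have "transpose_mat p = four_block_mat (transpose_mat m') (0\<^sub>m n n) (0\<^sub>m n n) (transpose_mat m)"
    unfolding p_def levi_mat_def using c by (subst transpose_four_block_mat) auto
  moreover have "four_block_mat (transpose_mat m') (0\<^sub>m n n) (0\<^sub>m n n) (transpose_mat m) * ?J =
      four_block_mat (0\<^sub>m n n) (- transpose_mat m') (transpose_mat m) (0\<^sub>m n n)"
    unfolding J_mat_def using c by (subst mult_square_blocks[of _ n]) (auto intro!: cong_four_block_mat eq_matI)
  moreover have "four_block_mat (0\<^sub>m n n) (- transpose_mat m') (transpose_mat m) (0\<^sub>m n n) * p =
      four_block_mat (0\<^sub>m n n) (- (l \<cdot>\<^sub>m 1\<^sub>m n)) (l \<cdot>\<^sub>m 1\<^sub>m n) (0\<^sub>m n n)"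
    unfolding p_def levi_mat_def using c by (subst mult_square_blocks[of _ n]) (auto simp: mm mm2 intro!: cong_four_block_mat)
  moreover have "l \<cdot>\<^sub>m ?J = four_block_mat (0\<^sub>m n n) (- (l \<cdot>\<^sub>m 1\<^sub>m n)) (l \<cdot>\<^sub>m 1\<^sub>m n) (0\<^sub>m n n)"
    unfolding J_mat_def by (subst smult_four_block_mat) (auto intro!: cong_four_block_mat eq_matI)
  ultimately have "transpose_mat p * ?J * p = l \<cdot>\<^sub>m ?J" by simp
  then have "p \<in> carrier (GSp n)"
    unfolding GSp_iff using cc inv l by (intro conjI bexI[of _ d'] exI[of _ l]) auto
  then show "levi_mat n m' m \<in> siegel_parabolic n"
    unfolding siegel_parabolic_def p_def[symmetric]
  proof (intro CollectI conjI)
    show "\<exists>A\<in>carrier_mat n n. \<exists>B\<in>carrier_mat n n. \<exists>D\<in>carrier_mat n n. p = four_block_mat A B (0\<^sub>m n n) D"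
      by (rule bexI[OF bexI[OF bexI[OF _ c(2)] zero_carrier_mat] c(1)]) (simp add: p_def levi_mat_def)
  qed
qed

lemma levi_siegel:
  assumes "(m', m) \<in> levi_pairs n"
  shows "levi_mat n m' m \<in> siegel_parabolic n"
  using assms by (intro block_diag_siegel(1)[of m' n m 1]) (auto simp: levi_pairs_def one_smult_m)

text \<open>
  The lower right block of $u^T J u$ is $B - B^T$, and the other blocks are those of $J$.
\<close>

lemma unip_mat_GSp_iff:
  assumes B: "B \<in> carrier_mat n n"
  shows "unip_mat n B \<in> carrier (GSp n) \<longleftrightarrow> transpose_mat B = (B :: 'a::field mat)"
proof -
  let ?J = "J_mat n :: 'a mat"
  define p where "p = unip_mat n B"
  have cc: "unip_mat n B \<in> carrier_mat (2 * n) (2 * n)" "unip_mat n (- B) \<in> carrier_mat (2 * n) (2 * n)"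
    unfolding unip_mat_def mult_2 using B by (auto intro!: four_block_carrier_mat)
  have z: "- B + B = 0\<^sub>m n n" "B + - B = 0\<^sub>m n n"
    using B by (auto intro!: eq_matI)
  have z': "- 0\<^sub>m n n + 1\<^sub>m n = (1\<^sub>m n :: 'a mat)" by (auto intro!: eq_matI)
  have inv: "p * unip_mat n (- B) = 1\<^sub>m (2 * n)" "unip_mat n (- B) * p = 1\<^sub>m (2 * n)"
    unfolding p_def unip_mat_def using B by (subst mult_square_blocks[of _ n]; auto simp: z z' mult_2)+
  have "transpose_mat p = four_block_mat (1\<^sub>m n) (0\<^sub>m n n) (transpose_mat B) (1\<^sub>m n)"
    unfolding p_def unip_mat_def using B by (subst transpose_four_block_mat) auto
  moreover have "four_block_mat (1\<^sub>m n) (0\<^sub>m n n) (transpose_mat B) (1\<^sub>m n) * ?J =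
      four_block_mat (0\<^sub>m n n) (- (1\<^sub>m n)) (1\<^sub>m n) (- transpose_mat B)"
    unfolding J_mat_def using B by (subst mult_square_blocks[of _ n]) (auto intro!: cong_four_block_mat eq_matI)
  moreover have "four_block_mat (0\<^sub>m n n) (- (1\<^sub>m n)) (1\<^sub>m n) (- transpose_mat B) * p =
      four_block_mat (0\<^sub>m n n) (- (1\<^sub>m n)) (1\<^sub>m n) (B + - transpose_mat B)"
    unfolding p_def unip_mat_def using B by (subst mult_square_blocks[of _ n]) (auto intro!: cong_four_block_mat eq_matI)
  ultimately have form: "transpose_mat p * ?J * p = four_block_mat (0\<^sub>m n n) (- (1\<^sub>m n)) (1\<^sub>m n) (B + - transpose_mat B)"
    by simp
  show ?thesis
  proof
    assume "transpose_mat B = B"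
    then have "transpose_mat p * ?J * p = 1 \<cdot>\<^sub>m ?J"
      unfolding form by (simp add: z J_mat_def one_smult_m)
    then show "unip_mat n B \<in> carrier (GSp n)"
      unfolding GSp_iff p_def[symmetric] using cc inv
      by (intro conjI bexI[of _ "unip_mat n (- B)"] exI[of _ 1]) (auto simp: p_def)
  next
    assume "unip_mat n B \<in> carrier (GSp n)"
    then obtain l where l: "transpose_mat p * ?J * p = l \<cdot>\<^sub>m ?J"
      unfolding GSp_iff p_def[symmetric] by blast
    have "l \<cdot>\<^sub>m ?J = four_block_mat (0\<^sub>m n n) (l \<cdot>\<^sub>m (- 1\<^sub>m n)) (l \<cdot>\<^sub>m 1\<^sub>m n) (0\<^sub>m n n)"
      unfolding J_mat_def by (subst smult_four_block_mat) auto
    then have "split_block (four_block_mat (0\<^sub>m n n) (- (1\<^sub>m n)) (1\<^sub>m n) (B + - transpose_mat B)) n n =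
        split_block (four_block_mat (0\<^sub>m n n) (l \<cdot>\<^sub>m (- 1\<^sub>m n)) (l \<cdot>\<^sub>m 1\<^sub>m n) (0\<^sub>m n n)) n n"
      using form l by simp
    then have e: "B + - transpose_mat B = 0\<^sub>m n n"
      using B by (simp add: split_block_four_block)
    show "transpose_mat B = B"
    proof (rule eq_matI)
      fix i j assume ij: "i < dim_row B" "j < dim_col B"
      then have "(B + - transpose_mat B) $$ (i, j) = 0" using B e by simp
      then show "transpose_mat B $$ (i, j) = B $$ (i, j)" using ij B by simp
    qed (use B in auto)
  qed
qed

lemma unipotent_radical_eq:
  "unipotent_radical n = unip_mat n ` {B \<in> carrier_mat n n. transpose_mat B = (B :: 'a::field mat)}"
  unfolding unipotent_radical_def using unip_mat_GSp_iff unfolding unip_mat_def by blast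

lemma inv_J_mat: "inv\<^bsub>GSp n\<^esub> (J_mat n) = transpose_mat (J_mat n :: 'a::field mat)"
proof -
  interpret group "GSp n :: 'a mat monoid" by (rule group_GSp)
  let ?J = "J_mat n :: 'a mat" and ?i = "inv\<^bsub>GSp n\<^esub> (J_mat n :: 'a mat)"
  have i: "?i \<in> carrier_mat (2 * n) (2 * n)" using inv_closed[OF J_mat_in_GSp] unfolding GSp_iff by blast
  have "?i * ?J = 1\<^sub>m (2 * n)" using l_inv[OF J_mat_in_GSp] by (simp add: GSp_mult GSp_one)
  then have "?i * (?J * transpose_mat ?J) = transpose_mat ?J"
    using i J_mat_carrier[of n, where 'a = 'a]
    by (simp flip: assoc_mult_mat[of _ "2 * n" "2 * n" _ "2 * n" _ "2 * n"])
  then show ?thesis using i by (simp add: J_mat_sq)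
qed

lemma J_unip_mat_of:
  assumes B: "B \<in> carrier_mat n n"
  shows "transpose_mat (J_mat n) * unip_mat n B * mat_of n \<tau> = mat_of n (opp n (\<lambda>i j. B $$ (i, j)) \<tau>)"
proof (cases \<tau>)
  case (Pair A R)
  have "four_block_mat (0\<^sub>m n n) (1\<^sub>m n) (- 1\<^sub>m n) (0\<^sub>m n n) * unip_mat n B =
      four_block_mat (0\<^sub>m n n) (1\<^sub>m n) (- 1\<^sub>m n) (- B)"
    unfolding unip_mat_def using B by (subst mult_square_blocks[of _ n]) (auto intro!: cong_four_block_mat)
  then have JU: "transpose_mat (J_mat n) * unip_mat n B = four_block_mat (0\<^sub>m n n) (1\<^sub>m n) (- 1\<^sub>m n) (- B)"
    by (simp add: transpose_J_mat)
  show ?thesis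
    unfolding Pair JU using B
    by (subst four_block_mult_mat_of) (auto simp: mat_of_def sum_one_mat sum_minus_mat simp del: index_one_mat index_uminus_mat intro!: eq_matI)
qed

section \<open>Elementary matrices in the Levi subgroup\<close>

lemma levi_pairs_one: "(1\<^sub>m n, 1\<^sub>m n) \<in> levi_pairs n"
  by (simp add: levi_pairs_def)

lemma transpose_addrow_mat: "transpose_mat (addrow_mat n c a b) = addrow_mat n (c :: 'a::field) b a"
  by (rule eq_matI) auto

lemma transpose_swaprows_mat: "transpose_mat (swaprows_mat n a b) = (swaprows_mat n a b :: 'a::field mat)"
  by (rule eq_matI) auto

lemma transpose_multrow_mat: "transpose_mat (multrow_mat n a s) = (multrow_mat n a s :: 'a::field mat)"
  by (rule eq_matI) auto

lemma addrow_levi: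
  assumes "a < n" "b < n" "a \<noteq> b"
  shows "(addrow_mat n (- c :: 'a::field) b a, addrow_mat n c a b) \<in> levi_pairs n"
  using addrow_mat_inv[OF assms, of "- c"] by (simp add: levi_pairs_def transpose_addrow_mat)

lemma swaprows_levi:
  assumes "a < n" "b < n"
  shows "(swaprows_mat n a b, swaprows_mat n a b :: 'a::field mat) \<in> levi_pairs n"
  using swaprows_mat_inv[OF assms] by (simp add: levi_pairs_def transpose_swaprows_mat)

lemma multrow_levi:
  assumes "a < n" "s \<noteq> 0"
  shows "(multrow_mat n a (inverse s), multrow_mat n a (s :: 'a::field)) \<in> levi_pairs n"
proof -
  have "multrow_mat n a (inverse s) * multrow_mat n a s = 1\<^sub>m n"
    unfolding multrow_mat[OF multrow_mat_carrier, symmetric]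
    using assms by (intro eq_matI) auto
  then show ?thesis by (simp add: levi_pairs_def transpose_multrow_mat)
qed

lemma sum_addrow:
  fixes F :: "nat \<Rightarrow> 'a::field"
  assumes "i < n" "b < n" "a \<noteq> b"
  shows "(\<Sum>j<n. addrow_mat n c a b $$ (i, j) * F j) = F i + (if i = a then c * F b else 0)"
proof -
  have "(\<Sum>j<n. addrow_mat n c a b $$ (i, j) * F j) =
      (\<Sum>j<n. (if j = i then F j else 0) + (if j = b then (if i = a then c * F j else 0) else 0))"
    using assms by (intro sum.cong) (auto simp: algebra_simps)
  then show ?thesis using assms by (simp add: sum.distrib)
qed

lemma sum_swaprows:
  fixes F :: "nat \<Rightarrow> 'a::field"
  assumes "i < n" "a < n" "b < n"
  shows "(\<Sum>j<n. swaprows_mat n a b $$ (i, j) * F j) = F (if i = a then b else if i = b then a else i)"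
proof -
  have "(\<Sum>j<n. swaprows_mat n a b $$ (i, j) * F j) =
      (\<Sum>j<n. if j = (if i = a then b else if i = b then a else i) then F j else 0)"
    using assms by (intro sum.cong) auto
  then show ?thesis using assms by (simp split: if_splits)
qed

lemma sum_multrow:
  fixes F :: "nat \<Rightarrow> 'a::field"
  assumes "i < n"
  shows "(\<Sum>j<n. multrow_mat n a s $$ (i, j) * F j) = (if i = a then s * F i else F i)"
proof -
  have "(\<Sum>j<n. multrow_mat n a s $$ (i, j) * F j) =
      (\<Sum>j<n. if j = i then (if i = a then s * F j else F j) else 0)"
    using assms by (intro sum.cong) auto
  then show ?thesis using assms by simp
qed

lemma shear_levi_act:
  assumes "a < n" "b < n" "a \<noteq> b"
  shows "levi_act n (addrow_mat n (- c) b a) (addrow_mat n c a b) \<tau> = shear a b c \<tau>"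
  using assms by (cases \<tau>) (auto simp: fun_eq_iff sum_addrow simp del: index_mat_addrow_mat)

lemma scale_levi_act:
  assumes "a < n"
  shows "levi_act n (multrow_mat n a (inverse s)) (multrow_mat n a s) \<tau> = scale a s \<tau>"
  using assms by (cases \<tau>) (auto simp: fun_eq_iff sum_multrow simp del: index_mat_multrow_mat)

lemma rot_levi_act:
  assumes "Suc i < n"
  obtains h' h where "(h', h) \<in> levi_pairs n" "det h = - 1" "\<And>\<tau>. rot i c \<tau> = levi_act n h' h \<tau>"
proof (rule that)
  let ?s = "swaprows_mat n i (Suc i)"
  let ?h' = "?s * addrow_mat n (- c) (Suc i) i" and ?h = "?s * addrow_mat n c i (Suc i)"
  show "(?h', ?h) \<in> levi_pairs n"
    using assms by (intro levi_pairs_mult swaprows_levi addrow_levi) auto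
  show "det ?h = - 1"
    using assms by (simp add: det_mult[of _ n] det_swaprows_mat det_addrow_mat)
  fix \<tau>
  have "rot i c \<tau> = levi_act n ?s ?s (shear i (Suc i) c \<tau>)"
    using assms by (cases \<tau>) (auto simp: fun_eq_iff sum_swaprows simp del: index_mat_swaprows_mat)
  also have "shear i (Suc i) c \<tau> = levi_act n (addrow_mat n (- c) (Suc i) i) (addrow_mat n c i (Suc i)) \<tau>"
    using assms by (intro shear_levi_act[symmetric]) auto
  finally show "rot i c \<tau> = levi_act n ?h' ?h \<tau>"
    by (simp add: levi_act_mult del: levi_act.simps)
qed

lemma finite_carrier_mat: "finite (carrier_mat n m :: 'a::finite mat set)"
proof (rule finite_subset)
  show "(carrier_mat n m :: 'a mat set) \<subseteq> (\<lambda>h. mat n m h) ` (PiE ({..<n} \<times> {..<m}) (\<lambda>_. UNIV))"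
  proof
    fix X :: "'a mat" assume X: "X \<in> carrier_mat n m"
    have "mat n m (restrict (\<lambda>ij. X $$ ij) ({..<n} \<times> {..<m})) = X" using X by (intro eq_matI) auto
    moreover have "restrict (\<lambda>ij. X $$ ij) ({..<n} \<times> {..<m}) \<in> PiE ({..<n} \<times> {..<m}) (\<lambda>_. UNIV)"
      unfolding restrict_PiE_iff by simp
    ultimately show "X \<in> (\<lambda>h. mat n m h) ` (PiE ({..<n} \<times> {..<m}) (\<lambda>_. UNIV))"
      by (metis imageI)
  qed
qed (intro finite_imageI finite_PiE; simp)

lemma finite_levi_pairs: "finite (levi_pairs n :: ('a::{field,finite} mat \<times> 'a mat) set)"
  by (rule finite_subset[of _ "carrier_mat n n \<times> carrier_mat n n"])
    (auto simp: levi_pairs_def finite_carrier_mat)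

text \<open>
  Left translation is a permutation of the Levi factor, which makes averages over it invariant.
\<close>

lemma levi_pairs_bij:
  assumes h: "(h', h) \<in> levi_pairs n"
  shows "bij_betw (\<lambda>(m', m). (h' * m', h * m)) (levi_pairs n) (levi_pairs n :: ('a::{field,finite} mat \<times> 'a mat) set)"
proof -
  let ?F = "\<lambda>(m', m). (h' * m', h * m)"
  have c: "h' \<in> carrier_mat n n" "h \<in> carrier_mat n n" "transpose_mat h' * h = 1\<^sub>m n" "transpose_mat h * h' = 1\<^sub>m n"
    using h levi_pairs_swap[OF h] by (auto simp: levi_pairs_def)
  have canc: "m1 = m2" if e: "a * m1 = a * m2" and ba: "b * a = 1\<^sub>m n" and
    "a \<in> carrier_mat n n" "b \<in> carrier_mat n n" "m1 \<in> carrier_mat n n" "m2 \<in> carrier_mat n n"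
    for a b m1 m2 :: "'a mat"
  proof -
    have "b * (a * m) = m" if "m \<in> carrier_mat n n" for m
      using \<open>a \<in> _\<close> \<open>b \<in> _\<close> that ba by (simp flip: assoc_mult_mat[of b n n a n m n])
    then show ?thesis using e that by metis
  qed
  have "inj_on ?F (levi_pairs n)"
  proof (rule inj_onI, clarify)
    fix m1' m1 m2' m2
    assume m: "(m1', m1) \<in> levi_pairs n" "(m2', m2) \<in> levi_pairs n" and e: "h' * m1' = h' * m2'" "h * m1 = h * m2"
    show "m1' = m2' \<and> m1 = m2"
      using canc[OF e(1) c(4)] canc[OF e(2) c(3)] c m by (simp add: levi_pairs_def)
  qed
  moreover have "?F ` levi_pairs n \<subseteq> levi_pairs n" using levi_pairs_mult[OF h] by auto
  ultimately show ?thesis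
    unfolding bij_betw_def using endo_inj_surj[OF finite_levi_pairs] by blast
qed

section \<open>Induced representations as functions of row pairs\<close>

lemma induced_mult:
  assumes f: "f \<in> induced n \<theta>" and p: "p \<in> siegel_parabolic n" and g: "g \<in> carrier_mat (2 * n) (2 * n)"
  shows "f (p * g) = \<theta> p * f (g :: 'a::field mat)"
proof (cases "g \<in> carrier (GSp n)")
  case True
  then show ?thesis using f p unfolding induced_def by blast
next
  case False
  have "p \<in> carrier (GSp n)" using p siegel_subset by blast
  then have "p * g \<notin> carrier (GSp n)" using GSp_left_cancel[OF _ g] False by blast
  then show ?thesis using f False unfolding induced_def by auto
qed

lemma induced_ext:
  assumes "f \<in> induced n \<theta>" "h \<in> induced n \<theta>'" "\<And>\<tau>. f (mat_of n \<tau>) = h (mat_of n \<tau>)"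
  shows "f = (h :: 'a::field mat \<Rightarrow> complex)"
proof
  fix g :: "'a mat"
  show "f g = h g"
  proof (cases "g \<in> carrier (GSp n)")
    case True
    then have "mat_of n (rows_of n g) = g" by (intro mat_of_rows_of) (simp add: GSp_iff)
    then show ?thesis using assms(3)[of "rows_of n g"] by simp
  next
    case False
    then show ?thesis using assms(1,2) unfolding induced_def by auto
  qed
qed

text \<open>
  For a pair that does not represent an element of the group both sides vanish, since the translates do not
  represent elements of the group either.
\<close>

lemma intertwiner_mat_of:
  fixes f :: "'a::{field,finite} mat \<Rightarrow> complex"
  assumes f: "f \<in> induced n \<theta>"
  shows "intertwiner n f (mat_of n \<tau>) = (\<Sum>X\<in>sym_set n. f (mat_of n (opp n X \<tau>)))"
proof -
  let ?g = "mat_of n \<tau>" and ?J = "transpose_mat (J_mat n) :: 'a mat"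
  let ?B = "\<lambda>X. mat n n (\<lambda>(i, j). X i j)"
  interpret group "GSp n :: 'a mat monoid" by (rule group_GSp)
  have op: "?J * unip_mat n (?B X) * ?g = mat_of n (opp n X \<tau>)" for X
  proof (cases \<tau>)
    case (Pair A R)
    then show ?thesis by (subst J_unip_mat_of) (auto simp: mat_of_def intro!: eq_matI)
  qed
  have sym: "transpose_mat (?B X) = ?B X" if "X \<in> sym_set n" for X
    using that by (auto simp: sym_set_def intro!: eq_matI)
  have UG: "unip_mat n (?B X) \<in> carrier (GSp n)" if "X \<in> sym_set n" for X
    using unip_mat_GSp_iff[of "?B X" n] sym[OF that] by simp
  have JG: "?J \<in> carrier (GSp n)" using inv_closed[OF J_mat_in_GSp] by (simp add: inv_J_mat)
  show ?thesis
  proof (cases "?g \<in> carrier (GSp n)")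
    case True
    have "intertwiner n f ?g = (\<Sum>u\<in>unipotent_radical n. f (?J * u * ?g))"
      using True by (simp add: intertwiner_def inv_J_mat)
    also have "\<dots> = (\<Sum>X\<in>sym_set n. f (mat_of n (opp n X \<tau>)))"
    \<comment> \<open>Elements of the unipotent radical correspond to symmetric matrices, extended by zero.\<close>
    proof (rule sum.reindex_bij_witness[of _ "\<lambda>X. unip_mat n (?B X)"
          "\<lambda>u i j. if i < n \<and> j < n then u $$ (i, j + n) else 0"], goal_cases)
      case (1 u)
      then obtain B where B: "B \<in> carrier_mat n n" "u = unip_mat n B" unfolding unipotent_radical_eq by auto
      have "?B (\<lambda>i j. if i < n \<and> j < n then u $$ (i, j + n) else 0) = B"
        using B by (auto simp: unip_mat_def intro!: eq_matI)
      then show ?case using B by simp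
    next
      case (2 u)
      then obtain B where B: "B \<in> carrier_mat n n" "u = unip_mat n B" "transpose_mat B = B"
        unfolding unipotent_radical_eq by auto
      have "B $$ (i, j) = B $$ (j, i)" if "i < n" "j < n" for i j
        using B(1,3) that index_transpose_mat(1)[of j B i] by (metis carrier_matD)
      then show ?case using B by (auto simp: unip_mat_def sym_set_def)
    next
      case (3 X)
      then show ?case by (auto simp: unip_mat_def sym_set_def fun_eq_iff) (metis not_less)+
    next
      case (4 X)
      then show ?case using sym[OF 4] unfolding unipotent_radical_eq by (intro imageI CollectI conjI) auto
    next
      case (5 u)
      then obtain B where B: "B \<in> carrier_mat n n" "u = unip_mat n B" unfolding unipotent_radical_eq by auto
      have e: "?B (\<lambda>i j. if i < n \<and> j < n then u $$ (i, j + n) else 0) = B"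
        using B by (auto simp: unip_mat_def intro!: eq_matI)
      show ?case unfolding op[symmetric] e unfolding B(2) ..
    qed
    finally show ?thesis .
  next
    case False
    have "f (mat_of n (opp n X \<tau>)) = 0" if X: "X \<in> sym_set n" for X
    proof -
      let ?p = "?J * unip_mat n (?B X)"
      have pG: "?p \<in> carrier (GSp n)" using m_closed[OF JG UG[OF X]] by (simp add: GSp_mult)
      have "?p * ?g \<notin> carrier (GSp n)" using GSp_left_cancel[OF pG mat_of_carrier] False by blast
      then show ?thesis using f unfolding op induced_def by blast
    qed
    then show ?thesis using False by (simp add: intertwiner_def)
  qed
qed

context sign_char
begin

text \<open>
  The equivariance of a function in the induced space, under the whole Levi factor of multiplier $1$ and the whole
  unipotent radical.
\<close>

definition siegel_equivariant :: "nat \<Rightarrow> ('a row_pair \<Rightarrow> complex) \<Rightarrow> bool" where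
  "siegel_equivariant n d \<longleftrightarrow>
     (\<forall>m' m \<tau>. (m', m) \<in> levi_pairs n \<longrightarrow> d (levi_act n m' m \<tau>) = \<beta> (det m) * d \<tau>) \<and>
     (\<forall>X \<tau>. (\<forall>i j. X i j = X j i) \<longrightarrow> d (unip_act n X \<tau>) = d \<tau>)"

lemma siegel_equivariantD:
  assumes "siegel_equivariant n d"
  shows "(m', m) \<in> levi_pairs n \<Longrightarrow> d (levi_act n m' m \<tau>) = \<beta> (det m) * d \<tau>"
    and "(\<And>i j. X i j = X j i) \<Longrightarrow> d (unip_act n X \<tau>) = d \<tau>"
  using assms unfolding siegel_equivariant_def by blast+

lemma unip1_unip_act:
  fixes x :: 'a
  assumes "a < n"
  shows "unip1 a x \<tau> = unip_act n (\<lambda>i j. if i = a \<and> j = a then x else 0) \<tau>"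
proof -
  have s: "(\<Sum>j<n. (if i = a \<and> j = a then x else 0) * F j) = (if i = a then x * F a else 0)"
    for i and F :: "nat \<Rightarrow> 'a"
  proof -
    have "(\<Sum>j<n. (if i = a \<and> j = a then x else 0) * F j) = (\<Sum>j<n. if j = a then (if i = a then x * F j else 0) else 0)"
      by (intro sum.cong) auto
    then show ?thesis using assms by simp
  qed
  show ?thesis
    using assms by (cases \<tau>) (simp only: unip_act.simps unip1.simps s, auto simp: fun_eq_iff)
qed

lemma unip2_unip_act:
  fixes x :: 'a
  assumes "a < n" "b < n" "a \<noteq> b"
  shows "unip2 a b x \<tau> = unip_act n (\<lambda>i j. if i = a \<and> j = b \<or> i = b \<and> j = a then x else 0) \<tau>"
proof -
  have s: "(\<Sum>j<n. (if i = a \<and> j = b \<or> i = b \<and> j = a then x else 0) * F j) =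
      (if i = a then x * F b else if i = b then x * F a else 0)"
    for i and F :: "nat \<Rightarrow> 'a"
  proof -
    have "(\<Sum>j<n. (if i = a \<and> j = b \<or> i = b \<and> j = a then x else 0) * F j) =
        (\<Sum>j<n. (if j = b then (if i = a then x * F j else 0) else 0) + (if j = a then (if i = b then x * F j else 0) else 0))"
      using assms by (intro sum.cong) auto
    then show ?thesis using assms by (simp add: sum.distrib)
  qed
  show ?thesis
    using assms by (cases \<tau>) (simp only: unip_act.simps unip2.simps s, auto simp: fun_eq_iff)
qed

lemma siegel_equivariant_imp:
  assumes d: "siegel_equivariant n d"
  shows "equivariant n d"
  unfolding equivariant_def
proof (intro conjI allI impI)
  fix a b x \<tau> assume "a < n" "b < n" "a \<noteq> b"
  then show "d (unip2 a b x \<tau>) = d \<tau>"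
    by (subst unip2_unip_act) (auto intro!: siegel_equivariantD(2)[OF d] simp del: unip_act.simps)
next
  fix a x \<tau> assume "a < n"
  then show "d (unip1 a x \<tau>) = d \<tau>"
    by (simp only: unip1_unip_act) (rule siegel_equivariantD(2)[OF d], auto)
next
  fix a b x \<tau> assume ab: "a < n" "b < n" "a \<noteq> b"
  then show "d (shear a b x \<tau>) = d \<tau>"
    using siegel_equivariantD(1)[OF d addrow_levi[OF ab, of x], of \<tau>]
    by (simp add: shear_levi_act det_addrow_mat \<beta>_1 del: levi_act.simps shear.simps)
next
  fix a s \<tau> assume "a < n" "s \<noteq> (0 :: 'a)"
  then show "d (scale a s \<tau>) = \<beta> s * d \<tau>"
    using siegel_equivariantD(1)[OF d multrow_levi[of a n s], of \<tau>]
    by (simp add: scale_levi_act det_multrow_mat del: levi_act.simps scale.simps)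
next
  fix i \<tau> and c :: 'a assume "Suc i < n"
  then obtain h' h where "(h', h) \<in> levi_pairs n" "det h = - 1" "\<And>\<tau>. rot i c \<tau> = levi_act n h' h \<tau>"
    using rot_levi_act by metis
  then show "d (rot i c \<tau>) = \<beta> (- 1) * d \<tau>"
    using siegel_equivariantD(1)[OF d, of h' h \<tau>] by simp
qed

lemma siegel_equivariant_induced:
  fixes f :: "'a mat \<Rightarrow> complex"
  assumes f: "f \<in> induced n \<theta>"
    and levi: "\<And>m' m. (m', m) \<in> levi_pairs n \<Longrightarrow> \<theta> (levi_mat n m' m) = \<beta> (det m)"
    and unip: "\<And>B. B \<in> carrier_mat n n \<Longrightarrow> transpose_mat B = B \<Longrightarrow> \<theta> (unip_mat n B) = 1"
  shows "siegel_equivariant n (\<lambda>\<tau>. f (mat_of n \<tau>))"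
  unfolding siegel_equivariant_def
proof (intro conjI allI impI)
  fix m' m :: "'a mat" and \<tau> assume m: "(m', m) \<in> levi_pairs n"
  then show "f (mat_of n (levi_act n m' m \<tau>)) = \<beta> (det m) * f (mat_of n \<tau>)"
    using induced_mult[OF f levi_siegel[OF m], of "mat_of n \<tau>"] levi[OF m] by (simp flip: mult_levi_mat_of)
next
  fix X :: "nat \<Rightarrow> nat \<Rightarrow> 'a" and \<tau> assume X: "\<forall>i j. X i j = X j i"
  let ?B = "mat n n (\<lambda>(i, j). X i j)"
  have B: "transpose_mat ?B = ?B" "?B \<in> carrier_mat n n" using X by (auto intro!: eq_matI)
  have "unip_mat n ?B * mat_of n \<tau> = mat_of n (unip_act n X \<tau>)"
  proof (cases \<tau>)
    case (Pair A R)
    then show ?thesis by (subst mult_unip_mat_of) (auto simp: mat_of_def intro!: eq_matI)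
  qed
  moreover have "unip_mat n ?B \<in> siegel_parabolic n"
    using B unipotent_subset unfolding unipotent_radical_eq by blast
  ultimately show "f (mat_of n (unip_act n X \<tau>)) = f (mat_of n \<tau>)"
    using induced_mult[OF f, of "unip_mat n ?B" "mat_of n \<tau>"] unip[OF B(2,1)] by simp
qed

text \<open>
  The projection to the $\beta \circ \det$ isotypic part for the Levi factor, up to normalisation. It fixes
  functions in an induced space up to a nonzero scalar and absorbs the generators $t_1, \dots, t_{n-1}$ on the left.
\<close>

definition gl_average :: "nat \<Rightarrow> ('a row_pair \<Rightarrow> complex) \<Rightarrow> 'a row_pair \<Rightarrow> complex" where
  "gl_average n w \<tau> = (\<Sum>(m', m)\<in>levi_pairs n. \<beta> (det m) * w (levi_act n m' m \<tau>))"

lemma gl_average_add: "gl_average n (\<lambda>\<tau>. v \<tau> + w \<tau>) \<tau> = gl_average n v \<tau> + gl_average n w \<tau>"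
  by (simp add: gl_average_def split_def sum.distrib algebra_simps)

lemma gl_average_equivariant:
  assumes "siegel_equivariant n d"
  shows "gl_average n d \<tau> = of_nat (card (levi_pairs n :: ('a mat \<times> 'a mat) set)) * d \<tau>"
proof -
  have "\<beta> (det m) * d (levi_act n m' m \<tau>) = d \<tau>" if m: "(m', m) \<in> levi_pairs n" for m' m
  proof -
    have "det m \<noteq> 0" using levi_pairs_det[OF m] by auto
    then show ?thesis using \<beta>_sq siegel_equivariantD(1)[OF assms m] by (simp flip: mult.assoc)
  qed
  then have "gl_average n d \<tau> = (\<Sum>(m', m)\<in>(levi_pairs n :: ('a mat \<times> 'a mat) set). d \<tau>)"
    unfolding gl_average_def by (intro sum.cong) auto
  then show ?thesis by (simp add: split_def)
qed

text \<open>
  Each of the $q$ terms of $t_i$ is the translation by an element $h$ of the Levi factor with $\det h = -1$,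
  and the substitution $m \mapsto h m$ in the average absorbs it together with the sign $\beta(-1)$.
\<close>

lemma gl_average_gen:
  assumes "0 < i" "i < n"
  shows "gl_average n (app (gen i) w) \<tau> = of_nat CARD('a) * gl_average n w \<tau>"
proof -
  obtain j where j: "i = Suc j" "Suc j < n" using assms by (cases i) auto
  have one: "(\<Sum>(m', m)\<in>levi_pairs n. \<beta> (det m) * (\<beta> (- 1) * w (rot j c (levi_act n m' m \<tau>)))) = gl_average n w \<tau>" for c
  proof -
    obtain h' h where h: "(h', h) \<in> levi_pairs n" "det h = - 1" "\<And>\<tau>. rot j c \<tau> = levi_act n h' h \<tau>"
      using rot_levi_act[OF j(2)] by metis
    have t: "\<beta> (det m) * (\<beta> (- 1) * w (rot j c (levi_act n m' m \<tau>))) =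
        \<beta> (det (h * m)) * w (levi_act n (h' * m') (h * m) \<tau>)" if m: "(m', m) \<in> levi_pairs n" for m' m
    proof -
      have c: "h' \<in> carrier_mat n n" "h \<in> carrier_mat n n" "m' \<in> carrier_mat n n" "m \<in> carrier_mat n n"
        using h(1) m by (auto simp: levi_pairs_def)
      have "det m \<noteq> 0" using levi_pairs_det[OF m] by auto
      then have "\<beta> (det (h * m)) = \<beta> (- 1) * \<beta> (det m)"
        using c h(2) \<beta>_mult[of "- 1" "det m"] by (simp add: det_mult[of _ n])
      then show ?thesis using c by (simp add: h(3) levi_act_mult del: levi_act.simps)
    qed
    have "(\<Sum>(m', m)\<in>levi_pairs n. \<beta> (det m) * (\<beta> (- 1) * w (rot j c (levi_act n m' m \<tau>)))) =
        (\<Sum>x\<in>levi_pairs n. (\<lambda>(m', m). \<beta> (det m) * w (levi_act n m' m \<tau>)) ((\<lambda>(m', m). (h' * m', h * m)) x))"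
      using t by (intro sum.cong) auto
    also have "\<dots> = gl_average n w \<tau>"
      unfolding gl_average_def by (rule sum.reindex_bij_betw[OF levi_pairs_bij[OF h(1)]])
    finally show ?thesis .
  qed
  have "gl_average n (app (gen i) w) \<tau> =
      (\<Sum>(m', m)\<in>levi_pairs n. \<Sum>c\<in>UNIV. \<beta> (det m) * (\<beta> (- 1) * w (rot j c (levi_act n m' m \<tau>))))"
    unfolding gl_average_def j by (simp add: app_pull sum_distrib_left)
  also have "\<dots> = (\<Sum>c\<in>UNIV. (\<Sum>(m', m)\<in>levi_pairs n. \<beta> (det m) * (\<beta> (- 1) * w (rot j c (levi_act n m' m \<tau>)))))"
    unfolding split_def by (rule sum.swap)
  also have "\<dots> = (\<Sum>c\<in>(UNIV :: 'a set). gl_average n w \<tau>)" by (simp only: one)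
  also have "\<dots> = of_nat CARD('a) * gl_average n w \<tau>" by (rule sum_constant)
  finally show ?thesis .
qed

lemma spherical_gl_average:
  assumes "siegel_equivariant n d"
  shows "spherical gen n CARD('a) (\<lambda>r. gl_average n (app r d) \<tau>)"
proof -
  note sph = spherical_of_absorbing[where e = "\<lambda>w. gl_average n w \<tau>", OF siegel_equivariant_imp[OF assms]]
  show ?thesis
  proof (rule sph)
    fix v w
    show "gl_average n (\<lambda>\<tau>. v \<tau> + w \<tau>) \<tau> = gl_average n v \<tau> + gl_average n w \<tau>"
      by (rule gl_average_add)
  next
    fix i w assume "0 < i" "i < n"
    then show "gl_average n (app (gen i) w) \<tau> = of_nat CARD('a) * gl_average n w \<tau>"
      by (rule gl_average_gen)
  qed
qed

end

section \<open>Diagonalizability from an annihilating polynomial\<close>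

text \<open>
  The polynomial $\prod_c (T - c)$ applied to a function, with the first factor acting first.
\<close>

primrec poly_at :: "(('b \<Rightarrow> complex) \<Rightarrow> 'b \<Rightarrow> complex) \<Rightarrow> complex list \<Rightarrow> ('b \<Rightarrow> complex) \<Rightarrow> 'b \<Rightarrow> complex" where
  "poly_at T [] f = f"
| "poly_at T (c # cs) f = poly_at T cs (T f - fscale c f)"

locale space_operator =
  fixes V :: "('b \<Rightarrow> complex) set" and T :: "('b \<Rightarrow> complex) \<Rightarrow> 'b \<Rightarrow> complex"
  assumes subspace: "fun_space.subspace V"
    and maps: "f \<in> V \<Longrightarrow> T f \<in> V"
    and add: "f \<in> V \<Longrightarrow> h \<in> V \<Longrightarrow> T (f + h) = T f + T h"
    and scale: "f \<in> V \<Longrightarrow> T (fscale c f) = fscale c (T f)"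
begin

lemma diff: "f \<in> V \<Longrightarrow> h \<in> V \<Longrightarrow> T (f - h) = T f - T h"
proof -
  assume "f \<in> V" "h \<in> V"
  then have "T (f - h) + T h = T (f - h + h)"
    by (intro add[symmetric]) (auto intro: fun_space.subspace_diff[OF subspace])
  then show ?thesis by (simp add: eq_diff_eq)
qed

lemma shifted: "f \<in> V \<Longrightarrow> T f - fscale c f \<in> V"
  by (intro fun_space.subspace_diff[OF subspace] maps fun_space.subspace_scale[OF subspace])

lemma poly_at_maps: "f \<in> V \<Longrightarrow> poly_at T cs f \<in> V"
  by (induction cs arbitrary: f) (simp_all add: shifted)

lemma shifted_commute:
  "f \<in> V \<Longrightarrow> T (T f - fscale c f) - fscale b (T f - fscale c f) =
     T (T f - fscale b f) - fscale c (T f - fscale b f)"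
proof -
  assume f: "f \<in> V"
  have "T (T f - fscale c f) = T (T f) - fscale c (T f)" for c
    using f by (simp add: diff maps fun_space.subspace_scale[OF subspace] scale)
  then show ?thesis by (simp add: fun_eq_iff fscale_def algebra_simps)
qed

lemma poly_at_commute: "f \<in> V \<Longrightarrow> poly_at T cs (T f - fscale c f) = T (poly_at T cs f) - fscale c (poly_at T cs f)"
proof (induction cs arbitrary: f)
  case (Cons b cs)
  have "poly_at T (b # cs) (T f - fscale c f) = poly_at T cs (T (T f - fscale b f) - fscale c (T f - fscale b f))"
    by (simp only: poly_at.simps shifted_commute[OF Cons.prems])
  also have "\<dots> = T (poly_at T (b # cs) f) - fscale c (poly_at T (b # cs) f)"
    by (simp only: poly_at.simps Cons.IH[OF shifted[OF Cons.prems]])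
  finally show ?case .
qed simp

lemma poly_at_eigen:
  assumes "f \<in> V" "T f = fscale c f"
  shows "poly_at T cs f = fscale (\<Prod>b\<leftarrow>cs. c - b) f"
  using assms
proof (induction cs arbitrary: f)
  case Nil
  then show ?case by (simp add: fscale_def)
next
  case (Cons b cs)
  have e: "T f - fscale b f = fscale (c - b) f"
    using Cons.prems by (simp add: fscale_def fun_eq_iff algebra_simps)
  have "fscale (c - b) f \<in> V" using Cons.prems by (intro fun_space.subspace_scale[OF subspace])
  moreover have "T (fscale (c - b) f) = fscale c (fscale (c - b) f)"
    using Cons.prems by (simp add: scale)
  ultimately have "poly_at T cs (fscale (c - b) f) = fscale (\<Prod>b\<leftarrow>cs. c - b) (fscale (c - b) f)"
    by (rule Cons.IH)
  then show ?case by (simp add: e mult.commute)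
qed

lemma eigenvalue_root:
  assumes "c \<in> eigenvalues_on V T" "\<And>f. f \<in> V \<Longrightarrow> poly_at T cs f = 0"
  shows "c \<in> set cs"
proof -
  obtain f where f: "f \<in> V" "f \<noteq> 0" "T f = fscale c f" using assms(1) unfolding eigenvalues_on_def by blast
  have "fscale (\<Prod>b\<leftarrow>cs. c - b) f = 0" using poly_at_eigen[OF f(1,3), of cs] assms(2)[OF f(1)] by simp
  then have "(\<Prod>b\<leftarrow>cs. c - b) = 0" using f(2) by (auto simp: fscale_def fun_eq_iff)
  then show ?thesis by (auto simp: prod_list_zero_iff)
qed

text \<open>
  If $c$ is not an eigenvalue, then $T - c$ is injective on $V$, and the factors $T - c$ may be dropped from
  an annihilating product.
\<close>

lemma poly_at_filter:
  assumes c: "c \<notin> eigenvalues_on V T" and f: "f \<in> V" "poly_at T cs f = 0"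
  shows "poly_at T (filter (\<lambda>b. b \<noteq> c) cs) f = 0"
  using f
proof (induction cs arbitrary: f)
  case (Cons b cs)
  show ?case
  proof (cases "b = c")
    case True
    have "T (poly_at T cs f) - fscale c (poly_at T cs f) = 0"
      using Cons.prems(2) unfolding True poly_at.simps poly_at_commute[OF Cons.prems(1)] .
    then have "T (poly_at T cs f) = fscale c (poly_at T cs f)" by (simp only: right_minus_eq)
    then have "poly_at T cs f = 0"
      using c poly_at_maps[OF Cons.prems(1), of cs] unfolding eigenvalues_on_def by blast
    then show ?thesis using Cons.IH[OF Cons.prems(1)] True by simp
  next
    case False
    have "poly_at T (filter (\<lambda>b. b \<noteq> c) cs) (T f - fscale b f) = 0"
      by (rule Cons.IH[OF shifted[OF Cons.prems(1)]]) (use Cons.prems(2) in \<open>simp only: poly_at.simps\<close>)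
    then show ?thesis using False by (simp only: filter.simps poly_at.simps if_True simp_thms)
  qed
qed simp

text \<open>
  If no generalised eigenvector of order two is there, an annihilating product of linear factors forces $V$ to
  be spanned by eigenvectors. The proof removes one factor $T - c$ at a time: given that $(T - c) f$ is in
  the span, it equals $(T - c) h_1 + h_2$ with $h_1$ in the span and $h_2$ an eigenvector for $c$; then
  $f - h_1$ is killed by $(T - c)^2$ and hence is itself an eigenvector.
\<close>

theorem diagonalizable:
  assumes semisimple: "\<And>f c. f \<in> V \<Longrightarrow> c \<in> set cs \<Longrightarrow>
      T (T f - fscale c f) = fscale c (T f - fscale c f) \<Longrightarrow> T f = fscale c f"
    and ann: "\<And>f. f \<in> V \<Longrightarrow> poly_at T cs f = 0"
  shows "diagonalizable_on V T"
proof -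
  define S where "S = {f \<in> V. \<exists>c. T f = fscale c f}"
  have SV: "fun_space.span S \<subseteq> V"
    by (rule fun_space.span_minimal[OF _ subspace]) (auto simp: S_def)
  have Ssc: "fscale a f \<in> S" if f: "f \<in> S" for a f
  proof -
    obtain c where c: "f \<in> V" "T f = fscale c f" using f unfolding S_def by blast
    then have "T (fscale a f) = fscale c (fscale a f)" by (simp add: scale mult.commute)
    then show ?thesis using c fun_space.subspace_scale[OF subspace] unfolding S_def by blast
  qed
  have split: "\<exists>h1\<in>fun_space.span S. \<exists>h2\<in>V. T h2 = fscale c h2 \<and> h = T h1 - fscale c h1 + h2"
    if "h \<in> fun_space.span S" for h c
    using that
  proof (induction rule: fun_space.span_induct_alt)
    case base
    have V0: "0 \<in> V" by (rule fun_space.subspace_0[OF subspace])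
    then have "T 0 = 0" using diff[of 0 0] by simp
    then show ?case
      by (intro bexI[of _ 0] conjI)
        (simp_all only: fun_space.scale_zero_right diff_self add_0 fun_space.span_zero V0)
  next
    case (step a f h)
    then obtain h1 h2 where h: "h1 \<in> fun_space.span S" "h2 \<in> V" "T h2 = fscale c h2"
      "h = T h1 - fscale c h1 + h2" by blast
    have af: "fscale a f \<in> S" using step(1) Ssc by blast
    then obtain b where b: "fscale a f \<in> V" "T (fscale a f) = fscale b (fscale a f)"
      unfolding S_def by blast
    define g where "g = fscale a f"
    have h1V: "h1 \<in> V" using h(1) SV by blast
    show ?case
    proof (cases "b = c")
      case True
      have "T (g + h2) = fscale c (g + h2)"
        using b h True by (simp add: add g_def) (simp add: fscale_def fun_eq_iff algebra_simps)
      moreover have "g + h2 \<in> V" using b(1) h(2) g_def fun_space.subspace_add[OF subspace] by blast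
      moreover have "fscale a f + h = T h1 - fscale c h1 + (g + h2)"
        using h(4) by (simp add: g_def algebra_simps)
      ultimately show ?thesis using h(1) by blast
    next
      case False
      \<comment> \<open>An eigenvector for $b \ne c$ is in the image of $T - c$, with this preimage.\<close>
      define g1 where "g1 = fscale (1 / (b - c)) g"
      have gS: "g1 \<in> S" unfolding g1_def g_def by (rule Ssc[OF af])
      have gV: "g \<in> V" "g1 \<in> V" using b(1) gS by (simp_all add: g_def S_def)
      have "T g = fscale b g" using b(2) by (simp only: g_def)
      then have "T g1 = fscale (1 / (b - c)) (fscale b g)" by (simp only: g1_def scale[OF gV(1)])
      moreover have "fscale (1 / (b - c)) (fscale b g) - fscale c g1 = g"
      proof -
        have "1 / (b - c) * (b * y) - c * (1 / (b - c) * y) = y" for y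
        proof -
          have "1 / (b - c) * (b * y) - c * (1 / (b - c) * y) = (b - c) * y / (b - c)"
            by (simp add: left_diff_distrib diff_divide_distrib)
          then show ?thesis using False by simp
        qed
        then show ?thesis by (simp add: g1_def fscale_def fun_eq_iff)
      qed
      ultimately have "T g1 - fscale c g1 = g" by simp
      moreover have "T (g1 + h1) = T g1 + T h1" using gV h1V by (intro add)
      ultimately have "fscale a f + h = T (g1 + h1) - fscale c (g1 + h1) + h2"
        using h(4) by (simp add: g_def fscale_def fun_eq_iff algebra_simps)
      moreover have "g1 + h1 \<in> fun_space.span S"
        by (rule fun_space.span_add[OF fun_space.span_base[OF gS] h(1)])
      ultimately show ?thesis using h(2,3) by blast
    qed
  qed
  have "f \<in> fun_space.span S" if "f \<in> V" "poly_at T bs f = 0" "set bs \<subseteq> set cs" for f bs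
    using that
  proof (induction bs arbitrary: f)
    case Nil
    then have "f = 0" by (simp only: poly_at.simps)
    then show ?case by (simp only: fun_space.span_zero)
  next
    case (Cons c bs)
    have "T f - fscale c f \<in> fun_space.span S"
    proof (rule Cons.IH)
      show "T f - fscale c f \<in> V" using Cons.prems(1) by (rule shifted)
      show "poly_at T bs (T f - fscale c f) = 0" using Cons.prems(2) by (simp only: poly_at.simps)
      show "set bs \<subseteq> set cs" using Cons.prems(3) by simp
    qed
    then obtain h1 h2 where h: "h1 \<in> fun_space.span S" "h2 \<in> V" "T h2 = fscale c h2"
      "T f - fscale c f = T h1 - fscale c h1 + h2" using split by blast
    have h1V: "h1 \<in> V" using h(1) SV by blast
    have fh: "f - h1 \<in> V" using Cons.prems h1V fun_space.subspace_diff[OF subspace] by blast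
    have "T (f - h1) - fscale c (f - h1) = h2"
      using h(4) Cons.prems h1V by (simp add: diff fscale_def fun_eq_iff algebra_simps)
    then have "T (f - h1) = fscale c (f - h1)"
      using semisimple[OF fh, of c] h(3) Cons.prems(3) by (simp only: list.set insert_subset)
    then have "f - h1 \<in> fun_space.span S" using fh by (intro fun_space.span_base) (auto simp: S_def)
    then have "(f - h1) + h1 \<in> fun_space.span S" using h(1) by (rule fun_space.span_add)
    then show ?case by (simp only: diff_add_cancel)
  qed
  then have "fun_space.span S = V" using ann SV by blast
  moreover obtain E where "E \<subseteq> S" "fun_space.independent E" "S \<subseteq> fun_space.span E"
    using fun_space.maximal_independent_subset[of S] by blast
  moreover from this have "fun_space.span E = fun_space.span S"
    by (metis fun_space.span_mono fun_space.span_span subset_antisym)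
  ultimately show ?thesis unfolding diagonalizable_on_def S_def by blast
qed

end

lemma rescaled_operator:
  assumes "k \<noteq> 0"
  shows "diagonalizable_on V (\<lambda>f. fscale k (T f)) \<Longrightarrow> diagonalizable_on V T"
    and "eigenvalues_on V T = {c. k * c \<in> eigenvalues_on V (\<lambda>f. fscale k (T f))}"
proof -
  have e: "fscale k (T f) = fscale c f \<longleftrightarrow> T f = fscale (c / k) f" for f c
    using assms by (auto simp: fscale_def fun_eq_iff field_simps)
  show "diagonalizable_on V (\<lambda>f. fscale k (T f)) \<Longrightarrow> diagonalizable_on V T"
    unfolding diagonalizable_on_def e by metis
  show "eigenvalues_on V T = {c. k * c \<in> eigenvalues_on V (\<lambda>f. fscale k (T f))}"
    unfolding eigenvalues_on_def e using assms by simp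
qed

section \<open>The square of the intertwiner\<close>

lemma induced_subspace: "fun_space.subspace (induced n \<theta>)"
  unfolding fun_space.subspace_def induced_def by (auto simp: fscale_def algebra_simps)

lemma intertwiner_add: "intertwiner n (f + h) = intertwiner n f + intertwiner n h"
  by (auto simp: intertwiner_def fun_eq_iff sum.distrib)

lemma intertwiner_scale: "intertwiner n (fscale c f) = fscale c (intertwiner n f)"
  by (auto simp: intertwiner_def fscale_def fun_eq_iff sum_distrib_left)

lemma J_twist_levi:
  assumes "(m', m) \<in> levi_pairs n"
  shows "J_twist n \<chi> (levi_mat n m' m) = \<chi> (levi_mat n m m')"
  using assms by (simp add: J_twist_def levi_mat_def levi_pairs_def split_block_four_block)

lemma J_twist_unip:
  assumes "B \<in> carrier_mat n n"
  shows "J_twist n \<chi> (unip_mat n B) = \<chi> (levi_mat n (1\<^sub>m n) (1\<^sub>m n))"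
  using assms by (simp add: J_twist_def unip_mat_def levi_mat_def split_block_four_block)

text \<open>
  Only the values of the character on elements of multiplier $1$ enter, and there it is $\beta$ of the
  determinant of the lower right block, as the factor from $\alpha$ is $\alpha(1) = 1$.
\<close>

locale siegel_character = sign_char \<beta> \<epsilon> for \<beta> :: "'a::{field,finite} \<Rightarrow> complex" and \<epsilon> +
  fixes n :: nat and \<chi> :: "'a mat \<Rightarrow> complex"
  assumes \<chi>_mult: "p \<in> siegel_parabolic n \<Longrightarrow> p' \<in> siegel_parabolic n \<Longrightarrow> \<chi> (p * p') = \<chi> p * \<chi> p'"
    and \<chi>_block: "(D', D) \<in> levi_pairs n \<Longrightarrow> B \<in> carrier_mat n n \<Longrightarrow>
      four_block_mat D' B (0\<^sub>m n n) D \<in> carrier (GSp n) \<Longrightarrow>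
      \<chi> (four_block_mat D' B (0\<^sub>m n n) D) = \<beta> (det D)"
begin

abbreviation "V \<equiv> induced n \<chi>"
abbreviation "V' \<equiv> induced n (J_twist n \<chi>)"
abbreviation "I \<equiv> intertwiner n :: ('a mat \<Rightarrow> complex) \<Rightarrow> 'a mat \<Rightarrow> complex"

lemma \<chi>_levi: "(m', m) \<in> levi_pairs n \<Longrightarrow> \<chi> (levi_mat n m' m) = \<beta> (det m)"
  using \<chi>_block[of m' m "0\<^sub>m n n"] levi_siegel[of m' m n] siegel_subset unfolding levi_mat_def by auto

lemma \<chi>_unip: "B \<in> carrier_mat n n \<Longrightarrow> transpose_mat B = B \<Longrightarrow> \<chi> (unip_mat n B) = 1"
  using \<chi>_block[OF levi_pairs_one, of B] unip_mat_GSp_iff[of B n] \<beta>_1 unfolding unip_mat_def by simp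

text \<open>
  The twist exchanges $m$ with its inverse transpose, and $\beta$ takes the same value at $\det m$ and its
  inverse. So the two induced spaces have the same equivariance under elements of multiplier $1$, and one set
  of operators acts on both.
\<close>

lemma J_twist_levi_value: "(m', m) \<in> levi_pairs n \<Longrightarrow> J_twist n \<chi> (levi_mat n m' m) = \<beta> (det m)"
proof -
  assume m: "(m', m) \<in> levi_pairs n"
  have "det m \<noteq> 0" using levi_pairs_det[OF m] by auto
  moreover have "det m' = inverse (det m)"
    using levi_pairs_det[OF m] by (metis inverse_unique mult.commute)
  ultimately have "det m' = inverse (det m)" "det m \<noteq> 0" by simp_all
  then show ?thesis using \<chi>_levi[OF levi_pairs_swap[OF m]] by (simp add: J_twist_levi[OF m] \<beta>_inverse)
qed

lemma J_twist_unip_value: "B \<in> carrier_mat n n \<Longrightarrow> J_twist n \<chi> (unip_mat n B) = 1"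
  by (simp add: J_twist_unip \<chi>_levi levi_pairs_one \<beta>_1)

lemma V_equivariant: "f \<in> V \<Longrightarrow> siegel_equivariant n (\<lambda>\<tau>. f (mat_of n \<tau>))"
  by (erule siegel_equivariant_induced) (simp_all add: \<chi>_levi \<chi>_unip)

lemma V'_equivariant: "f \<in> V' \<Longrightarrow> siegel_equivariant n (\<lambda>\<tau>. f (mat_of n \<tau>))"
  by (erule siegel_equivariant_induced) (simp_all add: J_twist_levi_value J_twist_unip_value)

lemma I_V: "f \<in> V \<Longrightarrow> I f \<in> V'"
  by (rule intertwiner_induced)

text \<open>
  The double twist only depends on the block diagonal part of $p$. Splitting $p = d u$ with $d$ block diagonal
  and $u$ unipotent shows that the same is true of $\chi$.
\<close>

lemma J_twist_J_twist:
  assumes p: "p \<in> siegel_parabolic n"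
  shows "J_twist n (J_twist n \<chi>) p = \<chi> p"
proof -
  interpret group "GSp n :: 'a mat monoid" by (rule group_GSp)
  obtain A B D where c: "A \<in> carrier_mat n n" "B \<in> carrier_mat n n" "D \<in> carrier_mat n n"
    and pe: "p = four_block_mat A B (0\<^sub>m n n) D"
    using p unfolding siegel_parabolic_def by blast
  obtain l where l: "l \<noteq> 0" "transpose_mat A * D = l \<cdot>\<^sub>m 1\<^sub>m n"
    using siegel_blocks[OF c] p siegel_subset unfolding pe by blast
  define d where "d = levi_mat n A D"
  define X where "X = inverse l \<cdot>\<^sub>m transpose_mat D * B"
  define d' where "d' = levi_mat n (inverse l \<cdot>\<^sub>m transpose_mat D) (inverse l \<cdot>\<^sub>m transpose_mat A)"
  note diag = block_diag_siegel[OF c(1,3) l(2,1), folded d_def d'_def]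
  have dG: "d \<in> carrier (GSp n)" and pG: "p \<in> carrier (GSp n)" using diag(1) p siegel_subset by blast+
  have dc: "d \<in> carrier_mat (2 * n) (2 * n)" using dG unfolding GSp_iff by blast
  have d'c: "d' \<in> carrier_mat (2 * n) (2 * n)"
    unfolding d'_def levi_mat_def mult_2 using c by (auto intro!: four_block_carrier_mat)
  have d'i: "d' = inv\<^bsub>GSp n\<^esub> d"
  proof -
    have i: "inv\<^bsub>GSp n\<^esub> d \<in> carrier_mat (2 * n) (2 * n)" "d * inv\<^bsub>GSp n\<^esub> d = 1\<^sub>m (2 * n)"
      using inv_closed[OF dG] r_inv[OF dG] unfolding GSp_iff by (auto simp: GSp_mult GSp_one)
    have "d' * (d * inv\<^bsub>GSp n\<^esub> d) = d' * d * inv\<^bsub>GSp n\<^esub> d"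
      by (rule assoc_mult_mat[symmetric, OF d'c dc i(1)])
    then show ?thesis using i d'c diag(3) by simp
  qed
  have Xc: "X \<in> carrier_mat n n" using c by (auto simp: X_def intro!: mult_carrier_mat[of _ n n])
  have DA: "inverse l \<cdot>\<^sub>m transpose_mat D * A = 1\<^sub>m n" "inverse l \<cdot>\<^sub>m transpose_mat A * D = 1\<^sub>m n"
  proof -
    have "transpose_mat (transpose_mat A * D) = l \<cdot>\<^sub>m (1\<^sub>m n :: 'a mat)" unfolding l(2) by (simp add: transpose_smult)
    then have "transpose_mat D * A = l \<cdot>\<^sub>m 1\<^sub>m n" using c by (simp add: transpose_mult[of _ n n])
    then show "inverse l \<cdot>\<^sub>m transpose_mat D * A = 1\<^sub>m n" "inverse l \<cdot>\<^sub>m transpose_mat A * D = 1\<^sub>m n"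
      using c l by (simp_all add: mult_smult_assoc_mat[of _ n n] smult_smult_m[symmetric] one_smult_m)
  qed
  have u: "d' * p = unip_mat n X"
    unfolding d'_def pe levi_mat_def unip_mat_def X_def using c DA
    by (subst mult_square_blocks[of _ n]) (auto simp: DA intro!: cong_four_block_mat)
  have "d' * p \<in> carrier (GSp n)"
    using m_closed[OF inv_closed[OF dG] pG] unfolding d'i by (simp add: GSp_mult)
  then have Xs: "transpose_mat X = X" using unip_mat_GSp_iff[OF Xc] u by simp
  have "d * unip_mat n X = d * d' * p"
    unfolding u[symmetric] using dc d'c pG unfolding GSp_iff by (auto intro!: assoc_mult_mat[symmetric])
  then have "p = d * unip_mat n X" using diag(2) pG unfolding GSp_iff by auto
  moreover have "unip_mat n X \<in> siegel_parabolic n"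
    using Xc Xs unipotent_subset unfolding unipotent_radical_eq by blast
  ultimately have "\<chi> p = \<chi> d" using \<chi>_mult[OF diag(1)] \<chi>_unip[OF Xc Xs] by simp
  then show ?thesis
    using c by (simp add: J_twist_def pe d_def levi_mat_def split_block_four_block)
qed

lemma I_V': "f \<in> V' \<Longrightarrow> I f \<in> V"
proof -
  assume "f \<in> V'"
  then have "I f \<in> induced n (J_twist n (J_twist n \<chi>))" by (rule intertwiner_induced)
  moreover have "J_twist n (J_twist n \<chi>) p = \<chi> p" if p: "p \<in> siegel_parabolic n" for p
    using p by (rule J_twist_J_twist)
  ultimately show ?thesis unfolding induced_def by auto
qed

text \<open>
  The scalar by which the central element differs from the intertwiner, read off from \<open>app_LL\<close>.
\<close>

definition \<kappa> :: complex where
  "\<kappa> = of_nat CARD('a) ^ (n * (n - 1) div 2) * inverse \<epsilon> ^ n"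

text \<open>
  This is the action of the square of the central element; with the factor $\kappa^2$ its eigenvalues are
  squares of the integers \<open>zmat q n k k\<close>.
\<close>

definition I2 :: "('a mat \<Rightarrow> complex) \<Rightarrow> 'a mat \<Rightarrow> complex" where
  "I2 f = fscale (\<kappa> * \<kappa>) (I (I f))"

lemma \<kappa>_nz: "\<kappa> \<noteq> 0"
  using \<epsilon>_nz by (simp add: \<kappa>_def)

lemma I2_maps: "f \<in> V \<Longrightarrow> I2 f \<in> V"
  unfolding I2_def by (intro fun_space.subspace_scale[OF induced_subspace] I_V' I_V)

sublocale space_operator V I2
  by unfold_locales
    (rule induced_subspace, erule I2_maps,
      simp_all add: I2_def intertwiner_add intertwiner_scale fun_space.scale_right_distrib mult.commute)

lemma siegel_equivariant_scale:
  "siegel_equivariant n d \<Longrightarrow> siegel_equivariant n (\<lambda>\<tau>. c * d \<tau>)"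
  unfolding siegel_equivariant_def by simp

text \<open>
  The additional scalar $c$ permits a second application, to the multiple $\kappa I f$ in the other induced space.
\<close>

lemma app_center_intertwiner:
  assumes f: "f \<in> V \<or> f \<in> V'"
  shows "app (LL 0 n) (\<lambda>\<tau>. c * f (mat_of n \<tau>)) = (\<lambda>\<tau>. c * \<kappa> * I f (mat_of n \<tau>))"
proof
  fix \<tau>
  have "siegel_equivariant n (\<lambda>\<tau>. f (mat_of n \<tau>))" using f V_equivariant V'_equivariant by blast
  then have "equivariant n (\<lambda>\<tau>. c * f (mat_of n \<tau>))"
    by (intro siegel_equivariant_imp siegel_equivariant_scale)
  then have "app (LL 0 n) (\<lambda>\<tau>. c * f (mat_of n \<tau>)) \<tau> =
      \<kappa> * (\<Sum>X\<in>sym_set n. c * f (mat_of n (opp n X \<tau>)))"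
    unfolding \<kappa>_def by (rule app_LL) simp
  also have "(\<Sum>X\<in>sym_set n. c * f (mat_of n (opp n X \<tau>))) = c * I f (mat_of n \<tau>)"
    using f intertwiner_mat_of by (metis sum_distrib_left)
  also have "\<kappa> * (c * I f (mat_of n \<tau>)) = c * \<kappa> * I f (mat_of n \<tau>)" by simp
  finally show "app (LL 0 n) (\<lambda>\<tau>. c * f (mat_of n \<tau>)) \<tau> = c * \<kappa> * I f (mat_of n \<tau>)" .
qed

lemma app_center_factor:
  assumes f: "f \<in> V"
  shows "app (center_factor n \<mu>) (\<lambda>\<tau>. f (mat_of n \<tau>)) = (\<lambda>\<tau>. (I2 f - fscale (of_int \<mu>) f) (mat_of n \<tau>))"
proof
  fix \<tau> :: "'a row_pair"
  have "app (LL 0 n) (app (LL 0 n) (\<lambda>\<tau>. f (mat_of n \<tau>))) = (\<lambda>\<tau>. \<kappa> * \<kappa> * I (I f) (mat_of n \<tau>))"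
    using app_center_intertwiner[of f 1] app_center_intertwiner[of "I f" \<kappa>] f I_V[OF f] by simp
  moreover have "app (of_int \<mu>) w \<tau> = of_int \<mu> * w \<tau>" for w
  proof (cases \<mu>)
    case (nonneg k)
    then show ?thesis by (simp add: app_of_nat)
  next
    case (neg k)
    have "of_int \<mu> = (0 - of_nat (Suc k) :: 'a row_pair endo)" unfolding neg by simp
    then have "app (of_int \<mu>) w \<tau> = app 0 w \<tau> - of_nat (Suc k) * w \<tau>"
      by (simp only: app_minus app_of_nat)
    then show ?thesis unfolding neg by (simp add: zero_endo.rep_eq algebra_simps)
  qed
  ultimately show "app (center_factor n \<mu>) (\<lambda>\<tau>. f (mat_of n \<tau>)) \<tau> = (I2 f - fscale (of_int \<mu>) f) (mat_of n \<tau>)"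
    by (simp add: center_factor_def app_minus app_times I2_def fscale_def)
qed

lemma app_center_prod:
  assumes "f \<in> V"
  shows "app (center_prod n \<mu>s) (\<lambda>\<tau>. f (mat_of n \<tau>)) = (\<lambda>\<tau>. poly_at I2 (map of_int \<mu>s) f (mat_of n \<tau>))"
  using assms
proof (induction \<mu>s arbitrary: f)
  case Nil
  then show ?case by (simp add: app_one)
next
  case (Cons \<mu> \<mu>s)
  have "app (center_prod n (\<mu> # \<mu>s)) (\<lambda>\<tau>. f (mat_of n \<tau>)) =
      app (center_prod n \<mu>s) (app (center_factor n \<mu>) (\<lambda>\<tau>. f (mat_of n \<tau>)))"
    by (simp only: center_prod_simps center_factor_prod app_times)
  then show ?case
    by (simp only: app_center_factor[OF Cons.prems] Cons.IH[OF shifted[OF Cons.prems]] list.map poly_at.simps)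
qed

definition \<mu>s :: "int list" where
  "\<mu>s = map (\<lambda>k. (zmat CARD('a) n k k)\<^sup>2) [0..<Suc n]"

lemma card_levi_pos: "card (levi_pairs n :: ('a mat \<times> 'a mat) set) \<noteq> 0"
  using levi_pairs_one[of n] finite_levi_pairs[of n, where 'a = 'a] by auto

text \<open>
  The abstract annihilation concerns averages over the Levi factor. On the induced space the average
  is multiplication by the order of that factor, so the function itself vanishes.
\<close>

theorem poly_at_annihilates:
  assumes f: "f \<in> V"
  shows "poly_at I2 (map of_int \<mu>s) f = 0"
proof -
  let ?h = "poly_at I2 (map of_int \<mu>s) f"
  have h: "?h \<in> V" using f by (rule poly_at_maps)
  have "?h (mat_of n \<tau>) = (0 :: 'a mat \<Rightarrow> complex) (mat_of n \<tau>)" for \<tau>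
  proof -
    have "gl_average n (app (center_prod n \<mu>s) (\<lambda>\<tau>. f (mat_of n \<tau>))) \<tau> = 0"
      using center_prod_annihilates[OF spherical_gl_average[OF V_equivariant[OF f]], of \<tau>]
      unfolding \<mu>s_def .
    then have "of_nat (card (levi_pairs n :: ('a mat \<times> 'a mat) set)) * ?h (mat_of n \<tau>) = 0"
      unfolding app_center_prod[OF f] gl_average_equivariant[OF V_equivariant[OF h]] .
    then show ?thesis using card_levi_pos by simp
  qed
  then show ?thesis by (intro induced_ext[OF h fun_space.subspace_0[OF induced_subspace]])
qed

section \<open>The Hermitian form\<close>

definition ip :: "('a mat \<Rightarrow> complex) \<Rightarrow> ('a mat \<Rightarrow> complex) \<Rightarrow> complex" where
  "ip f h = (\<Sum>g\<in>carrier (GSp n). f g * cnj (h g))"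

lemma finite_GSp: "finite (carrier (GSp n) :: 'a mat set)"
  by (rule finite_subset[OF _ finite_carrier_mat[of "2 * n" "2 * n"]]) (auto simp: GSp_iff)

lemma ip_cnj: "ip f h = cnj (ip h f)"
  by (simp add: ip_def mult.commute)

lemma ip_diff: "ip (f - f') h = ip f h - ip f' h"
  by (simp add: ip_def sum_subtractf algebra_simps)

lemma ip_scale: "ip (fscale c f) h = c * ip f h"
  by (simp add: ip_def fscale_def sum_distrib_left mult.assoc)

lemma ip_definite:
  assumes "f \<in> induced n \<theta>" "ip f f = 0"
  shows "f = 0"
proof
  fix g
  have "ip f f = of_real (\<Sum>g\<in>carrier (GSp n). (cmod (f g))\<^sup>2)"
    unfolding ip_def of_real_sum by (intro sum.cong refl) (rule complex_norm_square[symmetric])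
  then have "(\<Sum>g\<in>carrier (GSp n). (cmod (f g))\<^sup>2) = 0" using assms(2) by (metis of_real_eq_0_iff)
  then have "\<forall>g\<in>carrier (GSp n). (cmod (f g))\<^sup>2 = 0"
    by (subst (asm) sum_nonneg_eq_0_iff[OF finite_GSp]) auto
  then show "f g = 0 g" using assms(1) unfolding induced_def by (cases "g \<in> carrier (GSp n)") auto
qed

lemma sum_left_mult:
  assumes "a \<in> carrier (GSp n)"
  shows "(\<Sum>g\<in>carrier (GSp n). F (a * g :: 'a mat)) = (\<Sum>g\<in>carrier (GSp n). F g :: complex)"
proof -
  interpret group "GSp n :: 'a mat monoid" by (rule group_GSp)
  have "bij_betw (\<lambda>g. a \<otimes>\<^bsub>GSp n\<^esub> g) (carrier (GSp n)) (carrier (GSp n))"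
    unfolding bij_betw_def
  proof
    show i: "inj_on (\<lambda>g. a \<otimes>\<^bsub>GSp n\<^esub> g) (carrier (GSp n))" using assms by (intro inj_onI) simp
    show "(\<lambda>g. a \<otimes>\<^bsub>GSp n\<^esub> g) ` carrier (GSp n) = carrier (GSp n)"
      using assms by (intro endo_inj_surj[OF finite_GSp _ i]) auto
  qed
  then show ?thesis using sum.reindex_bij_betw[of "\<lambda>g. a \<otimes>\<^bsub>GSp n\<^esub> g" _ _ F] by (simp add: GSp_mult)
qed

text \<open>
  The substitution of $u g$ for $g$ moves each $u$ into the second argument, where it acts trivially, so all
  terms of the intertwiner contribute equally.
\<close>

lemma ip_intertwiner:
  assumes f: "f \<in> induced n \<theta>" and h: "h \<in> induced n \<theta>'"
    and unip: "\<And>B. B \<in> carrier_mat n n \<Longrightarrow> transpose_mat B = B \<Longrightarrow> \<theta>' (unip_mat n B) = 1"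
  shows "ip (I f) h = of_nat (card (unipotent_radical n :: 'a mat set)) *
    (\<Sum>g\<in>carrier (GSp n). f (transpose_mat (J_mat n) * g) * cnj (h g))"
proof -
  let ?J = "transpose_mat (J_mat n) :: 'a mat"
  have Jc: "?J \<in> carrier_mat (2 * n) (2 * n)" using J_mat_carrier[of n, where 'a = 'a] by simp
  have "ip (I f) h = (\<Sum>g\<in>carrier (GSp n). \<Sum>u\<in>unipotent_radical n. f (?J * u * g) * cnj (h g))"
    unfolding ip_def by (intro sum.cong) (simp_all add: intertwiner_def inv_J_mat sum_distrib_right)
  also have "\<dots> = (\<Sum>u\<in>unipotent_radical n. \<Sum>g\<in>carrier (GSp n). f (?J * u * g) * cnj (h g))"
    by (rule sum.swap)
  also have "\<dots> = (\<Sum>u\<in>(unipotent_radical n :: 'a mat set). \<Sum>g\<in>carrier (GSp n). f (?J * g) * cnj (h g))"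
  proof (rule sum.cong[OF refl])
    fix u :: "'a mat" assume u: "u \<in> unipotent_radical n"
    then have uP: "u \<in> siegel_parabolic n" and uG: "u \<in> carrier (GSp n)"
      using unipotent_subset siegel_subset by blast+
    have u1: "\<theta>' u = 1" using u unip unfolding unipotent_radical_eq by auto
    have "f (?J * u * g) * cnj (h g) = f (?J * (u * g)) * cnj (h (u * g))" if g: "g \<in> carrier (GSp n)" for g
    proof -
      have "h (u * g) = h g" using h uP g u1 unfolding induced_def by auto
      moreover have "?J * u * g = ?J * (u * g)"
        using Jc uG g unfolding GSp_iff by (intro assoc_mult_mat) auto
      ultimately show ?thesis by simp
    qed
    then have "(\<Sum>g\<in>carrier (GSp n). f (?J * u * g) * cnj (h g)) =
        (\<Sum>g\<in>carrier (GSp n). (\<lambda>g. f (?J * g) * cnj (h g)) (u * g))" by simp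
    also have "\<dots> = (\<Sum>g\<in>carrier (GSp n). f (?J * g) * cnj (h g))" by (rule sum_left_mult[OF uG])
    finally show "(\<Sum>g\<in>carrier (GSp n). f (?J * u * g) * cnj (h g)) =
        (\<Sum>g\<in>carrier (GSp n). f (?J * g) * cnj (h g))" .
  qed
  finally show ?thesis by simp
qed

text \<open>
  As $J^{-1} = J^T = -J$, the two differ by the central element $-1$, on which the character is
  $\beta(\det(-1_n))$.
\<close>

lemma J_mat_neg: "J_mat n = levi_mat n (- 1\<^sub>m n) (- 1\<^sub>m n) * transpose_mat (J_mat n :: 'a mat)"
proof -
  have "levi_mat n (- 1\<^sub>m n) (- 1\<^sub>m n) * four_block_mat (0\<^sub>m n n) (1\<^sub>m n) (- 1\<^sub>m n) (0\<^sub>m n n) =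
      (J_mat n :: 'a mat)"
    unfolding levi_mat_def J_mat_def
    by (subst mult_square_blocks[of _ n]) (auto intro!: cong_four_block_mat eq_matI)
  then show ?thesis by (simp add: transpose_J_mat)
qed

lemma neg_one_levi: "(- 1\<^sub>m n, - 1\<^sub>m n :: 'a mat) \<in> levi_pairs n"
  by (auto simp: levi_pairs_def transpose_uminus intro!: eq_matI)

text \<open>
  Substituting $J g$ for $g$ moves $J^{-1}$ to the second argument as $J$, which is $J^{-1}$ again up to
  $-1$. Hence the adjoint of one intertwiner is the other one up to a sign, and the sign drops out in $I \circ I$.
\<close>

lemma ip_intertwiner_adjoint:
  assumes f: "f \<in> V" and h: "h \<in> V'"
  shows "ip (I f) h = \<beta> (det (- 1\<^sub>m n)) * ip f (I h)"
proof -
  let ?J = "J_mat n :: 'a mat" and ?m = "levi_mat n (- 1\<^sub>m n) (- 1\<^sub>m n) :: 'a mat"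
  have d: "det (- 1\<^sub>m n :: 'a mat) \<noteq> 0" using levi_pairs_det[OF neg_one_levi] by auto
  then have "\<beta> (det (- 1\<^sub>m n)) = 1 \<or> \<beta> (det (- 1\<^sub>m n)) = - 1"
    using \<beta>_sq by (metis power2_eq_1_iff power2_eq_square)
  then have cb: "cnj (\<beta> (det (- 1\<^sub>m n))) = \<beta> (det (- 1\<^sub>m n))" by auto
  have JG: "?J \<in> carrier (GSp n)" by (rule J_mat_in_GSp)
  have JTG: "transpose_mat ?J \<in> carrier (GSp n)"
    using group.inv_closed[OF group_GSp J_mat_in_GSp, of n, where ?'a1 = 'a] by (simp add: inv_J_mat)
  have JTc: "transpose_mat ?J \<in> carrier_mat (2 * n) (2 * n)" "?J \<in> carrier_mat (2 * n) (2 * n)"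
    using J_mat_carrier[of n, where 'a = 'a] by simp_all
  have mP: "?m \<in> siegel_parabolic n" by (rule levi_siegel[OF neg_one_levi])
  have hJ: "h (?J * g) = \<beta> (det (- 1\<^sub>m n)) * h (transpose_mat ?J * g)" if g: "g \<in> carrier (GSp n)" for g
  proof -
    have gc: "g \<in> carrier_mat (2 * n) (2 * n)" using g unfolding GSp_iff by blast
    have "?m \<in> carrier (GSp n)" using mP siegel_subset by blast
    then have "?m \<in> carrier_mat (2 * n) (2 * n)" unfolding GSp_iff by blast
    then have "?J * g = ?m * (transpose_mat ?J * g)"
      using JTc gc by (subst J_mat_neg) (rule assoc_mult_mat)
    moreover have "transpose_mat ?J * g \<in> carrier_mat (2 * n) (2 * n)" using JTc gc by auto
    ultimately show ?thesis
      using induced_mult[OF h mP] J_twist_levi_value[OF neg_one_levi] by simp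
  qed
  have "(\<Sum>g\<in>carrier (GSp n). f (transpose_mat ?J * g) * cnj (h g)) =
      (\<Sum>g\<in>carrier (GSp n). (\<lambda>g. f (transpose_mat ?J * g) * cnj (h g)) (?J * g))"
    by (rule sum_left_mult[OF JG, symmetric])
  also have "\<dots> = (\<Sum>g\<in>carrier (GSp n). f g * cnj (h (?J * g)))"
  proof (intro sum.cong refl)
    fix g :: "'a mat" assume g: "g \<in> carrier (GSp n)"
    then have "transpose_mat ?J * (?J * g) = transpose_mat ?J * ?J * g"
      using JTc unfolding GSp_iff by (intro assoc_mult_mat[symmetric]) auto
    then show "f (transpose_mat ?J * (?J * g)) * cnj (h (?J * g)) = f g * cnj (h (?J * g))"
      using g by (auto simp: J_mat_sq GSp_iff)
  qed
  also have "\<dots> = \<beta> (det (- 1\<^sub>m n)) * cnj (\<Sum>g\<in>carrier (GSp n). h (transpose_mat ?J * g) * cnj (f g))"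
    by (simp add: hJ cb sum_distrib_left mult_ac)
  finally have e: "(\<Sum>g\<in>carrier (GSp n). f (transpose_mat ?J * g) * cnj (h g)) = \<dots>" .
  have "ip f (I h) = cnj (ip (I h) f)" by (rule ip_cnj)
  then show ?thesis
    using ip_intertwiner[OF f h J_twist_unip_value] ip_intertwiner[OF h f \<chi>_unip] e by simp
qed

text \<open>
  The signs of two adjunctions cancel. The factor $\kappa^2$ is real although $\kappa$ may not be, because
  $\epsilon^2 = \beta(-1) q$ is real.
\<close>

lemma ip_I2:
  assumes f: "f \<in> V" and h: "h \<in> V"
  shows "ip (I2 f) h = ip f (I2 h)"
proof -
  let ?b = "\<beta> (det (- 1\<^sub>m n)) :: complex"
  have d: "det (- 1\<^sub>m n :: 'a mat) \<noteq> 0" using levi_pairs_det[OF neg_one_levi] by auto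
  then have b: "?b * ?b = 1" by (rule \<beta>_sq)
  then have "?b = 1 \<or> ?b = - 1" by (metis power2_eq_1_iff power2_eq_square)
  then have cb: "cnj ?b = ?b" by auto
  have "ip (I (I f)) h = cnj (ip h (I (I f)))" by (rule ip_cnj)
  also have "ip h (I (I f)) = ?b * ip (I h) (I f)"
    using ip_intertwiner_adjoint[OF h I_V[OF f]] b by (simp flip: mult.assoc)
  also have "cnj \<dots> = ?b * ip (I f) (I h)" by (simp add: cb ip_cnj[of "I f" "I h"])
  also have "\<dots> = ip f (I (I h))"
    using ip_intertwiner_adjoint[OF f I_V[OF h]] b by (simp flip: mult.assoc)
  finally have e: "ip (I (I f)) h = ip f (I (I h))" .
  have "\<beta> (- 1) = 1 \<or> \<beta> (- 1) = - 1"
    using \<beta>_m1_sq by (metis power2_eq_1_iff power2_eq_square)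
  moreover define b where "b = \<beta> (- 1) * of_nat CARD('a)"
  ultimately have "cnj b = b" by auto
  moreover have "\<kappa> * \<kappa> =
      of_nat CARD('a) ^ (n * (n - 1) div 2) * of_nat CARD('a) ^ (n * (n - 1) div 2) * inverse b ^ n"
    unfolding b_def \<epsilon>_sq[symmetric] by (simp add: \<kappa>_def power_mult_distrib)
  ultimately have "cnj (\<kappa> * \<kappa>) = \<kappa> * \<kappa>" by simp
  then have "ip f (I2 h) = \<kappa> * \<kappa> * ip f (I (I h))"
    unfolding I2_def ip_cnj[of f "fscale _ _"] ip_scale by (simp add: ip_cnj[of f "I (I h)"])
  then show ?thesis by (simp add: I2_def ip_scale e)
qed

theorem I2_semisimple:
  assumes f: "f \<in> V" and e: "I2 (I2 f - fscale (of_int \<mu>) f) = fscale (of_int \<mu>) (I2 f - fscale (of_int \<mu>) f)"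
  shows "I2 f = fscale (of_int \<mu>) f"
proof -
  define g where "g = I2 f - fscale (of_int \<mu>) f"
  have g: "g \<in> V" unfolding g_def by (rule shifted[OF f])
  have "ip g g = ip (I2 f) g - of_int \<mu> * ip f g" unfolding g_def by (simp only: ip_diff ip_scale)
  also have "ip (I2 f) g = ip f (fscale (of_int \<mu>) g)" using ip_I2[OF f g] e by (simp only: g_def)
  also have "\<dots> = cnj (of_int \<mu> * ip g f)" unfolding ip_cnj[of f "fscale _ _"] ip_scale ..
  also have "\<dots> = of_int \<mu> * ip f g" by (simp add: ip_cnj[of f g])
  finally have "ip g g = 0" by simp
  then have "g = 0" using ip_definite[OF g] by blast
  then show ?thesis by (simp add: g_def)
qed

theorem I2_diagonalizable: "diagonalizable_on V I2"
  by (rule diagonalizable[of "map of_int \<mu>s"]) (auto intro: I2_semisimple poly_at_annihilates)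

lemma I2_eigenvalue_root: "c \<in> eigenvalues_on V I2 \<Longrightarrow> \<exists>k\<le>n. c = of_int ((zmat CARD('a) n k k)\<^sup>2)"
proof -
  assume "c \<in> eigenvalues_on V I2"
  then have "c \<in> set (map of_int \<mu>s)" by (rule eigenvalue_root) (rule poly_at_annihilates)
  then show ?thesis by (auto simp: \<mu>s_def less_Suc_eq_le simp del: upt_Suc)
qed

end

section \<open>Rank of the lower left block\<close>

text \<open>
  The condition that the lower left $n \times n$ block has rank less than $m$, expressed by a factorisation
  because that is easily carried along row operations.
\<close>

definition low_rank :: "nat \<Rightarrow> nat \<Rightarrow> 'a::field row_pair \<Rightarrow> bool" where
  "low_rank n m \<tau> \<longleftrightarrow> (\<exists>j<m. \<exists>X Y. \<forall>i<n. \<forall>k<n. snd \<tau> i k = (\<Sum>s<j. X i s * Y s k))"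

lemma low_rank_rot:
  assumes "Suc i < n" "low_rank n m (rot i c \<tau>)"
  shows "low_rank n m \<tau>"
proof -
  obtain A R where \<tau>: "\<tau> = (A, R)" by (cases \<tau>)
  obtain j X Y where j: "j < m" "\<And>p k. p < n \<Longrightarrow> k < n \<Longrightarrow> snd (rot i c \<tau>) p k = (\<Sum>s<j. X p s * Y s k)"
    using assms(2) unfolding low_rank_def by blast
  define X' where "X' p s = (if p = i then X (Suc i) s - c * X i s else if p = Suc i then X i s else X p s)" for p s
  have "R p k = (\<Sum>s<j. X' p s * Y s k)" if "p < n" "k < n" for p k
  proof -
    consider "p = i" | "p = Suc i" | "p \<noteq> i" "p \<noteq> Suc i" by blast
    then show ?thesis
    proof cases
      case 1
      then show ?thesis
        using j(2)[of i k] j(2)[of "Suc i" k] that assms(1)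
        by (simp add: \<tau> X'_def left_diff_distrib sum_subtractf sum_distrib_left mult.assoc algebra_simps)
    next
      case 2
      then show ?thesis using j(2)[of i k] that assms(1) by (simp add: \<tau> X'_def)
    next
      case 3
      then show ?thesis using j(2)[of p k] that by (simp add: \<tau> X'_def)
    qed
  qed
  then show ?thesis using j(1) unfolding low_rank_def \<tau> by auto
qed

text \<open>
  The operation replaces only one of the lower rows, so the rank changes by at most one.
\<close>

lemma low_rank_dual:
  assumes "low_rank n m (dual x \<tau>)"
  shows "low_rank n (Suc m) \<tau>"
proof -
  obtain A R where \<tau>: "\<tau> = (A, R)" by (cases \<tau>)
  obtain j X Y where j: "j < m" "\<And>p k. p < n \<Longrightarrow> k < n \<Longrightarrow> snd (dual x \<tau>) p k = (\<Sum>s<j. X p s * Y s k)"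
    using assms unfolding low_rank_def by blast
  define X' where "X' p s = (if s = j then (if p = 0 then 1 else 0) else if p = 0 then 0 else X p s)" for p s
  define Y' where "Y' s k = (if s = j then R 0 k else Y s k)" for s k
  have "R p k = (\<Sum>s<Suc j. X' p s * Y' s k)" if "p < n" "k < n" for p k
    using j(2)[OF that] by (cases "p = 0") (simp_all add: X'_def Y'_def \<tau>)
  then show ?thesis
    using j(1) unfolding low_rank_def \<tau> snd_conv
    by (intro exI[of _ "Suc j"] conjI exI[of _ X'] exI[of _ Y'] allI impI) simp_all
qed

lemma low_rank_levi:
  assumes m: "(m', m) \<in> levi_pairs n" and "low_rank n l (levi_act n m' m \<tau>)"
  shows "low_rank n l \<tau>"
proof -
  obtain A R where \<tau>: "\<tau> = (A, R)" by (cases \<tau>)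
  obtain j X Y where j: "j < l" "\<And>p k. p < n \<Longrightarrow> k < n \<Longrightarrow> snd (levi_act n m' m \<tau>) p k = (\<Sum>s<j. X p s * Y s k)"
    using assms(2) unfolding low_rank_def by blast
  have c: "m' \<in> carrier_mat n n" "m \<in> carrier_mat n n" "transpose_mat m' * m = 1\<^sub>m n"
    using m by (auto simp: levi_pairs_def)
  define X' where "X' p s = (\<Sum>a<n. m' $$ (a, p) * X a s)" for p s
  have "R p k = (\<Sum>s<j. X' p s * Y s k)" if pk: "p < n" "k < n" for p k
  proof -
    have "R p k = (\<Sum>b<n. (transpose_mat m' * m) $$ (p, b) * R b k)"
      unfolding c(3) using pk by (simp only: sum_one_mat)
    also have "\<dots> = (\<Sum>b<n. \<Sum>a<n. m' $$ (a, p) * m $$ (a, b) * R b k)"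
      using c(1,2) pk by (intro sum.cong) (simp_all add: scalar_prod_def atLeast0LessThan sum_distrib_right)
    also have "\<dots> = (\<Sum>a<n. m' $$ (a, p) * (\<Sum>b<n. m $$ (a, b) * R b k))"
      by (subst sum.swap) (simp add: sum_distrib_left mult.assoc)
    also have "\<dots> = (\<Sum>a<n. \<Sum>s<j. m' $$ (a, p) * X a s * Y s k)"
      using j(2) pk by (intro sum.cong) (simp_all add: \<tau> sum_distrib_left mult.assoc)
    also have "\<dots> = (\<Sum>s<j. X' p s * Y s k)"
      unfolding X'_def by (subst sum.swap) (simp add: sum_distrib_right)
    finally show ?thesis .
  qed
  then show ?thesis using j(1) unfolding low_rank_def \<tau> by auto
qed

text \<open>
  A representative $J_l$ of the double coset of rank $l$: it exchanges the first $l$ row pairs like $J$ and is the identity on the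
  others, so that applying \<open>opp l\<close> with $X = 0$ returns to the identity matrix.
\<close>

definition base_point :: "nat \<Rightarrow> nat \<Rightarrow> 'a::field row_pair" where
  "base_point n l =
    (\<lambda>i k. if i < l then (if k = i + n then - 1 else 0) else (if k = i then 1 else 0),
     \<lambda>i k. if i < l then (if k = i then 1 else 0) else (if k = i + n then 1 else 0))"

lemma base_point_rank:
  assumes "l \<le> n"
  shows "\<not> low_rank n l (base_point n l :: 'a::field row_pair)"
proof
  assume "low_rank n l (base_point n l :: 'a row_pair)"
  then obtain j and X Y :: "'a rows" where j: "j < l"
    "\<And>p k. p < n \<Longrightarrow> k < n \<Longrightarrow> snd (base_point n l) p k = (\<Sum>s<j. X p s * Y s k)"
    unfolding low_rank_def by blast
  define M where "M = mat l l (\<lambda>(p, s). if s < j then X p s else 0)"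
  define N where "N = mat l l (\<lambda>(s, k). if s < j then Y s k else 0)"
  have "M * N = 1\<^sub>m l"
  proof (rule eq_matI)
    fix p k assume "p < dim_row (1\<^sub>m l :: 'a mat)" "k < dim_col (1\<^sub>m l :: 'a mat)"
    then have pk: "p < l" "k < l" by simp_all
    have "(M * N) $$ (p, k) = (\<Sum>s<l. if s < j then X p s * Y s k else 0)"
      using pk by (simp add: M_def N_def scalar_prod_def atLeast0LessThan) (intro sum.cong, auto)
    also have "\<dots> = (\<Sum>s<j. X p s * Y s k)"
      using j(1) by (intro sum.mono_neutral_cong_right) auto
    also have "\<dots> = (1\<^sub>m l :: 'a mat) $$ (p, k)"
      using j(2)[of p k] pk assms by (cases "p = k") (simp_all add: base_point_def)
    finally show "(M * N) $$ (p, k) = 1\<^sub>m l $$ (p, k)" .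
  qed (simp_all add: M_def N_def)
  then have "N * M = 1\<^sub>m l"
    by (intro mat_mult_left_right_inverse[of M l]) (simp_all add: M_def N_def)
  then have "(N * M) $$ (j, j) = 1" using j(1) by simp
  moreover have "(N * M) $$ (j, j) = 0" using j(1) by (simp add: M_def N_def scalar_prod_def)
  ultimately show False by simp
qed

context siegel_character
begin

text \<open>
  The function vanishes unless the lower left block has rank less than $m$. The parabolic has rank $0$, each
  $t_0$ enlarges the rank of the support by at most one, and the other generators preserve it.
\<close>

definition supported_below :: "nat \<Rightarrow> ('a row_pair \<Rightarrow> complex) \<Rightarrow> bool" where
  "supported_below m w \<longleftrightarrow> (\<forall>\<tau>. \<not> low_rank n m \<tau> \<longrightarrow> w \<tau> = 0)"

lemma supported_pull:
  assumes "supported_below m w" "\<And>c \<tau>. low_rank n m (\<phi> c \<tau>) \<Longrightarrow> low_rank n m' \<tau>"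
  shows "supported_below m' (app (pull a \<phi>) w)"
  unfolding supported_below_def
proof (intro allI impI)
  fix \<tau> :: "'a row_pair" assume "\<not> low_rank n m' \<tau>"
  then have "w (\<phi> c \<tau>) = 0" for c
    using assms unfolding supported_below_def by blast
  then show "app (pull a \<phi>) w \<tau> = 0" by (simp add: app_pull)
qed

lemma supported_gen0: "supported_below m w \<Longrightarrow> supported_below (Suc m) (app (gen 0) w)"
  unfolding gen.simps by (erule supported_pull) (rule low_rank_dual)

lemma supported_gen_Suc: "Suc i < n \<Longrightarrow> supported_below m w \<Longrightarrow> supported_below m (app (gen (Suc i)) w)"
  unfolding gen.simps by (erule supported_pull) (rule low_rank_rot)

lemma supported_L: "i < n \<Longrightarrow> supported_below m w \<Longrightarrow> supported_below (Suc m) (app (L i) w)"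
proof (induction i arbitrary: w)
  case 0
  then show ?case using supported_gen0 by (simp del: gen.simps)
next
  case (Suc i)
  then have "supported_below (Suc m) (app (gen (Suc i)) (app (L i) (app (gen (Suc i)) w)))"
    by (intro supported_gen_Suc Suc.IH) simp_all
  then show ?case by (simp only: L.simps app_times)
qed

lemma supported_mono: "supported_below m w \<Longrightarrow> m \<le> m' \<Longrightarrow> supported_below m' w"
  unfolding supported_below_def low_rank_def by (meson order_less_le_trans)

text \<open>
  Each $L_i$ contains $t_0$ once. So in the product $u_m$ of $m$ factors $q^j + L_j$ only the leading term
  $L_0 \cdots L_{m-1}$ can reach the rank $m$.
\<close>

lemma supported_partial_sym:
  assumes "supported_below 1 w" "m \<le> n"
  shows "supported_below (Suc m) (app (partial_sym q m) w)"
    and "supported_below m (\<lambda>\<tau>. app (partial_sym q m) w \<tau> - app (LL 0 m) w \<tau>)"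
proof -
  have "supported_below (Suc m) (app (partial_sym q m) w) \<and>
      supported_below m (\<lambda>\<tau>. app (partial_sym q m) w \<tau> - app (LL 0 m) w \<tau>)"
    using assms(2)
  proof (induction m)
    case 0
    then show ?case using assms(1) by (simp add: app_one LL_empty supported_below_def)
  next
    case (Suc m)
    define v where "v = app (partial_sym q m) w"
    \<comment> \<open>The terms of $u_m$ other than the leading one.\<close>
    define e where "e = (\<lambda>\<tau>. v \<tau> - app (LL 0 m) w \<tau>)"
    have IH: "supported_below (Suc m) v" "supported_below m e" using Suc by (simp_all add: v_def e_def)
    have top: "app (partial_sym q (Suc m)) w \<tau> = of_nat (q ^ m) * v \<tau> + app (L m) v \<tau>" for \<tau>
      by (simp add: app_times app_plus app_of_nat v_def del: of_nat_power)
    have "L m * LL 0 m = LL 0 m * L m" by (rule LL_commute) (rule L_commute)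
    then have "LL 0 (Suc m) = L m * LL 0 m" by (simp only: LL_last le0)
    then have LL: "app (LL 0 (Suc m)) w = app (L m) (app (LL 0 m) w)" by (simp only: app_times)
    have ve: "v = (\<lambda>\<tau>. e \<tau> + app (LL 0 m) w \<tau>)" by (simp add: e_def)
    have Lv: "app (L m) v \<tau> = app (L m) e \<tau> + app (LL 0 (Suc m)) w \<tau>" for \<tau>
      unfolding LL by (subst ve) (simp only: app_add_fun)
    have "supported_below (Suc (Suc m)) (app (L m) v)" "supported_below (Suc m) (app (L m) e)"
      using Suc.prems IH by (auto intro: supported_L)
    moreover have "supported_below (Suc (Suc m)) v" using IH(1) by (rule supported_mono) simp
    ultimately show ?case
      using IH(1) unfolding supported_below_def top Lv by (auto simp del: split_paired_All)
  qed
  then show "supported_below (Suc m) (app (partial_sym q m) w)"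
    "supported_below m (\<lambda>\<tau>. app (partial_sym q m) w \<tau> - app (LL 0 m) w \<tau>)" by simp_all
qed

section \<open>The function supported on the parabolic\<close>

definition delta :: "'a mat \<Rightarrow> complex" where
  "delta g = (if g \<in> siegel_parabolic n then \<chi> g else 0)"

lemma siegel_mult:
  fixes p p' :: "'a mat"
  assumes "p \<in> siegel_parabolic n" "p' \<in> siegel_parabolic n"
  shows "p * p' \<in> siegel_parabolic n"
proof -
  interpret group "GSp n :: 'a mat monoid" by (rule group_GSp)
  obtain A B D A' B' D' where c: "A \<in> carrier_mat n n" "B \<in> carrier_mat n n" "D \<in> carrier_mat n n"
    "A' \<in> carrier_mat n n" "B' \<in> carrier_mat n n" "D' \<in> carrier_mat n n"
    and e: "p = four_block_mat A B (0\<^sub>m n n) D" "p' = four_block_mat A' B' (0\<^sub>m n n) D'"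
    using assms unfolding siegel_parabolic_def by blast
  have "p * p' \<in> carrier (GSp n)"
    using assms siegel_subset m_closed[of p p'] by (auto simp: GSp_mult)
  moreover have "p * p' = four_block_mat (A * A') (A * B' + B * D') (0\<^sub>m n n) (D * D')"
    unfolding e using c
    by (subst mult_square_blocks[of _ n]) (auto intro!: cong_four_block_mat)
  moreover have "A * A' \<in> carrier_mat n n" "A * B' + B * D' \<in> carrier_mat n n" "D * D' \<in> carrier_mat n n"
    using c by auto
  ultimately show ?thesis unfolding siegel_parabolic_def by blast
qed

text \<open>
  In a finite group a subset closed under multiplication is closed under inverses: left multiplication by $p$ permutes it.
\<close>

lemma siegel_inv:
  fixes p :: "'a mat"
  assumes p: "p \<in> siegel_parabolic n"
  shows "inv\<^bsub>GSp n\<^esub> p \<in> siegel_parabolic n"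
proof -
  interpret group "GSp n :: 'a mat monoid" by (rule group_GSp)
  have pG: "p \<in> carrier (GSp n)" using p siegel_subset by blast
  have fin: "finite (siegel_parabolic n :: 'a mat set)"
    by (rule finite_subset[OF siegel_subset finite_GSp])
  have inj: "inj_on (\<lambda>x. p * x) (siegel_parabolic n)"
  proof (rule inj_onI)
    fix x y :: "'a mat"
    assume "x \<in> siegel_parabolic n" "y \<in> siegel_parabolic n" and e: "p * x = p * y"
    then have "x \<in> carrier (GSp n)" "y \<in> carrier (GSp n)" using siegel_subset by blast+
    moreover have "p \<otimes>\<^bsub>GSp n\<^esub> x = p \<otimes>\<^bsub>GSp n\<^esub> y" using e by (simp add: GSp_mult)
    ultimately show "x = y" using pG by simp
  qed
  have onto: "(\<lambda>x. p * x) ` siegel_parabolic n = siegel_parabolic n"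
    using siegel_mult[OF p] by (intro endo_inj_surj[OF fin _ inj]) auto
  then obtain x where x: "x \<in> siegel_parabolic n" "p = p * x" using p by blast
  obtain y where y: "y \<in> siegel_parabolic n" "x = p * y" using x(1) onto by blast
  have xG: "x \<in> carrier (GSp n)" and yG: "y \<in> carrier (GSp n)" using x y siegel_subset by blast+
  have "p \<otimes>\<^bsub>GSp n\<^esub> x = p" by (simp add: GSp_mult x(2)[symmetric])
  then have "x = \<one>\<^bsub>GSp n\<^esub>" using pG xG by simp
  then have "p \<otimes>\<^bsub>GSp n\<^esub> y = \<one>\<^bsub>GSp n\<^esub>" using y(2) by (simp add: GSp_mult)
  then have "inv\<^bsub>GSp n\<^esub> p = y" by (rule inv_equality[OF inv_comm[OF _ pG yG] pG yG])
  then show ?thesis using y by simp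
qed

lemma delta_V: "delta \<in> V"
  unfolding induced_def
proof (intro CollectI conjI allI impI ballI)
  fix g :: "'a mat" assume "g \<notin> carrier (GSp n)"
  then show "delta g = 0" using siegel_subset by (auto simp: delta_def)
next
  fix p g :: "'a mat" assume p: "p \<in> siegel_parabolic n" and g: "g \<in> carrier (GSp n)"
  interpret group "GSp n :: 'a mat monoid" by (rule group_GSp)
  have pG: "p \<in> carrier (GSp n)" using p siegel_subset by blast
  have "p * g \<in> siegel_parabolic n \<longleftrightarrow> g \<in> siegel_parabolic n"
  proof
    assume "p * g \<in> siegel_parabolic n"
    then have "inv\<^bsub>GSp n\<^esub> p * (p * g) \<in> siegel_parabolic n" by (rule siegel_mult[OF siegel_inv[OF p]])
    moreover have "inv\<^bsub>GSp n\<^esub> p \<otimes>\<^bsub>GSp n\<^esub> (p \<otimes>\<^bsub>GSp n\<^esub> g) = g"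
      using pG g by (simp flip: m_assoc)
    ultimately show "g \<in> siegel_parabolic n" by (simp add: GSp_mult)
  qed (rule siegel_mult[OF p])
  then show "delta (p * g) = \<chi> p * delta g" using \<chi>_mult[OF p] by (simp add: delta_def)
qed

lemma siegel_rows_zero:
  assumes "mat_of n \<tau> \<in> siegel_parabolic n" "i < n" "k < n"
  shows "snd \<tau> i k = (0 :: 'a)"
proof -
  obtain A B D where c: "A \<in> carrier_mat n n" "B \<in> carrier_mat n n" "D \<in> carrier_mat n n"
    and e: "mat_of n \<tau> = four_block_mat A B (0\<^sub>m n n) D"
    using assms(1) unfolding siegel_parabolic_def by blast
  have "mat_of n \<tau> $$ (i + n, k) = 0" unfolding e using c assms by simp
  then show ?thesis using assms by (simp add: mat_of_def)
qed

lemma delta_supported: "supported_below 1 (\<lambda>\<tau>. delta (mat_of n \<tau>))"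
  unfolding supported_below_def
proof (intro allI impI)
  fix \<tau> :: "'a row_pair" assume "\<not> low_rank n 1 \<tau>"
  then have "mat_of n \<tau> \<notin> siegel_parabolic n"
    using siegel_rows_zero[of \<tau>] by (auto simp: low_rank_def)
  then show "delta (mat_of n \<tau>) = 0" by (simp add: delta_def)
qed

text \<open>
  No cancellation can occur in the average of $\delta$ at the base point. If the matrix lies in the parabolic,
  its vanishing lower left block forces $m$ to be block upper triangular and $X$ to be zero. The matrix is
  then block upper triangular with a lower right block of determinant $\det(a)^{-1} \det d$, where $a$ and $d$
  are the diagonal blocks of $m$. So $\chi$ takes there the value $\beta(\det m)$ up to squares, and the
  product of the two values is $1$.
\<close>

lemma delta_term:
  assumes l: "l \<le> n" and m: "(m', m) \<in> levi_pairs n" and X: "X \<in> sym_set l"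
  shows "\<beta> (det m) * delta (mat_of n (opp l X (levi_act n m' m (base_point n l)))) \<in> {0, 1}"
proof (cases "mat_of n (opp l X (levi_act n m' m (base_point n l))) \<in> siegel_parabolic n")
  case False
  then show ?thesis by (simp add: delta_def)
next
  case True
  define \<sigma> where "\<sigma> = levi_act n m' m (base_point n l)"
  let ?r = "n - l"
  have c: "m' \<in> carrier_mat n n" "m \<in> carrier_mat n n" and mm: "transpose_mat m' * m = 1\<^sub>m n"
    using m by (auto simp: levi_pairs_def)
  have \<sigma>A: "fst \<sigma> i k = (if k < n then (if l \<le> k then m' $$ (i, k) else 0) else (if k - n < l then - m' $$ (i, k - n) else 0))"
    if "i < n" "k < 2 * n" for i k
  proof -
    have kn: "(if k < n then k else k - n) < n" using that by auto
    have "fst \<sigma> i k = (\<Sum>j<n. m' $$ (i, j) * fst (base_point n l) j k)"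
      using that by (simp add: \<sigma>_def base_point_def)
    also have "\<dots> = (\<Sum>j<n. if j = (if k < n then k else k - n) then
        (if k < n then (if l \<le> k then m' $$ (i, k) else 0) else (if k - n < l then - m' $$ (i, k - n) else 0)) else 0)"
      using that by (intro sum.cong refl) (auto simp: base_point_def)
    finally show ?thesis by (simp only: sum.delta finite_lessThan lessThan_iff kn if_True)
  qed
  have \<sigma>R: "snd \<sigma> i k = (if k < n then (if k < l then m $$ (i, k) else 0) else (if l \<le> k - n then m $$ (i, k - n) else 0))"
    if "i < n" "k < 2 * n" for i k
  proof -
    have kn: "(if k < n then k else k - n) < n" using that by auto
    have "snd \<sigma> i k = (\<Sum>j<n. m $$ (i, j) * snd (base_point n l) j k)"
      using that by (simp add: \<sigma>_def base_point_def)
    also have "\<dots> = (\<Sum>j<n. if j = (if k < n then k else k - n) then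
        (if k < n then (if k < l then m $$ (i, k) else 0) else (if l \<le> k - n then m $$ (i, k - n) else 0)) else 0)"
      using that by (intro sum.cong refl) (auto simp: base_point_def)
    finally show ?thesis by (simp only: sum.delta finite_lessThan lessThan_iff kn if_True)
  qed
  have opp: "fst (opp l X \<sigma>) i k = (if i < l then snd \<sigma> i k else fst \<sigma> i k)"
    "snd (opp l X \<sigma>) i k = (if i < l then - fst \<sigma> i k - (\<Sum>j<l. X i j * snd \<sigma> j k) else snd \<sigma> i k)" for i k
    by (cases \<sigma>; simp)+
  have z: "snd (opp l X \<sigma>) i k = 0" if "i < n" "k < n" for i k
    using siegel_rows_zero[OF True that] by (simp add: \<sigma>_def)
  have m21: "m $$ (i, k) = 0" if "l \<le> i" "i < n" "k < l" for i k
    using z[of i k] that l by (simp add: opp \<sigma>R)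
  \<comment> \<open>The blocks of $m$ and of its inverse transpose, for the partition $n = l + (n - l)$.\<close>
  define a where "a = mat l l (\<lambda>(i, k). m $$ (i, k))"
  define b where "b = mat l ?r (\<lambda>(i, k). m $$ (i, k + l))"
  define d where "d = mat ?r ?r (\<lambda>(i, k). m $$ (i + l, k + l))"
  define a' where "a' = mat l l (\<lambda>(i, k). m' $$ (i, k))"
  define b' where "b' = mat l ?r (\<lambda>(i, k). m' $$ (i, k + l))"
  define e' where "e' = mat ?r l (\<lambda>(i, k). m' $$ (i + l, k))"
  define d' where "d' = mat ?r ?r (\<lambda>(i, k). m' $$ (i + l, k + l))"
  note cs = a_def b_def d_def a'_def b'_def e'_def d'_def
  have car: "a \<in> carrier_mat l l" "b \<in> carrier_mat l ?r" "d \<in> carrier_mat ?r ?r"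
    "a' \<in> carrier_mat l l" "b' \<in> carrier_mat l ?r" "e' \<in> carrier_mat ?r l" "d' \<in> carrier_mat ?r ?r"
    by (simp_all add: cs)
  have mB: "m = four_block_mat a b (0\<^sub>m ?r l) d"
    using c l by (intro eq_matI) (auto simp: cs m21)
  have m'B: "m' = four_block_mat a' b' e' d'"
    using c l by (intro eq_matI) (auto simp: cs)
  have tB: "transpose_mat m' = four_block_mat (transpose_mat a') (transpose_mat e') (transpose_mat b') (transpose_mat d')"
    unfolding m'B using car by (subst transpose_four_block_mat) auto
  have "four_block_mat (transpose_mat a' * a) (transpose_mat a' * b + transpose_mat e' * d)
      (transpose_mat b' * a) (transpose_mat b' * b + transpose_mat d' * d) = transpose_mat m' * m"
    unfolding tB mB using car
    by (subst mult_four_block_mat[where ?n1.0 = l and ?n2.0 = "?r" and ?nr1.0 = l and ?nr2.0 = "?r"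
          and ?nc1.0 = l and ?nc2.0 = "?r"]) (auto intro!: cong_four_block_mat)
  also have "\<dots> = four_block_mat (1\<^sub>m l) (0\<^sub>m l ?r) (0\<^sub>m ?r l) (1\<^sub>m ?r)"
    unfolding mm using l by (intro eq_matI) auto
  finally have blocks: "four_block_mat (transpose_mat a' * a) (transpose_mat a' * b + transpose_mat e' * d)
      (transpose_mat b' * a) (transpose_mat b' * b + transpose_mat d' * d) =
      four_block_mat (1\<^sub>m l) (0\<^sub>m l ?r) (0\<^sub>m ?r l) (1\<^sub>m ?r)" .
  have split: "split_block (four_block_mat P Q S T) l l = (P, Q, S, T)"
    if "P \<in> carrier_mat l l" "Q \<in> carrier_mat l ?r" "S \<in> carrier_mat ?r l" "T \<in> carrier_mat ?r ?r"
    for P Q S T :: "'a mat"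
    using that unfolding split_block_def Let_def by (auto intro!: eq_matI)
  have sp: "(transpose_mat a' * a, transpose_mat a' * b + transpose_mat e' * d, transpose_mat b' * a,
      transpose_mat b' * b + transpose_mat d' * d) = (1\<^sub>m l, 0\<^sub>m l ?r, 0\<^sub>m ?r l, 1\<^sub>m ?r)"
    using arg_cong[OF blocks, of "\<lambda>M. split_block M l l"] car by (subst (asm) (1 2) split) auto
  then have aa: "transpose_mat a' * a = 1\<^sub>m l" and ba: "transpose_mat b' * a = 0\<^sub>m ?r l"
    and bd: "transpose_mat b' * b + transpose_mat d' * d = 1\<^sub>m ?r" by simp_all
  have aa2: "a * transpose_mat a' = 1\<^sub>m l"
    by (rule mat_mult_left_right_inverse[OF _ car(1) aa]) (use car in simp)
  have "transpose_mat b' = transpose_mat b' * (a * transpose_mat a')" using car aa2 by simp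
  also have "\<dots> = transpose_mat b' * a * transpose_mat a'"
    using car by (intro assoc_mult_mat[symmetric, of _ ?r l _ l _ l]) auto
  also have "\<dots> = 0\<^sub>m ?r l" using ba car by simp
  finally have b0: "transpose_mat b' = 0\<^sub>m ?r l" .
  have b'0: "b' = 0\<^sub>m l ?r"
    using arg_cong[OF b0, of transpose_mat] by simp
  have dd: "transpose_mat d' * d = 1\<^sub>m ?r" using bd car unfolding b0 by simp
  \<comment> \<open>The first $l$ columns of the upper half of the translated base point are zero, so the vanishing of the
    lower left block gives $X a = 0$ with $a$ invertible.\<close>
  define x where "x = mat l l (\<lambda>(i, j). X i j)"
  have xa: "x * a = 0\<^sub>m l l"
  proof (rule eq_matI)
    fix i k assume "i < dim_row (0\<^sub>m l l :: 'a mat)" "k < dim_col (0\<^sub>m l l :: 'a mat)"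
    then have ik: "i < l" "k < l" by simp_all
    have "(\<Sum>j<l. X i j * snd \<sigma> j k) = 0"
      using z[of i k] ik l by (simp add: opp \<sigma>A)
    moreover have "(\<Sum>j<l. X i j * snd \<sigma> j k) = (\<Sum>j<l. X i j * m $$ (j, k))"
      using ik l by (intro sum.cong) (simp_all add: \<sigma>R)
    ultimately show "(x * a) $$ (i, k) = 0\<^sub>m l l $$ (i, k)"
      using ik by (simp add: x_def a_def scalar_prod_def atLeast0LessThan)
  qed (simp_all add: x_def a_def)
  have xc: "x \<in> carrier_mat l l" by (simp add: x_def)
  have "x = x * (a * transpose_mat a')" using xc aa2 by simp
  also have "\<dots> = x * a * transpose_mat a'"
    using car xc by (intro assoc_mult_mat[symmetric, of _ l l _ l _ l]) auto
  also have "\<dots> = 0\<^sub>m l l" using xa car by simp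
  finally have x0: "x = 0\<^sub>m l l" .
  have X0: "X i j = 0" if "i < l" "j < l" for i j
    using arg_cong[OF x0, of "\<lambda>M. M $$ (i, j)"] that by (simp add: x_def)
  \<comment> \<open>The first $l$ rows of the two halves have been exchanged, so $a$ and $d'$ make up the upper left block.\<close>
  define A1 where "A1 = four_block_mat a (0\<^sub>m l ?r) (0\<^sub>m ?r l) d'"
  define D1 where "D1 = four_block_mat a' (0\<^sub>m l ?r) (0\<^sub>m ?r l) d"
  define B1 where "B1 = mat n n (\<lambda>(i, k). fst (opp l X \<sigma>) i (k + n))"
  have ln: "l + ?r = n" using l by simp
  have car1: "A1 \<in> carrier_mat n n" "D1 \<in> carrier_mat n n" "B1 \<in> carrier_mat n n"
    using car four_block_carrier_mat[of a l l d' ?r ?r] four_block_carrier_mat[of a' l l d ?r ?r] ln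
    by (simp_all add: A1_def D1_def B1_def)
  have "transpose_mat A1 = four_block_mat (transpose_mat a) (0\<^sub>m l ?r) (0\<^sub>m ?r l) (transpose_mat d')"
    unfolding A1_def using car by (subst transpose_four_block_mat) auto
  then have "transpose_mat A1 * D1 = four_block_mat (transpose_mat a * a') (0\<^sub>m l ?r) (0\<^sub>m ?r l) (transpose_mat d' * d)"
    unfolding D1_def using car
    by (simp, subst mult_four_block_mat[where ?n1.0 = l and ?n2.0 = "?r" and ?nr1.0 = l and ?nr2.0 = "?r"
          and ?nc1.0 = l and ?nc2.0 = "?r"]) (auto intro!: cong_four_block_mat)
  moreover have "transpose_mat a * a' = 1\<^sub>m l"
    using levi_pairs_swap[of a' a l] aa car by (simp add: levi_pairs_def)
  ultimately have "transpose_mat A1 * D1 = 1\<^sub>m n"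
    using dd ln by simp
  then have AD: "(A1, D1) \<in> levi_pairs n" using car1 by (simp add: levi_pairs_def)
  have m'z: "m' $$ (i, k) = 0" if "i < l" "l \<le> k" "k < n" for i k
    using arg_cong[OF b'0, of "\<lambda>M. M $$ (i, k - l)"] that by (simp add: b'_def)
  have M: "mat_of n (opp l X \<sigma>) = four_block_mat A1 B1 (0\<^sub>m n n) D1"
  proof (rule eq_matI)
    fix i k assume "i < dim_row (four_block_mat A1 B1 (0\<^sub>m n n) D1)" "k < dim_col (four_block_mat A1 B1 (0\<^sub>m n n) D1)"
    then have ik: "i < 2 * n" "k < 2 * n" using car1 by simp_all
    have Xs: "(\<Sum>j<l. X i j * F j) = 0" for i and F :: "nat \<Rightarrow> 'a"
      using X0 X by (intro sum.neutral) (auto simp: sym_set_def, metis not_less)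
    consider "i < n" "k < n" | "i < n" "n \<le> k" | "n \<le> i" "k < n" | "n \<le> i" "n \<le> k" by linarith
    then show "mat_of n (opp l X \<sigma>) $$ (i, k) = four_block_mat A1 B1 (0\<^sub>m n n) D1 $$ (i, k)"
    proof cases
      case 1
      then have "A1 $$ (i, k) = fst (opp l X \<sigma>) i k"
        using l ln car by (auto simp: A1_def opp \<sigma>A \<sigma>R cs)
      then show ?thesis using 1 ik car1 by (simp add: mat_of_def)
    next
      case 2
      then show ?thesis using ik car1 by (simp add: mat_of_def B1_def)
    next
      case 3
      then show ?thesis using ik car1 z[of "i - n" k] by (simp add: mat_of_def)
    next
      case 4
      then have "D1 $$ (i - n, k - n) = snd (opp l X \<sigma>) (i - n) k"
        using l ln car ik by (auto simp: D1_def opp \<sigma>A \<sigma>R cs Xs m21)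
      then show ?thesis using 4 ik car1 by (simp add: mat_of_def)
    qed
  qed (use car1 in \<open>simp_all add: mat_of_def\<close>)
  have "\<chi> (mat_of n (opp l X \<sigma>)) = \<beta> (det D1)"
    unfolding M using True siegel_subset by (intro \<chi>_block[OF AD car1(3)]) (auto simp: M \<sigma>_def[symmetric])
  moreover have "det D1 = det a' * det d"
    unfolding D1_def using car by (intro det_four_block_mat_lower_left_zero) auto
  moreover have "det m = det a * det d"
    unfolding mB using car by (intro det_four_block_mat_lower_left_zero) auto
  moreover have "det a' * det a = 1" using levi_pairs_det[of a' a l] aa car by (simp add: levi_pairs_def)
  moreover have "det m \<noteq> 0" using levi_pairs_det[OF m] by auto
  ultimately have \<chi>\<sigma>: "\<chi> (mat_of n (opp l X \<sigma>)) = \<beta> (det a' * det d)" and dm: "det m = det a * det d"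
    and a1: "det a' * det a = 1" and nz: "det a \<noteq> 0" "det a' \<noteq> 0" "det d \<noteq> 0"
    by auto
  have "\<beta> (det m) * \<chi> (mat_of n (opp l X \<sigma>)) = \<beta> (det a' * det a) * (\<beta> (det d) * \<beta> (det d))"
    unfolding \<chi>\<sigma> dm \<beta>_mult[OF nz(1,3)] \<beta>_mult[OF nz(2,3)] \<beta>_mult[OF nz(2,1)] by (simp only: mult_ac)
  then have "\<beta> (det m) * \<chi> (mat_of n (opp l X \<sigma>)) = 1"
    using a1 \<beta>_1 \<beta>_sq[OF nz(3)] by simp
  then show ?thesis using True by (simp add: delta_def \<sigma>_def)
qed

lemma base_point_term: "l \<le> n \<Longrightarrow> mat_of n (opp l (\<lambda>_ _. 0) (levi_act n (1\<^sub>m n) (1\<^sub>m n) (base_point n l))) = (1\<^sub>m (2 * n) :: 'a mat)"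
proof -
  assume l: "l \<le> n"
  have "levi_act n (1\<^sub>m n) (1\<^sub>m n) \<tau> = \<tau>" for \<tau> :: "'a row_pair"
    by (cases \<tau>) (auto simp: fun_eq_iff sum_one_mat simp del: index_one_mat)
  then have "mat_of n (opp l (\<lambda>_ _. 0) (levi_act n (1\<^sub>m n) (1\<^sub>m n) (base_point n l))) =
      mat_of n (opp l (\<lambda>_ _. 0) (base_point n l :: 'a row_pair))" by (simp only:)
  also have "\<dots> = 1\<^sub>m (2 * n)" using l by (intro eq_matI) (auto simp: mat_of_def base_point_def)
  finally show ?thesis .
qed

lemma one_siegel: "1\<^sub>m (2 * n) \<in> (siegel_parabolic n :: 'a mat set)" and \<chi>_one: "\<chi> (1\<^sub>m (2 * n)) = 1"
proof -
  have "levi_mat n (1\<^sub>m n) (1\<^sub>m n) = (1\<^sub>m (2 * n) :: 'a mat)"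
    by (auto simp: levi_mat_def intro!: eq_matI)
  then show "1\<^sub>m (2 * n) \<in> (siegel_parabolic n :: 'a mat set)" "\<chi> (1\<^sub>m (2 * n)) = 1"
    using levi_siegel[OF levi_pairs_one, of n, where 'a = 'a] \<chi>_levi[OF levi_pairs_one] \<beta>_1 by simp_all
qed

text \<open>
  The Levi factor preserves the rank, so the average only involves points of rank $l$ or more.
\<close>

lemma gl_average_base_point:
  assumes "supported_below l w" "l \<le> n"
  shows "gl_average n w (base_point n l) = 0"
  unfolding gl_average_def
proof (rule sum.neutral, clarify)
  fix m' m :: "'a mat" assume m: "(m', m) \<in> levi_pairs n"
  have "\<not> low_rank n l (levi_act n m' m (base_point n l))"
    using low_rank_levi[OF m] base_point_rank[OF assms(2)] by blast
  then have "w (levi_act n m' m (base_point n l)) = 0"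
    using assms(1) unfolding supported_below_def by blast
  then show "\<beta> (det m) * w (levi_act n m' m (base_point n l)) = 0" by simp
qed

lemma finite_sym_set: "finite (sym_set l :: (nat \<Rightarrow> nat \<Rightarrow> 'a) set)"
proof (rule finite_subset)
  show "sym_set l \<subseteq> (\<lambda>h i j. if i < l \<and> j < l then h (i, j) else (0::'a)) ` (PiE ({..<l} \<times> {..<l}) (\<lambda>_. UNIV))"
  proof
    fix X :: "nat \<Rightarrow> nat \<Rightarrow> 'a" assume X: "X \<in> sym_set l"
    have e: "X = (\<lambda>i j. if i < l \<and> j < l then restrict (\<lambda>(i, j). X i j) ({..<l} \<times> {..<l}) (i, j) else 0)"
      using X by (auto simp: sym_set_def fun_eq_iff) (metis not_less)
    then show "X \<in> (\<lambda>h i j. if i < l \<and> j < l then h (i, j) else 0) ` (PiE ({..<l} \<times> {..<l}) (\<lambda>_. UNIV))"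
      using imageI[of "restrict (\<lambda>(i, j). X i j) ({..<l} \<times> {..<l})" "PiE ({..<l} \<times> {..<l}) (\<lambda>_. UNIV)"
          "\<lambda>h i j. if i < l \<and> j < l then h (i, j) else 0"]
      unfolding e[symmetric] by (simp add: restrict_PiE_iff)
  qed
qed (intro finite_imageI finite_PiE; simp)

text \<open>
  At a point of rank $l$ only the leading term of $u_l$ contributes. By \<open>app_LL\<close> it is a nonzero
  multiple of a sum of terms that are $0$ or $1$, and the identity matrix contributes a $1$.
\<close>

lemma gl_average_delta_partial_sym:
  assumes l: "l \<le> n"
  shows "gl_average n (app (partial_sym q l) (\<lambda>\<tau>. delta (mat_of n \<tau>))) (base_point n l) \<noteq> 0"
proof -
  let ?d = "\<lambda>\<tau>. delta (mat_of n \<tau>)"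
  define e where "e = (\<lambda>\<tau>. app (partial_sym q l) ?d \<tau> - app (LL 0 l) ?d \<tau>)"
  define c :: complex where "c = of_nat CARD('a) ^ (l * (l - 1) div 2) * inverse \<epsilon> ^ l"
  have c: "c \<noteq> 0" using \<epsilon>_nz by (simp add: c_def)
  have "app (partial_sym q l) ?d = (\<lambda>\<tau>. e \<tau> + app (LL 0 l) ?d \<tau>)" by (simp add: e_def)
  then have "gl_average n (app (partial_sym q l) ?d) (base_point n l) =
      gl_average n e (base_point n l) + gl_average n (app (LL 0 l) ?d) (base_point n l)"
    by (simp only: gl_average_add)
  also have "gl_average n e (base_point n l) = 0"
    unfolding e_def by (rule gl_average_base_point[OF supported_partial_sym(2)[OF delta_supported l] l])
  finally have 1: "gl_average n (app (partial_sym q l) ?d) (base_point n l) =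
      gl_average n (app (LL 0 l) ?d) (base_point n l)" by simp
  define S where "S = (levi_pairs n \<times> sym_set l :: (('a mat \<times> 'a mat) \<times> (nat \<Rightarrow> nat \<Rightarrow> 'a)) set)"
  define F where "F = (\<lambda>((m', m), X). \<beta> (det m) * ?d (opp l X (levi_act n m' m (base_point n l))))"
  have LLd: "app (LL 0 l) ?d \<tau> = c * (\<Sum>X\<in>sym_set l. ?d (opp l X \<tau>))" for \<tau>
    unfolding c_def by (rule app_LL[OF siegel_equivariant_imp[OF V_equivariant[OF delta_V]] l])
  have 2: "gl_average n (app (LL 0 l) ?d) (base_point n l) = c * (\<Sum>x\<in>S. F x)"
  proof -
    have "(\<Sum>x\<in>S. F x) = (\<Sum>p\<in>levi_pairs n. \<Sum>X\<in>sym_set l. F (p, X))"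
      by (simp add: S_def sum.cartesian_product)
    then show ?thesis
      by (simp add: gl_average_def F_def split_def sum_distrib_left mult_ac LLd)
  qed
  have fin: "finite S" unfolding S_def by (simp add: finite_levi_pairs finite_sym_set)
  have F01: "F x \<in> {0, 1}" if "x \<in> S" for x
  proof -
    obtain m' m X where x: "x = ((m', m), X)" by (metis surj_pair)
    then show ?thesis using that delta_term[OF l, of m' m X] by (simp only: S_def F_def mem_Times_iff fst_conv snd_conv split_conv)
  qed
  let ?x = "((1\<^sub>m n, 1\<^sub>m n), \<lambda>_ _. 0) :: ('a mat \<times> 'a mat) \<times> (nat \<Rightarrow> nat \<Rightarrow> 'a)"
  have x: "?x \<in> S" "F ?x = 1"
    using levi_pairs_one one_siegel \<chi>_one \<beta>_1 l
    by (simp_all add: S_def F_def sym_set_def base_point_term delta_def del: opp.simps levi_act.simps)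
  have "Re (F ?x) \<le> (\<Sum>x\<in>S. Re (F x))"
    by (rule member_le_sum[OF x(1) _ fin]) (use F01 in force)
  then have "(\<Sum>x\<in>S. F x) \<noteq> 0" using x(2) by (auto simp flip: Re_sum)
  then show ?thesis using c unfolding 1 2 by simp
qed

section \<open>The spectrum\<close>

text \<open>
  If the value were not an eigenvalue, the product of the other factors would annihilate $\delta$. Expanded in the $u_m$ with $m \ge k$,
  this product applied to $u_k$ has a highest term $u_l$ with nonzero coefficient, and this term alone is
  visible at the base point of rank $l$.
\<close>

theorem I2_eigenvalue:
  assumes k: "k \<le> n"
  shows "of_int ((zmat CARD('a) n k k)\<^sup>2) \<in> eigenvalues_on V I2"
proof (rule ccontr)
  let ?q = "CARD('a)"
  let ?a = "(zmat ?q n k k)\<^sup>2"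
  assume no: "of_int ?a \<notin> eigenvalues_on V I2"
  \<comment> \<open>Filtering by value rather than by index: different $k$ can have the same $z_k^2$, and all these factors have to be dropped.\<close>
  define \<nu>s where "\<nu>s = filter (\<lambda>\<mu>. \<mu> \<noteq> ?a) \<mu>s"
  have f: "filter (\<lambda>b. b \<noteq> of_int ?a) (map of_int \<mu>s) = (map of_int \<nu>s :: complex list)"
    unfolding \<nu>s_def by (simp only: filter_map o_def of_int_eq_iff)
  have z: "app (center_prod n \<nu>s) (\<lambda>\<tau>. delta (mat_of n \<tau>)) = (\<lambda>\<tau>. 0)"
    using poly_at_filter[OF no delta_V poly_at_annihilates[OF delta_V]]
    unfolding f app_center_prod[OF delta_V] by simp
  obtain c :: "nat \<Rightarrow> int" where c: "c k = (\<Prod>\<mu>\<leftarrow>\<nu>s. ?a - \<mu>)"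
    "\<And>\<Lambda>. spherical gen n ?q \<Lambda> \<Longrightarrow>
      \<Lambda> (center_prod n \<nu>s * partial_sym ?q k) = (\<Sum>m\<in>{k..n}. of_int (c m) * \<Lambda> (partial_sym ?q m))"
    using center_prod_triangular[OF k, of ?q \<nu>s] by blast
  have ck: "c k \<noteq> 0" unfolding c(1) \<nu>s_def by (auto simp: prod_list_zero_iff)
  define l where "l = Max {m \<in> {k..n}. c m \<noteq> 0}"
  have "l \<in> {m \<in> {k..n}. c m \<noteq> 0}" unfolding l_def using ck k by (intro Max_in) auto
  then have l: "k \<le> l" "l \<le> n" "c l \<noteq> 0" by simp_all
  have lmax: "c m = 0" if "l < m" "m \<le> n" for m
  proof (rule ccontr)
    assume "c m \<noteq> 0"
    then have "m \<le> l" unfolding l_def using that l by (intro Max_ge) auto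
    then show False using that by simp
  qed
  define \<Lambda> where "\<Lambda> = (\<lambda>r. gl_average n (app r (\<lambda>\<tau>. delta (mat_of n \<tau>))) (base_point n l))"
  have sph: "spherical gen n ?q \<Lambda>"
    unfolding \<Lambda>_def by (rule spherical_gl_average[OF V_equivariant[OF delta_V]])
  have low: "\<Lambda> (partial_sym ?q m) = 0" if "m < l" for m
    unfolding \<Lambda>_def
    using supported_mono[OF supported_partial_sym(1)[OF delta_supported, of m ?q], of l] that l
    by (intro gl_average_base_point) simp_all
  have "partial_sym ?q k * LL 0 n = LL 0 n * partial_sym ?q k"
  proof (rule partial_sym_commute[symmetric])
    show "LL 0 n * L i = L i * LL 0 n" for i by (rule LL_commute[symmetric]) (rule L_commute)
  qed
  then have "partial_sym ?q k * center_prod n \<nu>s = center_prod n \<nu>s * partial_sym ?q k" by (rule center_prod_commute)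
  then have "\<Lambda> (center_prod n \<nu>s * partial_sym ?q k) = \<Lambda> (partial_sym ?q k * center_prod n \<nu>s)" by simp
  also have "\<dots> = 0" unfolding \<Lambda>_def app_times z app_zero_fun by (simp add: gl_average_def split_def)
  finally have "(\<Sum>m\<in>{k..n}. of_int (c m) * \<Lambda> (partial_sym ?q m)) = 0" using c(2)[OF sph] by simp
  moreover have "(\<Sum>m\<in>{k..n}. of_int (c m) * \<Lambda> (partial_sym ?q m)) =
      (\<Sum>m\<in>{k..n}. if m = l then of_int (c l) * \<Lambda> (partial_sym ?q l) else 0)"
  proof (rule sum.cong[OF refl])
    fix m assume "m \<in> {k..n}"
    then show "of_int (c m) * \<Lambda> (partial_sym ?q m) = (if m = l then of_int (c l) * \<Lambda> (partial_sym ?q l) else 0)"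
      using low[of m] lmax[of m] by (cases m l rule: linorder_cases) auto
  qed
  ultimately have "of_int (c l) * \<Lambda> (partial_sym ?q l) = 0" using l by simp
  then show False using l(3) gl_average_delta_partial_sym[OF l(2), of ?q] by (simp add: \<Lambda>_def)
qed

theorem I2_eigenvalues: "eigenvalues_on V I2 = {of_int ((zmat CARD('a) n k k)\<^sup>2) | k. k \<le> n}"
  using I2_eigenvalue I2_eigenvalue_root by blast

text \<open>
  With $j = n - k$, the exponents satisfy $n + 2 (k(k-1) + kj + j(j-1)) = k^2 + j^2 + n(n-1)$, and
  $\kappa^2 = q^{n(n-1)} (\beta(-1) q)^{-n}$.
\<close>

lemma \<kappa>_eigenvalue:
  assumes "k \<le> n"
  shows "of_int ((zmat CARD('a) n k k)\<^sup>2) =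
    \<kappa> * \<kappa> * (\<beta> (- 1) ^ n * of_nat CARD('a) ^ (k\<^sup>2 + (n - k)\<^sup>2))"
proof -
  obtain j where n: "n = k + j" using assms by (metis le_Suc_ex)
  let ?q = "of_nat CARD('a) :: complex"
  have q: "?q \<noteq> 0" by simp
  have z: "zmat CARD('a) n k k = (- 1) ^ j * int CARD('a) ^ (k * (k - 1) + (k * j + j * (j - 1)))"
    unfolding n zmat_def zcoef_diag by (simp add: power_add)
  have zz: "of_int ((zmat CARD('a) n k k)\<^sup>2) = ?q ^ (2 * (k * (k - 1) + (k * j + j * (j - 1))))"
    unfolding z by (simp add: power_mult_distrib power_mult[symmetric] mult.commute)
  have e: "n * (n - 1) div 2 + n * (n - 1) div 2 = n * (n - 1)"
  proof -
    have "even (n * (n - 1))" by (cases n) auto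
    then show ?thesis by (metis dvd_mult_div_cancel mult_2)
  qed
  have half: "?q ^ (n * (n - 1) div 2) * ?q ^ (n * (n - 1) div 2) = ?q ^ (n * (n - 1))"
    by (simp only: power_add[symmetric] e)
  have "inverse x ^ n * x ^ n = 1" if "x \<noteq> 0" for x :: complex
    using that by (simp add: power_inverse)
  moreover have "\<epsilon> * \<epsilon> \<noteq> 0" using \<epsilon>_nz by simp
  ultimately have "inverse (\<epsilon> * \<epsilon>) ^ n * (\<epsilon> * \<epsilon>) ^ n = 1" by blast
  moreover have "(\<epsilon> * \<epsilon>) ^ n = \<beta> (- 1) ^ n * ?q ^ n" by (simp add: \<epsilon>_sq power_mult_distrib)
  ultimately have "inverse (\<epsilon> * \<epsilon>) ^ n * (\<beta> (- 1) ^ n * ?q ^ n) = 1" by (simp only:)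
  moreover have "\<kappa> * \<kappa> = ?q ^ (n * (n - 1)) * inverse (\<epsilon> * \<epsilon>) ^ n"
    unfolding half[symmetric] \<kappa>_def by (simp add: power_mult_distrib ac_simps)
  ultimately have "\<kappa> * \<kappa> * (\<beta> (- 1) ^ n * ?q ^ n) = ?q ^ (n * (n - 1))"
    by (simp only: mult.assoc mult_1_right)
  moreover have ex: "k\<^sup>2 + (n - k)\<^sup>2 + n * (n - 1) = n + 2 * (k * (k - 1) + (k * j + j * (j - 1)))"
    unfolding n by (cases k; cases j) (simp_all add: power2_eq_square algebra_simps)
  ultimately have "\<kappa> * \<kappa> * (\<beta> (- 1) ^ n * ?q ^ n) * ?q ^ (k\<^sup>2 + (n - k)\<^sup>2) =
      ?q ^ n * ?q ^ (2 * (k * (k - 1) + (k * j + j * (j - 1))))"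
    by (simp only: power_add[symmetric] add.commute)
  then have "?q ^ n * (\<kappa> * \<kappa> * (\<beta> (- 1) ^ n * ?q ^ (k\<^sup>2 + (n - k)\<^sup>2))) =
      ?q ^ n * ?q ^ (2 * (k * (k - 1) + (k * j + j * (j - 1))))"
    by (simp only: mult_ac)
  then show ?thesis unfolding zz using q by simp
qed

theorem intertwiner_square_spectrum:
  "diagonalizable_on V (I \<circ> I)"
  "eigenvalues_on V (I \<circ> I) = {\<beta> (- 1) ^ n * of_nat CARD('a) ^ (k\<^sup>2 + (n - k)\<^sup>2) | k. k \<le> n}"
proof -
  have kk: "\<kappa> * \<kappa> \<noteq> 0" using \<kappa>_nz by simp
  have I2: "(\<lambda>f. fscale (\<kappa> * \<kappa>) ((I \<circ> I) f)) = I2" by (simp add: I2_def fun_eq_iff)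
  show "diagonalizable_on V (I \<circ> I)"
    using rescaled_operator(1)[OF kk, of V "I \<circ> I"] I2_diagonalizable unfolding I2 .
  have "eigenvalues_on V (I \<circ> I) = {c. \<exists>k\<le>n. \<kappa> * \<kappa> * c = of_int ((zmat CARD('a) n k k)\<^sup>2)}"
    unfolding rescaled_operator(2)[OF kk, of V "I \<circ> I"] I2 I2_eigenvalues by blast
  also have "\<dots> = {\<beta> (- 1) ^ n * of_nat CARD('a) ^ (k\<^sup>2 + (n - k)\<^sup>2) | k. k \<le> n}"
    using kk \<kappa>_eigenvalue by auto
  finally show "eigenvalues_on V (I \<circ> I) = \<dots>" .
qed

end

theorem theorem4p5p3:
  fixes n q :: nat
    and \<chi> :: "'a::{field,finite} mat \<Rightarrow> complex"
    and \<alpha> \<beta> :: "'a \<Rightarrow> complex"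
  assumes "q = CARD('a)" and "odd q" and "\<not> 3 dvd q" and "n \<ge> 1"
    and "\<chi> \<in> hom (siegel_group n) mult_group"
    and "\<alpha> \<in> hom mult_group mult_group"
    and "\<beta> \<in> hom mult_group mult_group"
    and "\<forall>p\<in>siegel_parabolic n. \<chi> p = \<alpha> (mult_char n p) * \<beta> (chi_det n p)"
    and "\<forall>x. x \<noteq> 0 \<longrightarrow> \<beta> x ^ 2 = 1" and "\<exists>x. x \<noteq> 0 \<and> \<beta> x \<noteq> 1"
  shows "(\<forall>m. n = 2 * m \<longrightarrow>
            diagonalizable_on (induced n \<chi>) (intertwiner n \<circ> intertwiner n) \<and>
            eigenvalues_on (induced n \<chi>) (intertwiner n \<circ> intertwiner n) =
              {of_nat q ^ (2 * m ^ 2 + 2 * i ^ 2) | i. i \<le> m}) \<and>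
         (\<forall>m. n = 2 * m + 1 \<longrightarrow>
            diagonalizable_on (induced n \<chi>) (intertwiner n \<circ> intertwiner n) \<and>
            eigenvalues_on (induced n \<chi>) (intertwiner n \<circ> intertwiner n) =
              {\<beta> (- 1) * of_nat q ^ (2 * m * (m + 1) + 2 * i * (i + 1) + 1) | i. i \<le> m})"
proof -
  define \<epsilon> where "\<epsilon> = csqrt (\<beta> (- 1) * of_nat CARD('a))"
  have \<beta>m: "\<beta> (x * y) = \<beta> x * \<beta> y" if "x \<noteq> 0" "y \<noteq> 0" for x y
    using assms(7) that by (auto simp: hom_def mult_group_def)
  interpret sign_char \<beta> \<epsilon>
  proof
    show "\<epsilon> * \<epsilon> = \<beta> (- 1) * of_nat CARD('a)"
      unfolding \<epsilon>_def by (simp flip: power2_eq_square)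
  qed (use \<beta>m assms(9,10) in \<open>auto simp: power2_eq_square\<close>)
  have "\<alpha> 1 * \<alpha> 1 = \<alpha> 1" "\<alpha> 1 \<noteq> 0"
    using assms(6) hom_mult[of \<alpha> mult_group mult_group 1 1]
    by (auto simp: mult_group_def hom_def Pi_iff)
  then have \<alpha>1: "\<alpha> 1 = 1" by simp
  \<comment> \<open>A block matrix whose diagonal blocks are inverse transposes of each other has multiplier $1$, so $\alpha$ contributes
    $\alpha(1) = 1$.\<close>
  interpret siegel_character \<beta> \<epsilon> n \<chi>
  proof
    fix p p' :: "'a mat" assume "p \<in> siegel_parabolic n" "p' \<in> siegel_parabolic n"
    then show "\<chi> (p * p') = \<chi> p * \<chi> p'"
      using assms(5) by (auto simp: hom_def siegel_group_def mult_group_def GSp_def)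
  next
    fix D' D B :: "'a mat"
    assume D: "(D', D) \<in> levi_pairs n" and B: "B \<in> carrier_mat n n"
      and G: "four_block_mat D' B (0\<^sub>m n n) D \<in> carrier (GSp n)"
    let ?p = "four_block_mat D' B (0\<^sub>m n n) D"
    have c: "D' \<in> carrier_mat n n" "D \<in> carrier_mat n n" "transpose_mat D' * D = 1\<^sub>m n"
      using D by (auto simp: levi_pairs_def)
    have c2: "D * transpose_mat D' = 1\<^sub>m n"
      by (rule mat_mult_left_right_inverse[OF _ c(2,3)]) (use c(1) in simp)
    have P: "?p \<in> siegel_parabolic n"
      unfolding siegel_parabolic_def
      by (rule CollectI, rule conjI[OF G], rule bexI[OF bexI[OF bexI[OF refl c(2)] B] c(1)])
    have "\<exists>A\<in>carrier_mat n n. \<exists>B\<in>carrier_mat n n. \<exists>D\<in>carrier_mat n n.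
       inverts_mat (transpose_mat A) D \<and> inverts_mat D (transpose_mat A) \<and>
       ?p = four_block_mat (1 \<cdot>\<^sub>m A) B (0\<^sub>m n n) D"
    proof (rule bexI[OF bexI[OF bexI[OF _ c(2)] B] c(1)])
      show "inverts_mat (transpose_mat D') D \<and> inverts_mat D (transpose_mat D') \<and>
          ?p = four_block_mat (1 \<cdot>\<^sub>m D') B (0\<^sub>m n n) D"
        using c c2 unfolding inverts_mat_def one_smult_m by auto
    qed
    then have "mult_char n ?p = 1"
      unfolding mult_char_def by (intro the1_equality[OF mult_char_unique[OF assms(4) P]])
    moreover have "chi_det n ?p = inverse (det D)"
      using c B by (simp add: chi_det_def split_block_four_block)
    moreover have "det D \<noteq> 0" using levi_pairs_det[OF D] by auto
    ultimately show "\<chi> ?p = \<beta> (det D)" using assms(8) P \<alpha>1 by (simp add: \<beta>_inverse)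
  qed
  note spec = intertwiner_square_spectrum
  have b2: "\<beta> (- 1) ^ (2 * m) = 1" for m
    using \<beta>_m1_sq by (simp add: power_mult power2_eq_square)
  show ?thesis
  proof (intro conjI allI impI)
    fix m assume n: "n = 2 * m"
    have "{\<beta> (- 1) ^ n * of_nat CARD('a) ^ (k\<^sup>2 + (n - k)\<^sup>2) | k. k \<le> n} =
        {of_nat q ^ (2 * m ^ 2 + 2 * i ^ 2) | i. i \<le> m}" (is "?L = ?R")
    proof -
      \<comment> \<open>The indices $k = m + i$ and $k = m - i$ belong to the same eigenvalue.\<close>
      have e: "(m + i)\<^sup>2 + (n - (m + i))\<^sup>2 = 2 * m ^ 2 + 2 * i ^ 2"
        "(m - i)\<^sup>2 + (n - (m - i))\<^sup>2 = 2 * m ^ 2 + 2 * i ^ 2" if im: "i \<le> m" for i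
      proof -
        obtain j where j: "m = i + j" using im by (metis le_Suc_ex)
        show "(m + i)\<^sup>2 + (n - (m + i))\<^sup>2 = 2 * m ^ 2 + 2 * i ^ 2"
          "(m - i)\<^sup>2 + (n - (m - i))\<^sup>2 = 2 * m ^ 2 + 2 * i ^ 2"
          unfolding n j by (simp_all add: power2_eq_square algebra_simps)
      qed
      have "\<exists>i\<le>m. k\<^sup>2 + (n - k)\<^sup>2 = 2 * m ^ 2 + 2 * i ^ 2" if "k \<le> n" for k
      proof (cases "k \<le> m")
        case True
        then show ?thesis using e(2)[of "m - k"] by (intro exI[of _ "m - k"]) simp
      next
        case False
        then show ?thesis using e(1)[of "k - m"] that n by (intro exI[of _ "k - m"]) simp
      qed
      then have "?L \<subseteq> ?R" using b2[of m] assms(1) n by fastforce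
      moreover have "?R \<subseteq> ?L"
      proof
        fix x assume "x \<in> ?R"
        then obtain i where i: "i \<le> m" "x = of_nat q ^ (2 * m ^ 2 + 2 * i ^ 2)" by blast
        then show "x \<in> ?L" using e(1)[OF i(1)] b2[of m] assms(1) n
          by (intro CollectI exI[of _ "m + i"]) simp
      qed
      ultimately show ?thesis by (rule antisym)
    qed
    then show "eigenvalues_on (induced n \<chi>) (intertwiner n \<circ> intertwiner n) =
        {of_nat q ^ (2 * m ^ 2 + 2 * i ^ 2) | i. i \<le> m}" using spec(2) by simp
  next
    fix m assume n: "n = 2 * m + 1"
    have bn: "\<beta> (- 1) ^ n = \<beta> (- 1)" unfolding n by (simp add: b2)
    have "{\<beta> (- 1) ^ n * of_nat CARD('a) ^ (k\<^sup>2 + (n - k)\<^sup>2) | k. k \<le> n} =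
        {\<beta> (- 1) * of_nat q ^ (2 * m * (m + 1) + 2 * i * (i + 1) + 1) | i. i \<le> m}" (is "?L = ?R")
    proof -
      \<comment> \<open>Here $k = m + 1 + i$ and $k = m - i$ are the pairs with $k$ and $n - k$ exchanged.\<close>
      have e: "(m + 1 + i)\<^sup>2 + (n - (m + 1 + i))\<^sup>2 = 2 * m * (m + 1) + 2 * i * (i + 1) + 1"
        "(m - i)\<^sup>2 + (n - (m - i))\<^sup>2 = 2 * m * (m + 1) + 2 * i * (i + 1) + 1" if im: "i \<le> m" for i
      proof -
        obtain j where j: "m = i + j" using im by (metis le_Suc_ex)
        show "(m + 1 + i)\<^sup>2 + (n - (m + 1 + i))\<^sup>2 = 2 * m * (m + 1) + 2 * i * (i + 1) + 1"
          "(m - i)\<^sup>2 + (n - (m - i))\<^sup>2 = 2 * m * (m + 1) + 2 * i * (i + 1) + 1"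
          unfolding n j by (simp_all add: power2_eq_square algebra_simps)
      qed
      have "\<exists>i\<le>m. k\<^sup>2 + (n - k)\<^sup>2 = 2 * m * (m + 1) + 2 * i * (i + 1) + 1" if "k \<le> n" for k
      proof (cases "k \<le> m")
        case True
        then show ?thesis using e(2)[of "m - k"] by (intro exI[of _ "m - k"]) simp
      next
        case False
        then show ?thesis using e(1)[of "k - m - 1"] that n by (intro exI[of _ "k - m - 1"]) simp
      qed
      then have "?L \<subseteq> ?R" using bn assms(1) by fastforce
      moreover have "?R \<subseteq> ?L"
      proof
        fix x assume "x \<in> ?R"
        then obtain i where i: "i \<le> m" "x = \<beta> (- 1) * of_nat q ^ (2 * m * (m + 1) + 2 * i * (i + 1) + 1)" by blast
        then show "x \<in> ?L" using e(1)[OF i(1)] bn assms(1) n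
          by (intro CollectI exI[of _ "m + 1 + i"]) simp
      qed
      ultimately show ?thesis by (rule antisym)
    qed
    then show "eigenvalues_on (induced n \<chi>) (intertwiner n \<circ> intertwiner n) =
        {\<beta> (- 1) * of_nat q ^ (2 * m * (m + 1) + 2 * i * (i + 1) + 1) | i. i \<le> m}" using spec(2) by simp
  qed (use spec(1) in \<open>simp_all\<close>)
qed

end
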